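(* Let $p\in(1,\infty)$, let $(X,d,m)$ be a $p$-PI space, and let $f\in L^p(m)$. Then $f\in W^{1,p}(X)$ if and only if both $$\sup_{\delta\in(0,1)}\iint_{\{(x,y):|f(x)-f(y)|\le1\}}\frac{\delta\,|f(x)-f(y)|^{p+\delta}}{m(B_{d(x,y)}(x))\,d(x,y)^p}\,dm(y)\,dm(x)<\infty$$ and $$\iint_{\{(x,y):|f(x)-f(y)|>1\}}\frac{1}{m(B_{d(x,y)}(x))\,d(x,y)^p}\,dm(y)\,dm(x)<\infty.$$
   Context: A metric measure space $(X,d,m)$ is a complete separable metric space $(X,d)$ with a Borel measure $m$ that is finite on balls; $B_r(x)$ is the ball of radius $r$ and center $x$. In the first double integral the integrand is read as $0$ when $x=y$. $\mathrm{LIP}_{bs}(X)$ denotes the real-valued Lipschitz functions on $X$ with bounded support. The slope of a Lipschitz function $g$ is $\mathrm{lip}(g)(x)=\limsup_{y\to x}\frac{|g(x)-g(y)|}{d(x,y)}$, with value $0$ if $x$ is isolated. For $p\in(1,\infty)$ and $f\in L^p(m)$, $$\mathrm{Ch}_p(f)=\inf\Big\{\liminf_k\int_X\mathrm{lip}(f_k)^p\,dm:\ f_k\in\mathrm{LIP}_{bs}(X)\cap L^p(m),\ f_k\to f\text{ in }L^p(m)\Big\},$$ and $W^{1,p}(X)=\{f\in L^p(m):\mathrm{Ch}_p(f)<\infty\}$. $(X,d,m)$ is uniformly doubling if there is $C_D>0$ with $m(B_{2r}(x))\le C_D\,m(B_r(x))$ for all $x\in X$, $r>0$. It supports a $(1,p)$-Poincaré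 inequality if there is $C_P>0$ such that for every $f\in\mathrm{LIP}_{bs}(X)$, $x\in X$, $r>0$, $$\frac1{m(B_r(x))}\int_{B_r(x)}|f-f_{B_r(x)}|\,dm\le C_P\,r\Big(\frac1{m(B_r(x))}\int_{B_r(x)}\mathrm{lip}(f)^p\,dm\Big)^{1/p},$$ where $f_{B_r(x)}=\frac1{m(B_r(x))}\int_{B_r(x)}f\,dm$. A $p$-PI space is a metric measure space that is uniformly doubling and supports a $(1,p)$-Poincaré inequality. *)

theory Defs
  imports "HOL-Analysis.Analysis"
begin

text \<open>The complete separable metric space is the universe of a type of class
  \<^class>\<open>polish_space\<close>, which carries a fixed complete metric with a countable base.
  Balls are open.\<close>

definition metric_measure_space :: "'a::polish_space measure \<Rightarrow> bool" where
  "metric_measure_space m \<longleftrightarrow>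
     sets m = sets borel \<and> (\<forall>x r. emeasure m (ball x r) < \<infinity>)"

definition LIP_bs :: "('a::metric_space \<Rightarrow> real) set" where
  "LIP_bs = {g. (\<exists>L. L-lipschitz_on UNIV g) \<and> bounded (closure {x. g x \<noteq> 0})}"

text \<open>A point \<open>x\<close> is isolated iff \<open>at x = bot\<close>. The limit superior is taken in
  \<^typ>\<open>ereal\<close>; for Lipschitz \<open>g\<close> it lies between 0 and the Lipschitz constant at
  every non-isolated point, so the conversion to \<^typ>\<open>real\<close> loses nothing.\<close>

definition slope :: "('a::metric_space \<Rightarrow> real) \<Rightarrow> 'a \<Rightarrow> real" where
  "slope g x =
     (if at x = bot then 0
      else real_of_ereal (Limsup (at x) (\<lambda>y. ereal (\<bar>g x - g y\<bar> / dist x y))))"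

text \<open>Elements of \<open>L\<^sup>p\<close> are represented by Borel functions rather than by
  classes modulo null sets; \<open>Ch p m f\<close> depends only on the class of \<open>f\<close>.\<close>

definition Lp :: "real \<Rightarrow> 'a measure \<Rightarrow> ('a \<Rightarrow> real) set" where
  "Lp p m = {f \<in> borel_measurable m. integrable m (\<lambda>x. \<bar>f x\<bar> powr p)}"

definition Lp_norm :: "real \<Rightarrow> 'a measure \<Rightarrow> ('a \<Rightarrow> real) \<Rightarrow> real" where
  "Lp_norm p m f = (\<integral>x. \<bar>f x\<bar> powr p \<partial>m) powr (1 / p)"

text \<open>Only meaningful for \<open>f \<in> Lp p m\<close>, where all differences \<open>u k - f\<close> are again
  in \<open>Lp p m\<close> (otherwise the Bochner integral in \<^const>\<open>Lp_norm\<close> defaults to 0).\<close>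

definition Ch :: "real \<Rightarrow> 'a::metric_space measure \<Rightarrow> ('a \<Rightarrow> real) \<Rightarrow> ennreal" where
  "Ch p m f =
     Inf {liminf (\<lambda>k. \<integral>\<^sup>+x. ennreal (slope (u k) x powr p) \<partial>m) | u.
            (\<forall>k. u k \<in> LIP_bs \<inter> Lp p m) \<and>
            (\<lambda>k. Lp_norm p m (\<lambda>x. u k x - f x)) \<longlonglongrightarrow> 0}"

definition W1p :: "real \<Rightarrow> 'a::metric_space measure \<Rightarrow> ('a \<Rightarrow> real) set" where
  "W1p p m = {f \<in> Lp p m. Ch p m f < \<infinity>}"

definition uniformly_doubling :: "'a::metric_space measure \<Rightarrow> bool" where
  "uniformly_doubling m \<longleftrightarrow>
     (\<exists>C>0. \<forall>x. \<forall>r>0. measure m (ball x (2 * r)) \<le> C * measure m (ball x r))"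

definition ball_avg :: "'a::metric_space measure \<Rightarrow> 'a \<Rightarrow> real \<Rightarrow> ('a \<Rightarrow> real) \<Rightarrow> real" where
  "ball_avg m x r g = 1 / measure m (ball x r) * (LINT y:ball x r|m. g y)"

definition poincare_inequality :: "real \<Rightarrow> 'a::metric_space measure \<Rightarrow> bool" where
  "poincare_inequality p m \<longleftrightarrow>
     (\<exists>C>0. \<forall>g\<in>LIP_bs. \<forall>x. \<forall>r>0.
        ball_avg m x r (\<lambda>y. \<bar>g y - ball_avg m x r g\<bar>)
          \<le> C * r * ball_avg m x r (\<lambda>y. slope g y powr p) powr (1 / p))"

definition PI_space :: "real \<Rightarrow> 'a::polish_space measure \<Rightarrow> bool" where
  "PI_space p m \<longleftrightarrow>
     metric_measure_space m \<and> uniformly_doubling m \<and> poincare_inequality p m"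

end

theory Submission
  imports Defs
begin

text \<open>
  Suppose first that both double integrals are finite, and clip \<open>f\<close> to \<open>[-N, N]\<close>. The pairs with
  \<open>|f x - f y| > 1\<close> then contribute at most \<open>\<delta> (2N)\<^sup>p\<^sup>+\<^sup>\<delta>\<close> times the second integral, which vanishes
  as \<open>\<delta>\<close> tends to 0. Cutting the first integral into dyadic scales shows that a \<open>\<delta> 2\<^sup>-\<^sup>j\<^sup>\<delta>\<close>-weighted
  average of the scale-\<open>2\<^sup>-\<^sup>j\<close> energies of the clipped function is bounded independently of \<open>\<delta>\<close>;
  for small \<open>\<delta>\<close> the weight sits on small scales, so arbitrarily small scales have bounded energy.
  Mollifying at such scales and cutting off gives the sequence required in \<^const>\<open>Ch\<close>.

  Conversely, it suffices to find for every Lipschitz \<open>u\<close> a function \<open>G\<close> with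
  \<open>|u x - u y| \<le> d(x, y) max (G x) (G y)\<close> and \<open>\<integral> G\<^sup>p \<le> K \<integral> lip(u)\<^sup>p\<close>, and then to use Fatou's lemma.
  The weak-type bound for the level sets of \<open>G\<close> that the Poincare inequality gives directly misses
  this by a logarithm. As in the Keith--Zhong theorem, the inequality is instead applied to the mean
  \<open>h\<close> of \<open>k\<close> Lipschitz truncations of \<open>u\<close> at the heights \<open>2\<^sup>j \<lambda>\<close>, \<open>k \<le> j < 2k\<close>. The truncated
  regions enter the bound for the level \<open>\<lambda>\<close> with the factor \<open>k\<^sup>-\<^sup>p\<close>, and summation over dyadic
  levels counts each of them \<open>k\<close> times; as \<open>p > 1\<close>, the total factor \<open>k\<^sup>1\<^sup>-\<^sup>p\<close> is small and these terms
  are absorbed. Working with mollified functions makes a truncation agree with the function in a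
  whole neighbourhood of its good set, so no density points are needed.
\<close>

section \<open>Coverings and doubling measures\<close>

text \<open>The logarithm comes from the Poincare exponent being \<open>p\<close> itself: the
  maximal function of \<open>gh powr p\<close> is only of weak type, and bounding
  \<open>lam powr p\<close> times the measure of the bad set by the integral of
  \<open>gh powr p\<close> over \<open>gh > c * lam\<close> counts a point once for every dyadic
  level below its gradient. Truncation caps the gradient, up to a factor depending on
  \<open>k\<close>, by \<open>lam\<close> itself. The right side then is \<open>lam powr p\<close>
  times the measure of \<open>gh > c0 * lam\<close>, and its dyadic sum is a layer-cake sum. What
  remains lives on bad sets of higher levels and is of the same kind as the left side; subtracting
  it requires finite sums. Hence the argument is run for bounded Lipschitz functions of bounded
  support, from a positive lowest level on. Their Lipschitz constants only guarantee that high
  levels have no bad points and never enter the final constant. For the implication from finite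
  integrals to Sobolev regularity, the exponents \<open>p + \<delta>\<close> and \<open>p\<close>
  are compared scale by scale at a threshold proportional to the scale, so that the loss is the same
  at every scale and costs only the measure of a fixed ball.\<close>

lemma vitali_balls:
  fixes a :: "'i \<Rightarrow> 'b::{metric_space, second_countable_topology}" and r :: "'i \<Rightarrow> real"
  assumes K: "\<And>i. i \<in> K \<Longrightarrow> 0 < r i \<and> r i \<le> R"
  obtains C where "C \<subseteq> K" "countable C" "disjoint_family_on (\<lambda>i. ball (a i) (r i)) C"
    "\<And>i. i \<in> K \<Longrightarrow> \<exists>j\<in>C. ball (a i) (r i) \<subseteq> ball (a j) (5 * r j)"
proof -
  define B where "B i = ball (a i) (r i)" for i
  \<comment> \<open>Zorn's lemma replaces a greedy choice of radii: a ball that meets the family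
    must meet a member of at least half its radius. A maximal family meets every ball, since
    otherwise one could add a missed ball whose radius exceeds half the supremum of the missed
    radii.\<close>
  define good where "good D \<longleftrightarrow> D \<subseteq> K \<and> disjoint_family_on B D \<and>
    (\<forall>i\<in>K. (\<exists>j\<in>D. B i \<inter> B j \<noteq> {}) \<longrightarrow> (\<exists>j\<in>D. B i \<inter> B j \<noteq> {} \<and> r i \<le> 2 * r j))" for D
  have "\<exists>D\<in>Collect good. \<forall>X\<in>Collect good. D \<subseteq> X \<longrightarrow> X = D"
  proof (rule Zorn_Lemma, safe)
    fix \<C> assume \<C>: "\<C> \<in> chains (Collect good)"
    then have ch: "\<And>X Y. X \<in> \<C> \<Longrightarrow> Y \<in> \<C> \<Longrightarrow> X \<subseteq> Y \<or> Y \<subseteq> X" and g: "\<And>X. X \<in> \<C> \<Longrightarrow> good X"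
      by (auto simp: chains_def chain_subset_def)
    have "disjoint_family_on B (\<Union>\<C>)"
      unfolding disjoint_family_on_def
    proof (intro ballI impI)
      fix i j assume "i \<in> \<Union>\<C>" "j \<in> \<Union>\<C>" "i \<noteq> j"
      then obtain X where "X \<in> \<C>" "i \<in> X" "j \<in> X" using ch by blast
      with g[of X] \<open>i \<noteq> j\<close> show "B i \<inter> B j = {}"
        by (auto simp: good_def disjoint_family_on_def)
    qed
    moreover have "\<Union>\<C> \<subseteq> K" using g unfolding good_def by blast
    moreover have "\<exists>j\<in>\<Union>\<C>. B i \<inter> B j \<noteq> {} \<and> r i \<le> 2 * r j" if "i \<in> K" "\<exists>j\<in>\<Union>\<C>. B i \<inter> B j \<noteq> {}" for i
    proof -
      from that(2) obtain X j where "X \<in> \<C>" "j \<in> X" "B i \<inter> B j \<noteq> {}" by blast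
      with g[of X] that(1) show ?thesis unfolding good_def by blast
    qed
    ultimately show "good (\<Union>\<C>)" unfolding good_def by blast
  qed
  then obtain D where D: "good D" and mx: "\<And>X. good X \<Longrightarrow> D \<subseteq> X \<Longrightarrow> X = D" by blast
  have meet: "\<exists>j\<in>D. B i \<inter> B j \<noteq> {}" if "i \<in> K" for i
  proof (rule ccontr)
    assume no: "\<not> ?thesis"
    define S where "S = {i \<in> K. \<forall>j\<in>D. B i \<inter> B j = {}}"
    have "i \<in> S" using no that by (auto simp: S_def)
    have bd: "bdd_above (r ` S)" using K by (auto simp: S_def bdd_above_def)
    have pos: "0 < Sup (r ` S)"
      using K[OF that] cSUP_upper[OF \<open>i \<in> S\<close> bd] by linarith
    then have "Sup (r ` S) / 2 < Sup (r ` S)" by simp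
    then obtain k where k: "k \<in> S" "Sup (r ` S) / 2 < r k"
      using less_cSUP_iff[OF _ bd] \<open>i \<in> S\<close> by blast
    have kK: "k \<in> K" using k by (auto simp: S_def)
    have "good (insert k D)"
      unfolding good_def
    proof (intro conjI ballI impI)
      show "insert k D \<subseteq> K" using D kK by (auto simp: good_def)
      show "disjoint_family_on B (insert k D)"
        using D k(1) by (auto simp: good_def S_def disjoint_family_on_def)
      fix l assume l: "l \<in> K" "\<exists>j\<in>insert k D. B l \<inter> B j \<noteq> {}"
      show "\<exists>j\<in>insert k D. B l \<inter> B j \<noteq> {} \<and> r l \<le> 2 * r j"
      proof (cases "l \<in> S")
        case True
        then have "r l \<le> Sup (r ` S)" using bd by (intro cSUP_upper)
        moreover have "B l \<inter> B k \<noteq> {}" using True l(2) by (auto simp: S_def)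
        ultimately show ?thesis using k(2) by auto
      next
        case False
        then show ?thesis using D l(1) unfolding good_def S_def by blast
      qed
    qed
    then have "insert k D = D" by (intro mx) auto
    moreover have "a k \<in> B k" using K[OF kK] by (simp add: B_def)
    ultimately show False using k(1) by (auto simp: S_def)
  qed
  have DK: "D \<subseteq> K" and dj: "disjoint_family_on B D" using D by (auto simp: good_def)
  have ne: "B j \<noteq> {}" if "j \<in> D" for j using K[of j] DK that by (auto simp: B_def)
  have "inj_on B D"
    by (rule inj_onI) (use dj ne in \<open>metis Int_absorb disjoint_family_on_def\<close>)
  moreover have "countable (B ` D)"
  proof (rule countable_disjoint_open_subsets)
    show "pairwise disjnt (B ` D)"
      unfolding pairwise_image using dj
      by (auto simp: pairwise_def disjnt_def disjoint_family_on_def)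
  qed (auto simp: B_def)
  ultimately have "countable D" by (simp add: countable_image_inj_eq)
  moreover have "\<exists>j\<in>D. ball (a i) (r i) \<subseteq> ball (a j) (5 * r j)" if i: "i \<in> K" for i
  proof -
    obtain j where j: "j \<in> D" "B i \<inter> B j \<noteq> {}" "r i \<le> 2 * r j"
      using D meet[OF i] i unfolding good_def by blast
    then obtain z where z: "dist (a i) z < r i" "dist (a j) z < r j" by (auto simp: B_def)
    have "ball (a i) (r i) \<subseteq> ball (a j) (5 * r j)"
    proof
      fix y assume "y \<in> ball (a i) (r i)"
      then have "dist (a i) y < r i" by simp
      moreover have "dist (a j) y \<le> dist (a j) z + dist z (a i) + dist (a i) y"
        by metric
      ultimately have "dist (a j) y < 5 * r j" using z j(3) by (simp add: dist_commute)
      then show "y \<in> ball (a j) (5 * r j)" by simp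
    qed
    with j show ?thesis by blast
  qed
  ultimately show ?thesis using that[of D] DK dj by (simp add: B_def[abs_def])
qed

section \<open>Doubling measures and a weak-type bound\<close>

locale doubling_space =
  fixes m :: "'a::polish_space measure" and D :: real
  assumes sets_m [measurable_cong]: "sets m = sets borel"
    and finite_ball: "emeasure m (ball x r) < \<infinity>"
    and doubling: "0 < r \<Longrightarrow> measure m (ball x (2 * r)) \<le> D * measure m (ball x r)"
    and ball_pos: "0 < r \<Longrightarrow> 0 < measure m (ball x r)"
begin

abbreviation V :: "'a \<Rightarrow> real \<Rightarrow> real" where "V x r \<equiv> measure m (ball x r)"

lemma space_m [simp]: "space m = UNIV"
  using sets_eq_imp_space_eq[OF sets_m] by simp

lemma emeasure_ball: "emeasure m (ball x r) = ennreal (V x r)"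
  using finite_ball[of x r] by (intro emeasure_eq_ennreal_measure) auto

lemma ball_sets [measurable]: "ball x r \<in> sets m"
  by (simp add: sets_m)

lemma ball_fmeasurable: "ball x r \<in> fmeasurable m"
  using finite_ball[of x r] by (intro fmeasurableI) auto

lemma V_mono: "ball x r \<subseteq> ball y t \<Longrightarrow> V x r \<le> V y t"
  by (rule measure_mono_fmeasurable) (auto intro: ball_fmeasurable)

lemma V_mono': "dist x y + r \<le> t \<Longrightarrow> V x r \<le> V y t"
proof (rule V_mono, rule subsetI)
  fix z assume "dist x y + r \<le> t" "z \<in> ball x r"
  moreover have "dist y z \<le> dist x y + dist x z" by metric
  ultimately show "z \<in> ball y t" by simp
qed

lemma D_ge_1: "1 \<le> D"
proof -
  obtain x :: 'a where True by blast
  have "V x 1 \<le> V x (2 * 1)" by (rule V_mono') auto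
  also have "\<dots> \<le> D * V x 1" by (rule doubling) auto
  finally show ?thesis using ball_pos[of 1 x] by simp
qed

lemma doubling_power: "0 < r \<Longrightarrow> V x (2 ^ n * r) \<le> D ^ n * V x r"
proof (induction n)
  case (Suc n)
  have "V x (2 ^ Suc n * r) \<le> D * V x (2 ^ n * r)"
    using doubling[of "2 ^ n * r" x] Suc.prems by (simp add: mult.assoc)
  also have "\<dots> \<le> D * (D ^ n * V x r)"
    using Suc D_ge_1 by (intro mult_left_mono) auto
  finally show ?case by (simp add: mult.assoc)
qed simp

lemma V_compare: "0 < r \<Longrightarrow> dist x y + t \<le> 2 ^ n * r \<Longrightarrow> V x t \<le> D ^ n * V y r"
  using doubling_power[of r y n] V_mono'[of x y t "2 ^ n * r"] by linarith

sublocale sigma_finite_measure m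
proof
  obtain x :: 'a where True by blast
  have "(\<Union>n::nat. ball x (real n)) = UNIV"
    by (auto intro: reals_Archimedean2)
  then show "\<exists>A. countable A \<and> A \<subseteq> sets m \<and> \<Union>A = space m \<and> (\<forall>a\<in>A. emeasure m a \<noteq> \<infinity>)"
    using finite_ball by (intro exI[of _ "range (\<lambda>n::nat. ball x (real n))"]) (auto simp: less_top)
qed

text \<open>The disjoint Vitali balls carry integrals that add up to at most the integral of
  \<open>F\<close>; their fivefold enlargements cover \<open>A\<close>, and
  \<open>5 \<le> 2 ^ 3\<close> costs three doublings. The countable family is indexed by naturals to
  form series.\<close>

lemma weak_type:
  assumes [measurable]: "F \<in> borel_measurable m" "A \<in> sets m"
    and A: "\<And>x. x \<in> A \<Longrightarrow> \<exists>r>0. r \<le> R \<and> ennreal (V x r) \<le> (\<integral>\<^sup>+y\<in>ball x r. F y \<partial>m)"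
  shows "emeasure m A \<le> ennreal (D ^ 3) * (\<integral>\<^sup>+x. F x \<partial>m)"
proof -
  obtain r where r: "\<And>x. x \<in> A \<Longrightarrow> 0 < r x \<and> r x \<le> R \<and> ennreal (V x (r x)) \<le> (\<integral>\<^sup>+y\<in>ball x (r x). F y \<partial>m)"
    using A by metis
  obtain C where C: "C \<subseteq> A" "countable C" "disjoint_family_on (\<lambda>x. ball x (r x)) C"
    "\<And>x. x \<in> A \<Longrightarrow> \<exists>j\<in>C. ball x (r x) \<subseteq> ball j (5 * r j)"
    by (rule vitali_balls[of A r R "\<lambda>x. x"]) (use r in blast)+
  define I where "I = to_nat_on C ` C"
  define c where "c = from_nat_into C"
  have cC: "c n \<in> C" if "n \<in> I" for n
    using that C(2) by (auto simp: I_def c_def)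
  have inj: "n = k" if "n \<in> I" "k \<in> I" "c n = c k" for n k
    using that C(2) by (auto simp: I_def c_def)
  define b where "b n t = (if n \<in> I then ball (c n) (t * r (c n)) else {})" for n t
  have [measurable]: "b n t \<in> sets m" for n t by (auto simp: b_def)
  have "A \<subseteq> (\<Union>n. b n 5)"
  proof
    fix x assume x: "x \<in> A"
    then obtain j where j: "j \<in> C" "ball x (r x) \<subseteq> ball j (5 * r j)" using C(4) by blast
    moreover have "x \<in> ball x (r x)" using r[OF x] by simp
    moreover have "c (to_nat_on C j) = j" "to_nat_on C j \<in> I" using j C(2) by (auto simp: c_def I_def)
    ultimately have "x \<in> b (to_nat_on C j) 5" unfolding b_def using r[OF x] subsetD by fastforce
    then show "x \<in> (\<Union>n. b n 5)" by blast
  qed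
  then have "emeasure m A \<le> emeasure m (\<Union>n. b n 5)"
    by (intro emeasure_mono) auto
  also have "\<dots> \<le> (\<Sum>n. emeasure m (b n 5))"
    by (intro emeasure_subadditive_countably) auto
  also have "\<dots> \<le> (\<Sum>n. ennreal (D ^ 3) * (\<integral>\<^sup>+y. F y * indicator (b n 1) y \<partial>m))"
  proof (intro suminf_le allI)
    fix n
    show "emeasure m (b n 5) \<le> ennreal (D ^ 3) * (\<integral>\<^sup>+y. F y * indicator (b n 1) y \<partial>m)"
    proof (cases "n \<in> I")
      case True
      then have rr: "0 < r (c n)" "ennreal (V (c n) (r (c n))) \<le> (\<integral>\<^sup>+y\<in>ball (c n) (r (c n)). F y \<partial>m)"
        using r cC C(1) by blast+
      have "V (c n) (5 * r (c n)) \<le> D ^ 3 * V (c n) (r (c n))"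
        using rr by (intro V_compare) auto
      then have "emeasure m (b n 5) \<le> ennreal (D ^ 3) * ennreal (V (c n) (r (c n)))"
        using True D_ge_1 by (simp add: b_def emeasure_ball flip: ennreal_mult)
      also have "\<dots> \<le> ennreal (D ^ 3) * (\<integral>\<^sup>+y. F y * indicator (b n 1) y \<partial>m)"
        using True rr by (intro mult_left_mono) (auto simp: b_def)
      finally show ?thesis .
    qed (simp add: b_def)
  qed auto
  also have "\<dots> = ennreal (D ^ 3) * (\<integral>\<^sup>+y. F y * (\<Sum>n. indicator (b n 1) y) \<partial>m)"
    by (simp add: nn_integral_suminf[symmetric])
  also have "\<dots> \<le> ennreal (D ^ 3) * (\<integral>\<^sup>+y. F y \<partial>m)"
  proof (intro mult_left_mono nn_integral_mono)
    fix y
    have "disjoint_family (\<lambda>n. b n 1)"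
      unfolding disjoint_family_on_def
    proof (intro ballI impI)
      fix n k :: nat assume "n \<noteq> k"
      then have "ball (c n) (r (c n)) \<inter> ball (c k) (r (c k)) = {}" if "n \<in> I" "k \<in> I"
        using C(3) inj[OF that] cC[OF that(1)] cC[OF that(2)] unfolding disjoint_family_on_def by blast
      then show "b n 1 \<inter> b k 1 = {}" by (simp add: b_def)
    qed
    then have "(\<Sum>n. indicator (b n 1) y) = (indicator (\<Union>n. b n 1) y :: ennreal)"
      by (rule suminf_indicator)
    then show "F y * (\<Sum>n. indicator (b n 1) y) \<le> F y"
      by (auto simp: indicator_def split: if_splits)
  qed auto
  finally show ?thesis .
qed

lemma V_measurable [measurable]: "(\<lambda>x. V x r) \<in> borel_measurable m"
  "(\<lambda>(x, y). V x (dist x y)) \<in> borel_measurable (m \<Otimes>\<^sub>M m)"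
proof -
  have *: "(\<lambda>x. \<integral>\<^sup>+z. indicator {z. dist x z < r} z \<partial>m) \<in> borel_measurable m"
    unfolding indicator_def by measurable
  have "V x r = enn2real (\<integral>\<^sup>+z. indicator {z. dist x z < r} z \<partial>m)" for x
    by (subst nn_integral_indicator) (auto simp: ball_def[symmetric] measure_def)
  with * show "(\<lambda>x. V x r) \<in> borel_measurable m" by simp
  have *: "(\<lambda>(x, y). \<integral>\<^sup>+z. indicator {z. dist x z < dist x y} z \<partial>m) \<in> borel_measurable (m \<Otimes>\<^sub>M m)"
    unfolding indicator_def by measurable
  have "V x (dist x y) = enn2real (\<integral>\<^sup>+z. indicator {z. dist x z < dist x y} z \<partial>m)" for x y
    by (subst nn_integral_indicator) (auto simp: ball_def[symmetric] measure_def)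
  with * show "(\<lambda>(x, y). V x (dist x y)) \<in> borel_measurable (m \<Otimes>\<^sub>M m)"
    by (simp add: split_beta')
qed

end

section \<open>Slopes and mollification\<close>

lemma slope_bounds:
  assumes "0 < \<eta>" "0 \<le> c" "\<And>y. dist x y < \<eta> \<Longrightarrow> \<bar>g x - g y\<bar> \<le> c * dist x y"
  shows "0 \<le> slope g x" "slope g x \<le> c"
proof -
  have "0 \<le> slope g x \<and> slope g x \<le> c"
  proof (cases "at x = bot")
    case False
    let ?q = "\<lambda>y. ereal (\<bar>g x - g y\<bar> / dist x y)"
    have "\<forall>\<^sub>F y in at x. ?q y \<le> ereal c"
      unfolding eventually_at
    proof (intro exI[of _ \<eta>] conjI ballI impI)
      fix y assume "y \<noteq> x \<and> dist y x < \<eta>"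
      then show "?q y \<le> ereal c"
        using assms(2) assms(3)[of y] by (simp add: dist_commute divide_le_eq)
    qed (use assms in auto)
    then have 1: "Limsup (at x) ?q \<le> ereal c" by (rule Limsup_bounded)
    have 2: "0 \<le> Limsup (at x) ?q" using False by (intro le_Limsup) auto
    show ?thesis using False 1 2 assms(2)
      by (cases "Limsup (at x) ?q") (auto simp: slope_def)
  qed (use assms in \<open>auto simp: slope_def\<close>)
  then show "0 \<le> slope g x" "slope g x \<le> c" by auto
qed

lemma lipschitz_abs_diff:
  assumes "L-lipschitz_on UNIV g" shows "\<bar>g x - g y\<bar> \<le> L * dist x y"
  using lipschitz_onD[OF assms, of x y] by (simp add: dist_real_def)

lemma slope_lipschitz:
  assumes "L-lipschitz_on UNIV g" shows "0 \<le> slope g x" "slope g x \<le> L"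
  using slope_bounds[of 1 L x g] lipschitz_abs_diff[OF assms, of x] lipschitz_on_nonneg[OF assms] by auto

text \<open>The limit superior is a countable infimum of suprema over punctured balls of radius
  \<open>1 / Suc n\<close>. Each supremum is lower semicontinuous: if it exceeds \<open>a\<close>
  through some \<open>y\<close>, continuity of \<open>g\<close> keeps that quotient above
  \<open>a\<close> at nearby points. The isolated points form an open set.\<close>

lemma slope_measurable:
  fixes g :: "'a::metric_space \<Rightarrow> real"
  assumes "continuous_on UNIV g"
  shows "slope g \<in> borel_measurable borel"
proof -
  let ?q = "\<lambda>x y. ereal (\<bar>g x - g y\<bar> / dist x y)"
  define S where "S e x = (SUP y\<in>ball x e - {x}. ?q x y)" for e x
  have Smono: "S e x \<le> S e' x" if "e \<le> e'" for e e' x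
    unfolding S_def using that by (intro SUP_subset_mono) auto
  have "Limsup (at x) (?q x) = (INF n::nat. S (1 / Suc n) x)" for x
  proof -
    have "(INF e\<in>{0<..}. S e x) = (INF n::nat. S (1 / Suc n) x)"
    proof (rule antisym)
      show "(INF e\<in>{0<..}. S e x) \<le> (INF n::nat. S (1 / Suc n) x)"
        by (rule INF_mono) (auto intro!: bexI)
      show "(INF n::nat. S (1 / Suc n) x) \<le> (INF e\<in>{0<..}. S e x)"
      proof (rule INF_mono)
        fix e :: real assume "e \<in> {0<..}"
        then obtain n where "1 / Suc n < e" using nat_approx_posE by auto
        then show "\<exists>n\<in>UNIV. S (1 / Suc n) x \<le> S e x" by (intro bexI[of _ n] Smono) auto
      qed
    qed
    then show ?thesis by (simp add: Limsup_at S_def)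
  qed
  moreover have "S e \<in> borel_measurable borel" for e
  proof (rule borel_measurableI_greater)
    fix a
    have "{x \<in> space borel. a < S e x} = (\<Union>y. ball y e \<inter> ((-{y}) \<inter> (\<lambda>x. \<bar>g x - g y\<bar> / dist x y) -` {t. a < ereal t}))"
      by (auto simp: S_def less_SUP_iff dist_commute)
    moreover have "open {t. a < ereal t}"
      using open_vimage[OF open_greaterThan[of a] continuous_on_ereal[OF continuous_on_id]]
      by (simp add: vimage_def)
    then have "open ((-{y}) \<inter> (\<lambda>x. \<bar>g x - g y\<bar> / dist x y) -` {t. a < ereal t})" for y
      by (intro continuous_open_preimage continuous_intros continuous_on_subset[OF assms]) auto
    then have "open (\<Union>y. ball y e \<inter> ((-{y}) \<inter> (\<lambda>x. \<bar>g x - g y\<bar> / dist x y) -` {t. a < ereal t}))"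
      by (intro open_UN ballI open_Int[OF open_ball])
    ultimately have "open {x \<in> space borel. a < S e x}" by metis
    then show "{x \<in> space borel. a < S e x} \<in> sets borel" by simp
  qed
  ultimately have [measurable]: "(\<lambda>x. Limsup (at x) (?q x)) \<in> borel_measurable borel" by simp
  have "{x::'a. at x = bot} = (\<Union>x\<in>{x. open {x}}. {x})"
    by (auto simp: at_eq_bot_iff)
  moreover have "open \<dots>" by blast
  ultimately have [measurable]: "{x::'a. at x = bot} \<in> sets borel" by simp
  show ?thesis unfolding slope_def[abs_def] by (rule measurable_If) (simp_all, measurable)
qed

lemma LIP_bsI:
  assumes "L-lipschitz_on UNIV g" "\<And>x. R \<le> dist a x \<Longrightarrow> g x = 0"
  shows "g \<in> LIP_bs"
proof -
  have "{x. g x \<noteq> 0} \<subseteq> ball a R" using assms(2) by force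
  then have "bounded (closure {x. g x \<noteq> 0})"
    by (meson bounded_closure bounded_subset bounded_ball)
  with assms(1) show ?thesis by (auto simp: LIP_bs_def)
qed

lemma LIP_bsE:
  fixes g :: "'a::metric_space \<Rightarrow> real"
  assumes "g \<in> LIP_bs"
  obtains L N a R where "L-lipschitz_on UNIV g" "\<And>x. \<bar>g x\<bar> \<le> N" "0 < R" "\<And>x. R \<le> dist a x \<Longrightarrow> g x = 0"
proof -
  obtain L where L: "L-lipschitz_on UNIV g" and b: "bounded (closure {x. g x \<noteq> 0})"
    using assms by (auto simp: LIP_bs_def)
  obtain a :: 'a where True by blast
  have "bounded {x. g x \<noteq> 0}" using b closure_subset bounded_subset by blast
  then obtain e where e: "\<And>x. g x \<noteq> 0 \<Longrightarrow> dist a x \<le> e"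
    by (auto simp: bounded_any_center[of _ a])
  define R where "R = \<bar>e\<bar> + 1"
  have z: "g x = 0" if "R \<le> dist a x" for x using e[of x] that by (force simp: R_def)
  have "\<bar>g x\<bar> \<le> \<bar>g a\<bar> + L * R" for x
  proof (cases "g x = 0")
    case False
    then have "dist a x \<le> R" using z[of x] by force
    then have "L * dist a x \<le> L * R" using lipschitz_on_nonneg[OF L] by (intro mult_left_mono)
    then show ?thesis using lipschitz_abs_diff[OF L, of a x] by linarith
  qed (use lipschitz_on_nonneg[OF L] in \<open>auto simp: R_def\<close>)
  moreover have "0 < R" by (simp add: R_def)
  ultimately show ?thesis using that[OF L _ _ z] by blast
qed

context doubling_space
begin

lemma integrable_bounded_support:
  fixes h :: "'a \<Rightarrow> real"
  assumes [measurable]: "h \<in> borel_measurable m"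
    and "\<And>q. dist x q < R \<Longrightarrow> \<bar>h q\<bar> \<le> N" "\<And>q. R \<le> dist x q \<Longrightarrow> h q = 0"
  shows "integrable m h"
proof (rule Bochner_Integration.integrable_bound)
  show "integrable m (\<lambda>q. N * indicator (ball x R) q)"
    using finite_ball by (intro integrable_mult_right integrable_real_indicator) auto
  show "AE q in m. norm (h q) \<le> norm (N * indicator (ball x R) q :: real)"
    using assms(2,3) by (intro AE_I2) (auto simp: indicator_def not_less intro: order_trans[OF _ abs_ge_self])
qed simp

lemma set_integrable_ball:
  fixes h :: "'a \<Rightarrow> real"
  assumes [measurable]: "h \<in> borel_measurable m" and "\<And>q. \<bar>h q\<bar> \<le> N"
  shows "set_integrable m (ball x R) h"
  unfolding set_integrable_def using assms(2)
  by (intro integrable_bounded_support[of _ x R N]) (auto simp: indicator_def)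

lemma ball_avg_nonneg:
  assumes "\<And>q. 0 \<le> h q" shows "0 \<le> ball_avg m x r h"
  unfolding ball_avg_def set_lebesgue_integral_def
  using assms by (auto intro!: divide_nonneg_nonneg Bochner_Integration.integral_nonneg)

text \<open>Jensen's inequality: averaging Young's inequality for the product
  \<open>h q * A powr (p - 1)\<close>, with \<open>A\<close> the mean of \<open>h\<close>, leaves
  \<open>A powr p / p\<close> on the left after cancellation.\<close>

lemma ball_avg_powr:
  assumes [measurable]: "h \<in> borel_measurable m" and h: "\<And>q. 0 \<le> h q" "\<And>q. h q \<le> N"
    and p: "1 < p" and r: "0 < r"
  shows "ball_avg m x r h powr p \<le> ball_avg m x r (\<lambda>q. h q powr p)"
proof -
  define A where "A = ball_avg m x r h"
  define P where "P = ball_avg m x r (\<lambda>q. h q powr p)"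
  have N: "0 \<le> N" using h[of x] by linarith
  have i1: "set_integrable m (ball x r) h" using h by (intro set_integrable_ball[of _ N]) auto
  have i2: "set_integrable m (ball x r) (\<lambda>q. h q powr p)"
    using h p by (intro set_integrable_ball[of _ "N powr p"]) (auto intro!: powr_mono2)
  have i3: "set_integrable m (ball x r) (\<lambda>_. K)" for K :: real
    by (rule set_integrable_ball[of _ "\<bar>K\<bar>"]) auto
  have A0: "0 \<le> A" unfolding A_def by (rule ball_avg_nonneg[OF h(1)])
  have "A * A powr (p - 1) \<le> P / p + A powr p * (1 - 1 / p)"
  proof -
    have pt: "h q * A powr (p - 1) \<le> h q powr p / p + A powr p * (1 - 1 / p)" for q
    proof -
      have "h q * A powr (p - 1) \<le> h q powr p / p + (A powr (p - 1)) powr (p / (p - 1)) / (p / (p - 1))"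
        using p h by (intro Youngs_inequality) (auto simp: field_simps)
      also have "\<dots> = h q powr p / p + A powr p * (1 - 1 / p)"
      proof -
        have "(p - 1) * (p / (p - 1)) = p" using p by simp
        then have "(A powr (p - 1)) powr (p / (p - 1)) = A powr p" by (simp only: powr_powr)
        moreover have "A powr p / (p / (p - 1)) = A powr p * (1 - 1 / p)" using p by (simp add: field_simps)
        ultimately show ?thesis by (simp only:)
      qed
      finally show ?thesis .
    qed
    have "(LINT q:ball x r|m. h q * A powr (p - 1)) \<le> (LINT q:ball x r|m. h q powr p / p + A powr p * (1 - 1 / p))"
      by (intro set_integral_mono pt set_integral_add set_integrable_mult_left set_integrable_divide i1 i2 i3)
    also have "\<dots> = (LINT q:ball x r|m. h q powr p / p) + (LINT q:ball x r|m. A powr p * (1 - 1 / p))"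
      by (intro set_integral_add set_integrable_divide i2 i3)
    also have "\<dots> = (LINT q:ball x r|m. h q powr p) / p + V x r * (A powr p * (1 - 1 / p))"
      using finite_ball[of x r] by (simp add: set_lebesgue_integral_def)
    finally have *: "(LINT q:ball x r|m. h q) * A powr (p - 1) \<le> \<dots>" by simp
    have "(LINT q:ball x r|m. h q) = V x r * A" "(LINT q:ball x r|m. h q powr p) = V x r * P"
      using ball_pos[OF r, of x] by (auto simp: A_def P_def ball_avg_def)
    with * have "V x r * (A * A powr (p - 1)) \<le> V x r * (P / p + A powr p * (1 - 1 / p))"
      by (simp add: algebra_simps)
    then show ?thesis using ball_pos[OF r, of x] by simp
  qed
  moreover have "A * A powr (p - 1) = A powr p"
    using A0 p by (cases "A = 0") (auto simp: powr_mult_base)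
  ultimately have "A powr p / p \<le> P / p" by (simp add: algebra_simps)
  then show ?thesis using p by (simp add: A_def P_def divide_le_cancel)
qed

lemma ball_avg_abs_le:
  assumes "\<And>q. 0 \<le> h q" "\<And>q. h q \<le> N" and [measurable]: "h \<in> borel_measurable m"
  shows "0 \<le> ball_avg m x r h" "ball_avg m x r h \<le> N"
proof -
  have N: "0 \<le> N" using assms(1,2)[of x] by linarith
  show "0 \<le> ball_avg m x r h" by (rule ball_avg_nonneg[OF assms(1)])
  have "(LINT q:ball x r|m. h q) \<le> (LINT q:ball x r|m. N)"
    using assms N by (intro set_integral_mono set_integrable_ball[of _ N]) auto
  also have "\<dots> = V x r * N" using finite_ball[of x r] by (simp add: set_lebesgue_integral_def)
  finally show "ball_avg m x r h \<le> N" using N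
    by (cases "V x r = 0") (auto simp: ball_avg_def divide_le_eq mult.commute zero_less_measure_iff)
qed

section \<open>Mollification by a kernel normalised with its own mass\<close>

text \<open>A cut-off that is 1 up to distance \<open>r\<close> and 0 from \<open>2 * r\<close> on,
  with Lipschitz constant \<open>1 / r\<close>. Dividing by its mass in \<open>mol\<close>
  reproduces constants, so any constant may be subtracted before estimating.\<close>

definition ker :: "real \<Rightarrow> 'a \<Rightarrow> 'a \<Rightarrow> real" where
  "ker r x q = max 0 (min 1 (2 - dist x q / r))"

definition mol :: "real \<Rightarrow> ('a \<Rightarrow> real) \<Rightarrow> 'a \<Rightarrow> real" where
  "mol r f x = (\<integral>q. ker r x q * f q \<partial>m) / (\<integral>q. ker r x q \<partial>m)"

lemma ker_measurable [measurable]: "ker r x \<in> borel_measurable m"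
  unfolding ker_def[abs_def] by measurable

lemma ker_bounds: "0 \<le> ker r x q" "ker r x q \<le> 1" by (auto simp: ker_def)

lemma ker_eq_0: "0 < r \<Longrightarrow> 2 * r \<le> dist x q \<Longrightarrow> ker r x q = 0"
  by (auto simp: ker_def field_simps)

lemma ker_eq_1: "0 < r \<Longrightarrow> dist x q \<le> r \<Longrightarrow> ker r x q = 1"
  by (auto simp: ker_def field_simps)

lemma ker_diff:
  assumes "0 < r" shows "\<bar>ker r x q - ker r y q\<bar> \<le> dist x y / r"
proof -
  have "\<bar>dist x q - dist y q\<bar> \<le> dist x y" by metric
  then have "\<bar>dist x q / r - dist y q / r\<bar> \<le> dist x y / r"
    using assms by (simp add: divide_right_mono flip: diff_divide_distrib)
  then show ?thesis unfolding ker_def by linarith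
qed

lemma ker_mult_integrable:
  assumes [measurable]: "h \<in> borel_measurable m" and h: "\<And>q. \<bar>h q\<bar> \<le> N" and "0 < r"
  shows "integrable m (\<lambda>q. ker r x q * h q)"
proof (rule integrable_bounded_support[of _ x "2 * r" N])
  show "\<bar>ker r x q * h q\<bar> \<le> N" for q
    using mult_mono[of "\<bar>ker r x q\<bar>" 1 "\<bar>h q\<bar>" N] h[of q] ker_bounds[of r x q] by (simp add: abs_mult)
qed (use ker_eq_0 \<open>0 < r\<close> in auto)

lemma ker_integrable: "0 < r \<Longrightarrow> integrable m (ker r x)"
  using ker_mult_integrable[of "\<lambda>_. 1" 1 r x] by simp

lemma ker_integral_ge: assumes "0 < r" shows "V x r \<le> (\<integral>q. ker r x q \<partial>m)"
proof -
  have "V x r = (\<integral>q. indicator (ball x r) q \<partial>m)" by simp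
  also have "\<dots> \<le> (\<integral>q. ker r x q \<partial>m)"
    using finite_ball assms ker_bounds
    by (intro integral_mono ker_integrable integrable_real_indicator) (auto simp: indicator_def ker_eq_1)
  finally show ?thesis .
qed

lemma ker_integral_pos: "0 < r \<Longrightarrow> 0 < (\<integral>q. ker r x q \<partial>m)"
  using ker_integral_ge[of r x] ball_pos[of r x] by linarith

lemma mol_shift:
  assumes [measurable]: "f \<in> borel_measurable m" and "\<And>q. \<bar>f q\<bar> \<le> N" "0 < r"
  shows "mol r f x - c = (\<integral>q. ker r x q * (f q - c) \<partial>m) / (\<integral>q. ker r x q \<partial>m)"
proof -
  have "(\<integral>q. ker r x q * (f q - c) \<partial>m) = (\<integral>q. ker r x q * f q \<partial>m) - (\<integral>q. ker r x q \<partial>m) * c"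
    using ker_mult_integrable[OF assms, of x] ker_integrable[OF assms(3)]
    by (simp add: right_diff_distrib)
  with ker_integral_pos[OF assms(3), of x] show ?thesis by (simp add: mol_def field_simps)
qed

text \<open>The majorant is left free: the kernel times a constant serves for uniform bounds, the
  restriction of \<open>\<bar>f q - c\<bar>\<close> to a ball for bounds by averages.\<close>

lemma mol_deviation:
  assumes [measurable]: "f \<in> borel_measurable m" and f: "\<And>q. \<bar>f q\<bar> \<le> N" and r: "0 < r"
    and h: "integrable m h" "\<And>q. ker r x q * \<bar>f q - c\<bar> \<le> h q"
  shows "\<bar>mol r f x - c\<bar> * (\<integral>q. ker r x q \<partial>m) \<le> (\<integral>q. h q \<partial>m)"
proof -
  have "\<bar>f q - c\<bar> \<le> N + \<bar>c\<bar>" for q using f[of q] by linarith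
  then have "integrable m (\<lambda>q. ker r x q * (f q - c))" using r by (intro ker_mult_integrable) auto
  then have "(\<integral>q. \<bar>ker r x q * (f q - c)\<bar> \<partial>m) \<le> (\<integral>q. h q \<partial>m)"
    using h ker_bounds(1)[of r x] by (intro integral_mono integrable_abs) (auto simp: abs_mult)
  then have "\<bar>\<integral>q. ker r x q * (f q - c) \<partial>m\<bar> \<le> (\<integral>q. h q \<partial>m)"
    by (rule order_trans[OF integral_abs_bound])
  then show ?thesis using mol_shift[OF assms(1) f r, of x c] ker_integral_pos[OF r, of x] by simp
qed

text \<open>Quotient rule for \<open>F / W\<close>: numerator and mass vary by at most
  \<open>dist y z / r\<close> times an integral over the ball of radius \<open>4 * r\<close>. Each
  \<open>W\<close> is at least \<open>V x (4 * r) / D ^ 3\<close>, since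
  \<open>2 * r + 4 * r \<le> 2 ^ 3 * r\<close>. The free \<open>c\<close> is later a ball average,
  the value at \<open>x\<close>, or 0.\<close>

lemma mol_diff:
  assumes [measurable]: "f \<in> borel_measurable m" and f: "\<And>q. \<bar>f q\<bar> \<le> N" and r: "0 < r"
    and y: "dist x y < 2 * r" and z: "dist x z < 2 * r"
  shows "\<bar>mol r f y - mol r f z\<bar> \<le> 2 * D ^ 6 / r * ball_avg m x (4 * r) (\<lambda>q. \<bar>f q - c\<bar>) * dist y z"
proof -
  define I where "I = (LINT q:ball x (4 * r)|m. \<bar>f q - c\<bar>)"
  define W where "W y = (\<integral>q. ker r y q \<partial>m)" for y
  define F where "F y = (\<integral>q. ker r y q * (f q - c) \<partial>m)" for y
  let ?V = "V x (4 * r)"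
  have fc: "\<bar>f q - c\<bar> \<le> N + \<bar>c\<bar>" for q using f[of q] by linarith
  have fcm: "(\<lambda>q. f q - c) \<in> borel_measurable m" by measurable
  have iI: "integrable m (\<lambda>q. indicator (ball x (4 * r)) q * \<bar>f q - c\<bar>)"
    using set_integrable_ball[of "\<lambda>q. \<bar>f q - c\<bar>" "N + \<bar>c\<bar>" x "4 * r"] fc by (simp add: set_integrable_def)
  have I_eq: "I = (\<integral>q. indicator (ball x (4 * r)) q * \<bar>f q - c\<bar> \<partial>m)"
    by (simp add: I_def set_lebesgue_integral_def)
  have I0: "0 \<le> I" unfolding I_eq by simp
  have V0: "0 < ?V" using r by (intro ball_pos) auto
  have out: "ker r w q = 0" if "dist x w < 2 * r" "4 * r \<le> dist x q" for w q
    by (rule ker_eq_0[OF r]) (use that dist_triangle[of x q w] in linarith)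
  have W: "?V / D ^ 3 \<le> W w" "0 < W w" if "dist x w < 2 * r" for w
  proof -
    have "?V \<le> D ^ 3 * V w r" using that r by (intro V_compare) auto
    then have "?V / D ^ 3 \<le> V w r" using D_ge_1 by (simp add: divide_le_eq mult.commute)
    with ker_integral_ge[OF r, of w] show "?V / D ^ 3 \<le> W w" by (simp add: W_def)
    moreover have "0 < ?V / D ^ 3" using V0 D_ge_1 by simp
    ultimately show "0 < W w" by linarith
  qed
  have F: "\<bar>F w\<bar> \<le> I" if "dist x w < 2 * r" for w
  proof -
    have "\<bar>F w\<bar> \<le> (\<integral>q. \<bar>ker r w q * (f q - c)\<bar> \<partial>m)" unfolding F_def by (rule integral_abs_bound)
    also have "\<dots> \<le> I" unfolding I_eq
    proof (intro integral_mono integrable_abs ker_mult_integrable[OF fcm fc r] iI)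
      fix q show "\<bar>ker r w q * (f q - c)\<bar> \<le> indicator (ball x (4 * r)) q * \<bar>f q - c\<bar>"
        using out[OF that, of q] ker_bounds[of r w q]
        by (auto simp: indicator_def abs_mult mult_left_le_one_le)
    qed
    finally show ?thesis .
  qed
  let ?d = "dist y z / r"
  have kd: "\<bar>ker r y q - ker r z q\<bar> \<le> ?d * indicator (ball x (4 * r)) q" for q
    using ker_diff[OF r, of y q z] out[OF y, of q] out[OF z, of q] by (auto simp: indicator_def)
  have FF: "\<bar>F y - F z\<bar> \<le> ?d * I"
  proof -
    have "F y - F z = (\<integral>q. ker r y q * (f q - c) - ker r z q * (f q - c) \<partial>m)"
      unfolding F_def by (intro Bochner_Integration.integral_diff[symmetric] ker_mult_integrable[OF fcm fc r])
    also have "\<bar>\<dots>\<bar> \<le> (\<integral>q. \<bar>ker r y q * (f q - c) - ker r z q * (f q - c)\<bar> \<partial>m)" by (rule integral_abs_bound)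
    also have "\<dots> \<le> (\<integral>q. ?d * (indicator (ball x (4 * r)) q * \<bar>f q - c\<bar>) \<partial>m)"
    proof (intro integral_mono integrable_abs Bochner_Integration.integrable_diff integrable_mult_right ker_mult_integrable[OF fcm fc r] iI)
      fix q show "\<bar>ker r y q * (f q - c) - ker r z q * (f q - c)\<bar> \<le> ?d * (indicator (ball x (4 * r)) q * \<bar>f q - c\<bar>)"
        using mult_right_mono[OF kd[of q], of "\<bar>f q - c\<bar>"]
        by (simp add: mult.assoc abs_mult flip: left_diff_distrib)
    qed
    finally show ?thesis by (simp add: I_eq)
  qed
  have WW: "\<bar>W z - W y\<bar> \<le> ?d * ?V"
  proof -
    have "W z - W y = (\<integral>q. ker r z q - ker r y q \<partial>m)"
      unfolding W_def by (intro Bochner_Integration.integral_diff[symmetric] ker_integrable r)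
    also have "\<bar>\<dots>\<bar> \<le> (\<integral>q. \<bar>ker r z q - ker r y q\<bar> \<partial>m)" by (rule integral_abs_bound)
    also have "\<dots> \<le> (\<integral>q. ?d * indicator (ball x (4 * r)) q \<partial>m)"
    proof (intro integral_mono integrable_abs Bochner_Integration.integrable_diff integrable_mult_right ker_integrable r)
      fix q show "\<bar>ker r z q - ker r y q\<bar> \<le> ?d * indicator (ball x (4 * r)) q"
        using kd[of q] by (simp add: abs_minus_commute)
    qed (use finite_ball in \<open>auto intro!: integrable_real_indicator\<close>)
    finally show ?thesis by simp
  qed
  have "mol r f y - mol r f z = F y / W y - F z / W z"
    using mol_shift[OF assms(1) f r, of y c] mol_shift[OF assms(1) f r, of z c] by (simp add: F_def W_def)
  also have "\<dots> = (F y - F z) / W y + F z * (W z - W y) / (W y * W z)"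
    using W(2)[OF y] W(2)[OF z] by (simp add: field_simps)
  also have "\<bar>\<dots>\<bar> \<le> \<bar>F y - F z\<bar> / W y + \<bar>F z\<bar> * \<bar>W z - W y\<bar> / (W y * W z)"
    using W(2)[OF y] W(2)[OF z] by (intro order_trans[OF abs_triangle_ineq]) (simp add: abs_mult)
  also have "\<dots> \<le> (?d * I) / (?V / D ^ 3) + I * (?d * ?V) / ((?V / D ^ 3) * (?V / D ^ 3))"
    using W[OF y] W[OF z] F[OF z] FF WW I0 V0 D_ge_1 r
    by (intro add_mono frac_le mult_mono) auto
  also have "\<dots> = (D ^ 3 + D ^ 6) * (?d * I / ?V)"
    using V0 D_ge_1 r by (simp add: field_simps power_add[symmetric])
  also have "\<dots> \<le> (2 * D ^ 6) * (?d * I / ?V)"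
    using D_ge_1 I0 V0 r by (intro mult_right_mono) (auto intro!: power_increasing)
  also have "\<dots> = 2 * D ^ 6 / r * ball_avg m x (4 * r) (\<lambda>q. \<bar>f q - c\<bar>) * dist y z"
    by (simp add: ball_avg_def I_def)
  finally show ?thesis .
qed

lemma mol_close:
  assumes [measurable]: "f \<in> borel_measurable m" and f: "\<And>q. \<bar>f q\<bar> \<le> N" and r: "0 < r"
  shows "\<bar>mol r f x - f x\<bar> \<le> D ^ 2 * ball_avg m x (4 * r) (\<lambda>q. \<bar>f q - f x\<bar>)"
proof -
  define I where "I = (LINT q:ball x (4 * r)|m. \<bar>f q - f x\<bar>)"
  define W where "W = (\<integral>q. ker r x q \<partial>m)"
  have fc: "\<bar>\<bar>f q - f x\<bar>\<bar> \<le> N + N" for q using f[of q] f[of x] by linarith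
  have "\<bar>mol r f x - f x\<bar> * W \<le> I"
    unfolding W_def I_def set_lebesgue_integral_def
  proof (rule mol_deviation[OF assms])
    show "integrable m (\<lambda>q. indicator (ball x (4 * r)) q *\<^sub>R \<bar>f q - f x\<bar>)"
      unfolding set_integrable_def[symmetric] by (rule set_integrable_ball[OF _ fc]) measurable
    show "ker r x q * \<bar>f q - f x\<bar> \<le> indicator (ball x (4 * r)) q *\<^sub>R \<bar>f q - f x\<bar>" for q
      using ker_eq_0[OF r, of x q] ker_bounds[of r x q] r
      by (auto simp: indicator_def mult_left_le_one_le)
  qed
  then have "\<bar>mol r f x - f x\<bar> \<le> I / W"
    using ker_integral_pos[OF r, of x] by (simp add: W_def le_divide_eq)
  also have "\<dots> \<le> I / (V x (4 * r) / D ^ 2)"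
  proof (rule divide_left_mono)
    have "V x (4 * r) \<le> D ^ 2 * V x r" using r by (intro V_compare) auto
    then have "V x (4 * r) / D ^ 2 \<le> V x r" using D_ge_1 by (simp add: divide_le_eq mult.commute)
    then show "V x (4 * r) / D ^ 2 \<le> W" using ker_integral_ge[OF r, of x] by (simp add: W_def)
    show "0 \<le> I" unfolding I_def set_lebesgue_integral_def by (intro Bochner_Integration.integral_nonneg) auto
    show "0 < W * (V x (4 * r) / D ^ 2)"
      using ball_pos[of "4 * r" x] r D_ge_1 ker_integral_pos[OF r, of x] by (simp add: W_def)
  qed
  also have "\<dots> = D ^ 2 * ball_avg m x (4 * r) (\<lambda>q. \<bar>f q - f x\<bar>)" by (simp add: ball_avg_def I_def)
  finally show ?thesis .
qed

lemma mol_bounded: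
  assumes [measurable]: "f \<in> borel_measurable m" and f: "\<And>q. \<bar>f q\<bar> \<le> N" and r: "0 < r"
  shows "\<bar>mol r f x\<bar> \<le> N"
  using mol_deviation[OF assms, where h = "\<lambda>q. ker r x q * N" and x = x and c = 0] f
    ker_integrable[OF r, of x] ker_bounds(1)[of r x] ker_integral_pos[OF r, of x] by (simp add: mult_left_mono)

lemma mol_eq_0:
  assumes "\<And>q. R \<le> dist a q \<Longrightarrow> f q = 0" "0 < r" "R + 2 * r \<le> dist a x"
  shows "mol r f x = 0"
proof -
  have "ker r x q * f q = 0" for q
    using assms(1)[of q] ker_eq_0[OF assms(2), of x q] assms(3) dist_triangle[of a x q]
    by (cases "R \<le> dist a q") (auto simp: dist_commute)
  then have "(\<lambda>q. ker r x q * f q) = (\<lambda>_. 0)" by blast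
  then show ?thesis by (simp add: mol_def)
qed

lemma mol_lipschitz:
  assumes [measurable]: "f \<in> borel_measurable m" and f: "\<And>q. \<bar>f q\<bar> \<le> N" and r: "0 < r"
  shows "(2 * D ^ 6 * N / r)-lipschitz_on UNIV (mol r f)"
proof (rule lipschitz_onI)
  have N: "0 \<le> N" using f[of undefined] by linarith
  show "0 \<le> 2 * D ^ 6 * N / r" using N r D_ge_1 by simp
  fix x y
  have D6: "1 \<le> D ^ 6" using D_ge_1 by simp
  have "\<bar>mol r f x - mol r f y\<bar> \<le> 2 * D ^ 6 * N / r * dist x y"
  proof (cases "dist x y < 2 * r")
    case True
    have "\<bar>mol r f x - mol r f y\<bar> \<le> 2 * D ^ 6 / r * ball_avg m x (4 * r) (\<lambda>q. \<bar>f q - 0\<bar>) * dist x y"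
      using True r by (intro mol_diff[OF assms]) auto
    also have "\<dots> \<le> 2 * D ^ 6 / r * N * dist x y"
      using f r D_ge_1 by (intro mult_mono ball_avg_abs_le mult_nonneg_nonneg N) auto
    finally show ?thesis by simp
  next
    case False
    have "\<bar>mol r f x - mol r f y\<bar> \<le> N + N"
      using mol_bounded[OF assms, of x] mol_bounded[OF assms, of y] by linarith
    also have "\<dots> \<le> 2 * N / r * (2 * r)" using N r by simp
    also have "\<dots> \<le> 2 * D ^ 6 * N / r * dist x y"
      using False N r D6 by (intro mult_mono divide_right_mono mult_right_mono) auto
    finally show ?thesis .
  qed
  then show "dist (mol r f x) (mol r f y) \<le> 2 * D ^ 6 * N / r * dist x y" by (simp add: dist_real_def)
qed

end

section \<open>Lipschitz truncation and the sharp Poincare estimate\<close>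

lemma mcshane_extension:
  fixes w :: "'a::metric_space \<Rightarrow> real"
  assumes "S \<noteq> {}" "0 \<le> K" and w: "\<And>x y. x \<in> S \<Longrightarrow> y \<in> S \<Longrightarrow> \<bar>w x - w y\<bar> \<le> K * dist x y"
  obtains v where "K-lipschitz_on UNIV v" "\<And>x. x \<in> S \<Longrightarrow> v x = w x"
proof -
  define v where "v x = (INF y\<in>S. w y + K * dist x y)" for x
  obtain s where s: "s \<in> S" using assms(1) by blast
  have low: "w z - K * dist x z \<le> w y + K * dist x y" if "y \<in> S" "z \<in> S" for x y z
  proof -
    have "w z - w y \<le> K * dist z y" using w[OF that(2,1)] by linarith
    also have "\<dots> \<le> K * (dist x z + dist x y)"
      using assms(2) by (intro mult_left_mono) (auto intro: dist_triangle3)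
    finally show ?thesis by (simp add: algebra_simps)
  qed
  have bdd: "bdd_below ((\<lambda>y. w y + K * dist x y) ` S)" for x
    using low[OF _ s, of _ x] by (auto intro!: bdd_belowI2)
  have 1: "v x \<le> v y + K * dist x y" for x y
  proof -
    have "v x - K * dist x y \<le> v y"
      unfolding v_def[of y]
    proof (rule cINF_greatest[OF assms(1)])
      fix z assume z: "z \<in> S"
      have "v x \<le> w z + K * dist x z" unfolding v_def by (rule cINF_lower[OF bdd z])
      also have "\<dots> \<le> w z + K * (dist x y + dist y z)"
        using assms(2) by (intro add_left_mono mult_left_mono dist_triangle)
      finally show "v x - K * dist x y \<le> w z + K * dist y z" by (simp add: algebra_simps)
    qed
    then show ?thesis by simp
  qed
  have "K-lipschitz_on UNIV v"
  proof (rule lipschitz_onI)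
    fix x y show "dist (v x) (v y) \<le> K * dist x y"
      using 1[of x y] 1[of y x] by (auto simp: dist_real_def dist_commute abs_le_iff)
  qed (use assms in auto)
  moreover have "v x = w x" if x: "x \<in> S" for x
  proof (rule antisym)
    show "v x \<le> w x" unfolding v_def using cINF_lower[OF bdd x, of x] by simp
    show "w x \<le> v x" unfolding v_def
      using low[OF _ x, of _ x] by (intro cINF_greatest[OF assms(1)]) simp
  qed
  ultimately show ?thesis by (rule that)
qed

text \<open>A geometric sum is at most twice its largest term, whatever gaps \<open>T\<close>
  has.\<close>

lemma sum_two_power_le:
  fixes l b :: real
  assumes "finite T" "0 \<le> l" "0 \<le> b" "\<And>j. j \<in> T \<Longrightarrow> 2 ^ j * l \<le> b"
  shows "(\<Sum>j\<in>T. 2 ^ j * l) \<le> 2 * b"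
proof (cases "T = {}")
  case False
  define J where "J = Max T"
  have "J \<in> T" using assms(1) False by (simp add: J_def)
  have geo: "(\<Sum>j<n. (2::real) ^ j) = 2 ^ n - 1" for n by (induction n) auto
  have "(\<Sum>j\<in>T. 2 ^ j * l) \<le> (\<Sum>j<Suc J. 2 ^ j * l)"
    using assms by (intro sum_mono2) (auto simp: J_def less_Suc_eq_le)
  also have "\<dots> = (2 ^ Suc J - 1) * l" by (simp only: sum_distrib_right[symmetric] geo)
  also have "\<dots> \<le> 2 * (2 ^ J * l)" using assms(2) by (simp add: algebra_simps)
  also have "\<dots> \<le> 2 * b" using assms(4)[OF \<open>J \<in> T\<close>] by simp
  finally show ?thesis .
qed (use assms in simp)

text \<open>The largest term dominates, so the constant is independent of the number of terms.
  Convexity would cost \<open>card T powr (p - 1)\<close>, which would destroy the gain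
  \<open>k powr (1 - p)\<close> in the absorption.\<close>

lemma powr_sum_two_power_le:
  fixes p lam :: real
  assumes "finite T" "0 \<le> p" "0 \<le> lam"
  shows "(\<Sum>j\<in>T. 2 ^ j * lam) powr p \<le> 2 powr p * (\<Sum>j\<in>T. (2 ^ j * lam) powr p)"
proof (cases "T = {}")
  case False
  define J where "J = Max T"
  have J: "J \<in> T" using assms False by (simp add: J_def)
  have "(\<Sum>j\<in>T. 2 ^ j * lam) \<le> 2 * (2 ^ J * lam)"
    using assms by (intro sum_two_power_le) (auto simp: J_def intro!: mult_right_mono power_increasing)
  then have "(\<Sum>j\<in>T. 2 ^ j * lam) powr p \<le> (2 * (2 ^ J * lam)) powr p"
    using assms by (intro powr_mono2) (auto intro!: sum_nonneg)
  also have "\<dots> = 2 powr p * (2 ^ J * lam) powr p" using assms by (simp add: powr_mult)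
  also have "\<dots> \<le> 2 powr p * (\<Sum>j\<in>T. (2 ^ j * lam) powr p)"
    using assms J by (intro mult_left_mono member_le_sum[of J T "\<lambda>j. (2 ^ j * lam) powr p"]) auto
  finally show ?thesis .
qed simp

lemma powr_add_le:
  fixes a b p :: real assumes "0 \<le> a" "0 \<le> b" "0 \<le> p"
  shows "(a + b) powr p \<le> 2 powr p * (a powr p + b powr p)"
proof -
  have "(a + b) powr p \<le> (2 * max a b) powr p" using assms by (intro powr_mono2) auto
  also have "\<dots> = 2 powr p * (max a b) powr p" using assms by (simp add: powr_mult)
  also have "\<dots> \<le> 2 powr p * (a powr p + b powr p)"
    by (intro mult_left_mono) (auto simp: max_def)
  finally show ?thesis .
qed

locale poincare_space = doubling_space m D for m :: "'a::polish_space measure" and D :: real +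
  fixes p CP :: real
  assumes p_gt_1: "1 < p" and CP_pos: "0 < CP"
    and poincare: "g \<in> LIP_bs \<Longrightarrow> 0 < r \<Longrightarrow> ball_avg m x r (\<lambda>y. \<bar>g y - ball_avg m x r g\<bar>)
          \<le> CP * r * ball_avg m x r (\<lambda>y. slope g y powr p) powr (1 / p)"

section \<open>Oscillation as a mass of pairs, and central values\<close>

context doubling_space
begin

lemma emeasure_subset_ball:
  assumes "S \<subseteq> ball x r" shows "emeasure m S = ennreal (measure m S)" "emeasure m S < \<infinity>"
proof -
  have "emeasure m S \<le> emeasure m (ball x r)" using assms by (intro emeasure_mono) auto
  then show "emeasure m S < \<infinity>" using finite_ball[of x r] by (rule le_less_trans)
  then show "emeasure m S = ennreal (measure m S)" by (intro emeasure_eq_ennreal_measure) auto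
qed

text \<open>Oscillation is measured by the mass of pairs of points with a large difference rather than by
  an average of differences: altering a function on a set of small measure then changes it little.\<close>

definition osc_mass :: "('a \<Rightarrow> real) \<Rightarrow> 'a \<Rightarrow> real \<Rightarrow> real \<Rightarrow> ennreal" where
  "osc_mass w x r t =
     (\<integral>\<^sup>+y. (\<integral>\<^sup>+z. (if dist x y < r \<and> dist x z < r \<and> t < \<bar>w y - w z\<bar> then 1 else 0) \<partial>m) \<partial>m)"

text \<open>A central value has an exceptional set of relative measure at most
  \<open>2 * s0 = 1 / (4 * D\<^sup>2)\<close>. When one ball contains another and two doublings
  compare their volumes, the two exceptional sets together fill at most half of the smaller
  ball.\<close>

definition s0 :: real where "s0 = 1 / (8 * D\<^sup>2)"

lemma s0_pos: "0 < s0" using D_ge_1 by (simp add: s0_def)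

lemma osc_mass_measurable [measurable]:
  assumes [measurable]: "w \<in> borel_measurable m"
  shows "(\<lambda>x. osc_mass w x r t) \<in> borel_measurable m"
  unfolding osc_mass_def by measurable

lemma osc_mass_nonzeroE:
  assumes "0 < osc_mass w x r t"
  obtains y z where "dist x y < r" "dist x z < r" "t < \<bar>w y - w z\<bar>"
proof (rule ccontr)
  assume "\<not> thesis"
  then have "osc_mass w x r t = (\<integral>\<^sup>+y. (\<integral>\<^sup>+z. 0 \<partial>m) \<partial>m)"
    unfolding osc_mass_def using that by (intro nn_integral_cong) auto
  with assms show False by simp
qed

lemma osc_mass_antimono: "t \<le> t' \<Longrightarrow> osc_mass w x r t' \<le> osc_mass w x r t"
  unfolding osc_mass_def by (intro nn_integral_mono) auto

text \<open>Only pairs with a point in \<open>U\<close> are affected, so the bound is independent of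
  how far the values are moved; the factor 2 counts the two coordinates.\<close>

lemma osc_mass_change:
  assumes [measurable]: "U \<in> sets m" "h \<in> borel_measurable m" and U: "\<And>y. y \<notin> U \<Longrightarrow> h y = w y"
  shows "osc_mass w x r t \<le> osc_mass h x r t + ennreal (2 * measure m (U \<inter> ball x r) * V x r)"
proof -
  have "osc_mass w x r t \<le> (\<integral>\<^sup>+y. (\<integral>\<^sup>+z. (if dist x y < r \<and> dist x z < r \<and> t < \<bar>h y - h z\<bar> then 1 else 0)
     + (indicator (U \<inter> ball x r) y * indicator (ball x r) z
     + indicator (ball x r) y * indicator (U \<inter> ball x r) z) \<partial>m) \<partial>m)"
    unfolding osc_mass_def using U by (intro nn_integral_mono) (auto simp: indicator_def)
  also have "\<dots> = osc_mass h x r t + (emeasure m (U \<inter> ball x r) * emeasure m (ball x r)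
     + emeasure m (ball x r) * emeasure m (U \<inter> ball x r))"
    unfolding osc_mass_def
    by (simp add: nn_integral_add nn_integral_cmult nn_integral_multc)
  also have "emeasure m (U \<inter> ball x r) = ennreal (measure m (U \<inter> ball x r))"
    by (rule emeasure_subset_ball(1)[of _ x r]) auto
  finally show ?thesis
    by (simp add: emeasure_ball flip: ennreal_mult ennreal_plus) (simp add: algebra_simps)
qed

text \<open>The triangle inequality through \<open>c\<close>, then Markov's inequality; each
  coordinate contributes one integral, hence the factor 2.\<close>

lemma osc_mass_chebyshev:
  assumes [measurable]: "h \<in> borel_measurable m" and h: "\<And>q. \<bar>h q\<bar> \<le> N" and t: "0 < t" and r: "0 < r"
  shows "osc_mass h x r t \<le> ennreal (2 * (V x r)\<^sup>2 / t * ball_avg m x r (\<lambda>y. \<bar>h y - c\<bar>))"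
proof -
  define a where "a y = indicator (ball x r) y * \<bar>h y - c\<bar>" for y
  have [measurable]: "a \<in> borel_measurable m" unfolding a_def[abs_def] by measurable
  have a0: "0 \<le> a y" for y by (simp add: a_def)
  have A: "(\<integral>\<^sup>+y. ennreal (a y) \<partial>m) = ennreal (V x r * ball_avg m x r (\<lambda>y. \<bar>h y - c\<bar>))"
  proof -
    have "set_integrable m (ball x r) (\<lambda>y. \<bar>h y - c\<bar>)"
    proof (rule set_integrable_ball[of _ "N + \<bar>c\<bar>"])
      show "\<bar>\<bar>h q - c\<bar>\<bar> \<le> N + \<bar>c\<bar>" for q using h[of q] by linarith
    qed measurable
    then have "(\<integral>\<^sup>+y. ennreal (a y) \<partial>m) = ennreal (\<integral>y. a y \<partial>m)"
      by (intro nn_integral_eq_integral) (auto simp: set_integrable_def a_def[abs_def])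
    then show ?thesis using ball_pos[OF r, of x]
      by (simp add: ball_avg_def set_lebesgue_integral_def a_def)
  qed
  have ind: "ennreal (indicator S y) = indicator S y" for S and y :: 'a by (simp add: indicator_def)
  have "osc_mass h x r t \<le> (\<integral>\<^sup>+y. (\<integral>\<^sup>+z. ennreal (1 / t) * (ennreal (a y) * indicator (ball x r) z
     + indicator (ball x r) y * ennreal (a z)) \<partial>m) \<partial>m)"
    unfolding osc_mass_def
  proof (intro nn_integral_mono)
    fix y z
    have "1 \<le> 1 / t * (a y + a z)" if "dist x y < r" "dist x z < r" "t < \<bar>h y - h z\<bar>"
      using that t by (auto simp: a_def field_simps)
    then show "(if dist x y < r \<and> dist x z < r \<and> t < \<bar>h y - h z\<bar> then 1 else 0)
      \<le> ennreal (1 / t) * (ennreal (a y) * indicator (ball x r) z + indicator (ball x r) y * ennreal (a z))"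
      using t a0 by (auto simp: ennreal_mult[symmetric] ennreal_plus[symmetric] simp del: ennreal_plus intro!: ennreal_leI simp flip: ennreal_1)
  qed
  also have "\<dots> = ennreal (1 / t) * ((\<integral>\<^sup>+y. ennreal (a y) \<partial>m) * emeasure m (ball x r)
     + emeasure m (ball x r) * (\<integral>\<^sup>+y. ennreal (a y) \<partial>m))"
    by (simp add: nn_integral_add nn_integral_cmult nn_integral_multc)
  also have "\<dots> = ennreal (2 * (V x r)\<^sup>2 / t * ball_avg m x r (\<lambda>y. \<bar>h y - c\<bar>))"
  proof -
    have "0 \<le> ball_avg m x r (\<lambda>y. \<bar>h y - c\<bar>)" by (rule ball_avg_nonneg) simp
    then show ?thesis unfolding A emeasure_ball using t
      by (simp add: ennreal_mult[symmetric] ennreal_plus[symmetric] del: ennreal_plus)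
        (simp add: power2_eq_square algebra_simps)
  qed
  finally show ?thesis .
qed

text \<open>A substitute for the mean value on the ball that, like \<open>osc_mass\<close>,
  disregards what happens on a set of small relative measure.\<close>

definition central :: "('a \<Rightarrow> real) \<Rightarrow> real \<Rightarrow> 'a \<Rightarrow> real \<Rightarrow> real \<Rightarrow> bool" where
  "central w lam x r c \<longleftrightarrow> measure m {z \<in> ball x r. lam * r < \<bar>w z - c\<bar>} \<le> 2 * s0 * V x r"

text \<open>Fubini: if no value were central, then in particular no \<open>w y\<close> with
  \<open>y\<close> in the ball would be. Every slice of the pair integral would be at least
  \<open>2 * s0 * V x r\<close>, and the total at least twice the permitted amount.\<close>

lemma central_exists:
  assumes [measurable]: "w \<in> borel_measurable m" and r: "0 < r"
    and N: "osc_mass w x r (lam * r) \<le> ennreal (s0 * (V x r)\<^sup>2)"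
  shows "\<exists>c. central w lam x r c"
proof (rule ccontr)
  assume no: "\<nexists>c. central w lam x r c"
  have V0: "0 < V x r" by (rule ball_pos[OF r])
  have 1: "ennreal (2 * s0 * V x r) \<le> (\<integral>\<^sup>+z. (if dist x y < r \<and> dist x z < r \<and> lam * r < \<bar>w y - w z\<bar> then 1 else 0) \<partial>m)"
    if "dist x y < r" for y
  proof -
    have "(\<integral>\<^sup>+z. (if dist x y < r \<and> dist x z < r \<and> lam * r < \<bar>w y - w z\<bar> then 1 else 0) \<partial>m)
      = (\<integral>\<^sup>+z. indicator {z \<in> ball x r. lam * r < \<bar>w z - w y\<bar>} z \<partial>m)"
      using that by (intro nn_integral_cong) (auto simp: abs_minus_commute)
    also have "\<dots> = emeasure m {z \<in> ball x r. lam * r < \<bar>w z - w y\<bar>}"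
      by (subst nn_integral_indicator) auto
    also have "\<dots> = ennreal (measure m {z \<in> ball x r. lam * r < \<bar>w z - w y\<bar>})"
      by (rule emeasure_subset_ball(1)[of _ x r]) auto
    also have "\<dots> \<ge> ennreal (2 * s0 * V x r)"
      using no by (intro ennreal_leI) (auto simp: central_def not_le dest: spec[of _ "w y"] intro: less_imp_le)
    finally show ?thesis .
  qed
  have "ennreal (2 * s0 * V x r) * emeasure m (ball x r) = (\<integral>\<^sup>+y. ennreal (2 * s0 * V x r) * indicator (ball x r) y \<partial>m)"
    by (simp add: nn_integral_cmult)
  also have "\<dots> \<le> osc_mass w x r (lam * r)"
    unfolding osc_mass_def using 1 by (intro nn_integral_mono) (auto simp: indicator_def)
  finally have "ennreal (2 * s0 * V x r * V x r) \<le> ennreal (s0 * (V x r)\<^sup>2)"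
    using N V0 s0_pos by (simp add: emeasure_ball ennreal_mult)
  then have "2 * s0 * V x r * V x r \<le> s0 * (V x r)\<^sup>2"
    using s0_pos by (subst (asm) ennreal_le_iff) auto
  then show False using V0 s0_pos by (simp add: power2_eq_square)
qed

text \<open>Some point of the smaller ball avoids both exceptional sets, and \<open>w\<close> there
  is close to both central values. The condition \<open>dist x y + r \<le> 4 * t\<close> gives
  \<open>V x r \<le> D ^ 2 * V y t\<close>, which is what \<open>s0\<close> is tuned to.\<close>

lemma central_meet:
  assumes [measurable]: "w \<in> borel_measurable m" and "central w lam x r c" "central w lam y t c'"
    and t: "0 < t" "dist x y + t \<le> r" "dist x y + r \<le> 4 * t"
  shows "\<bar>c - c'\<bar> \<le> lam * (r + t)"
proof -
  define S where "S = {z \<in> ball x r. lam * r < \<bar>w z - c\<bar>}"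
  define T where "T = {z \<in> ball y t. lam * t < \<bar>w z - c'\<bar>}"
  have V0: "0 < V y t" by (rule ball_pos[OF t(1)])
  have [measurable]: "S \<in> sets m" "T \<in> sets m" unfolding S_def T_def by auto
  have fm: "S \<in> fmeasurable m" "T \<in> fmeasurable m"
    by (rule fmeasurableI2[OF ball_fmeasurable[of x r]], auto simp: S_def)
       (rule fmeasurableI2[OF ball_fmeasurable[of y t]], auto simp: T_def)
  have "V x r \<le> D ^ 2 * V y t" using t by (intro V_compare) auto
  have "2 * s0 * V x r \<le> 2 * s0 * (D ^ 2 * V y t)"
    using \<open>V x r \<le> _\<close> s0_pos by (intro mult_left_mono) auto
  also have "\<dots> = V y t / 4" using D_ge_1 by (simp add: s0_def)
  finally have 1: "measure m S \<le> V y t / 4" using assms(2) by (simp add: central_def S_def)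
  have "2 * s0 * V y t \<le> V y t / 4" using D_ge_1 V0 by (simp add: s0_def field_simps)
  then have 2: "measure m T \<le> V y t / 4" using assms(3) by (simp add: central_def T_def)
  have "\<not> ball y t \<subseteq> S \<union> T"
  proof
    assume "ball y t \<subseteq> S \<union> T"
    then have "V y t \<le> measure m (S \<union> T)" using fm by (intro measure_mono_fmeasurable) auto
    also have "\<dots> \<le> measure m S + measure m T" using fm by (intro measure_Un_le) auto
    finally show False using 1 2 V0 by linarith
  qed
  then obtain z where z: "z \<in> ball y t" "z \<notin> S" "z \<notin> T" by blast
  have "z \<in> ball x r" using z(1) t(2) dist_triangle[of x z y] by simp
  then have "\<bar>w z - c\<bar> \<le> lam * r" "\<bar>w z - c'\<bar> \<le> lam * t" using z by (auto simp: S_def T_def)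
  then show ?thesis by (simp add: algebra_simps)
qed

text \<open>An exceptional set cannot fill the ball, as \<open>2 * s0 < 1\<close>. The Lipschitz
  bound thus forces central values to converge to \<open>w x\<close> as the radius shrinks, which
  stands in for Lebesgue differentiation.\<close>

lemma central_near:
  assumes [measurable]: "w \<in> borel_measurable m" and "central w lam x r c" "L-lipschitz_on UNIV w" "0 < r"
  shows "\<bar>c - w x\<bar> \<le> (lam + L) * r"
proof -
  define S where "S = {z \<in> ball x r. lam * r < \<bar>w z - c\<bar>}"
  have "2 * s0 < 1"
  proof -
    have "1 \<le> D\<^sup>2" using D_ge_1 by simp
    then have "1 < 4 * D\<^sup>2" by linarith
    then show ?thesis using D_ge_1 by (simp add: s0_def divide_less_eq_1)
  qed
  then have "2 * s0 * V x r < V x r" using ball_pos[OF assms(4), of x] by simp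
  then have "S \<noteq> ball x r" using assms(2) by (auto simp: central_def S_def)
  moreover have "S \<subseteq> ball x r" by (auto simp: S_def)
  ultimately obtain z where z: "z \<in> ball x r" "z \<notin> S" by blast
  then have "\<bar>w z - c\<bar> \<le> lam * r" by (auto simp: S_def)
  moreover have "L * dist z x \<le> L * r"
    using z lipschitz_on_nonneg[OF assms(3)] by (intro mult_left_mono) (auto simp: dist_commute)
  then have "\<bar>w z - w x\<bar> \<le> L * r" using lipschitz_abs_diff[OF assms(3), of z x] by linarith
  ultimately show ?thesis by (simp add: algebra_simps)
qed

end

text \<open>\<open>w\<close> plays the role of a function regularised at scale \<open>eps\<close>, with \<open>gh\<close> controlling its
  difference quotients up to that scale.\<close>

locale truncation = poincare_space m D p CP for m :: "'a::polish_space measure" and D p CP :: real +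
  fixes w gh :: "'a \<Rightarrow> real" and eps L N M R :: real and a :: 'a
  assumes eps_pos: "0 < eps" and w_lip: "L-lipschitz_on UNIV w"
    and gh_measurable [measurable]: "gh \<in> borel_measurable m"
    and gh_nonneg: "0 \<le> gh x" and gh_le: "gh x \<le> M"
    and gh_local: "dist x y < 2 * eps \<Longrightarrow> dist x z < 2 * eps \<Longrightarrow> \<bar>w y - w z\<bar> \<le> gh x * dist y z"
    and w_le: "\<bar>w x\<bar> \<le> N"
    and w_support: "R \<le> dist a x \<Longrightarrow> w x = 0" and gh_support: "R \<le> dist a x \<Longrightarrow> gh x = 0"
begin

section \<open>Bad sets, good points and truncation at a single level\<close>

lemma w_measurable [measurable]: "w \<in> borel_measurable m"
proof -
  have "continuous_on UNIV w" using w_lip by (rule lipschitz_on_continuous_on)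
  then show ?thesis using borel_measurable_continuous_onI measurable_cong_sets[OF sets_m refl] by blast
qed

text \<open>Rational radii suffice for the telescoping argument and make the set measurable.\<close>

definition osc_bad :: "real \<Rightarrow> 'a set" where
  "osc_bad lam = (\<Union>r\<in>{r\<in>\<rat>. 0 < r}. {x. ennreal (s0 * (V x r)\<^sup>2) < osc_mass w x r (lam * r)})"

definition bad :: "real \<Rightarrow> 'a set" where
  "bad lam = {x. lam < gh x} \<union> osc_bad lam"

lemma gh_level_measurable [measurable]: "{x. t < gh x} \<in> sets m"
proof -
  have "{x \<in> space m. t < gh x} \<in> sets m" by measurable
  then show ?thesis by simp
qed

lemma osc_bad_measurable [measurable]: "osc_bad lam \<in> sets m"
proof -
  have "{x \<in> space m. ennreal (s0 * (V x r)\<^sup>2) < osc_mass w x r (lam * r)} \<in> sets m" for r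
    by measurable
  moreover have "countable {r\<in>\<rat>. 0 < (r::real)}"
    by (rule countable_subset[OF _ countable_rat]) auto
  ultimately show ?thesis unfolding osc_bad_def by (intro sets.countable_UN') auto
qed

lemma bad_measurable [measurable]: "bad lam \<in> sets m"
  unfolding bad_def by measurable

lemma bad_antimono: assumes "lam \<le> lam'" shows "bad lam' \<subseteq> bad lam"
proof -
  have "osc_mass w x r (lam' * r) \<le> osc_mass w x r (lam * r)" if "0 < r" for x r
    using that assms by (intro osc_mass_antimono mult_right_mono) auto
  then show ?thesis using assms unfolding bad_def osc_bad_def by (force intro: less_le_trans)
qed

text \<open>One pair with a jump above \<open>lam * r\<close> gives all three bounds: boundedness of
  \<open>w\<close> limits the radius, its support the position, its Lipschitz constant the level.
  They make the bad sets bounded, and empty at high levels.\<close>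

lemma osc_mass_radius:
  assumes "0 < osc_mass w x r (lam * r)" "0 < lam" "0 < r"
  shows "r < 2 * N / lam" "dist a x < R + 2 * N / lam" "lam < 2 * L"
proof -
  obtain y z where yz: "dist x y < r" "dist x z < r" "lam * r < \<bar>w y - w z\<bar>"
    using assms(1) by (rule osc_mass_nonzeroE)
  have "\<bar>w y - w z\<bar> \<le> 2 * N" using w_le[of y] w_le[of z] by linarith
  with yz have "lam * r < 2 * N" by linarith
  then show rN: "r < 2 * N / lam" using assms(2) by (simp add: field_simps)
  have "0 < lam * r" using assms by simp
  then have "w y \<noteq> 0 \<or> w z \<noteq> 0" using yz by auto
  then have "dist a y < R \<or> dist a z < R" using w_support[of y] w_support[of z] by linarith
  then show "dist a x < R + 2 * N / lam"
    using yz rN dist_triangle[of a x y] dist_triangle[of a x z] by (auto simp: dist_commute)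
  have "lam * r < L * dist y z" using yz(3) lipschitz_abs_diff[OF w_lip, of y z] by linarith
  also have "\<dots> \<le> L * (2 * r)"
    using yz(1,2) dist_triangle[of y z x] lipschitz_on_nonneg[OF w_lip]
    by (intro mult_left_mono) (auto simp: dist_commute)
  finally show "lam < 2 * L" using assms(3) by (simp add: field_simps)
qed

lemma bad_bounded: assumes "0 < lam" "x \<in> bad lam" shows "dist a x < R + 2 * N / lam"
proof (cases "lam < gh x")
  case True
  then have "dist a x < R" using gh_support[of x] assms(1) by linarith
  moreover have "0 \<le> N" using w_le[of x] by linarith
  ultimately show ?thesis using assms(1) by (smt (verit) divide_nonneg_pos)
next
  case False
  then obtain r where "r \<in> \<rat>" "0 < r" "ennreal (s0 * (V x r)\<^sup>2) < osc_mass w x r (lam * r)"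
    using assms(2) by (auto simp: bad_def osc_bad_def)
  then show ?thesis using assms(1) by (intro osc_mass_radius(2)[of x r lam]) (auto intro: le_less_trans)
qed

lemma bad_empty: assumes "0 < lam" "M \<le> lam" "2 * L \<le> lam" shows "bad lam = {}"
proof -
  have "x \<notin> bad lam" for x
  proof
    assume "x \<in> bad lam"
    then obtain r where "0 < r" "ennreal (s0 * (V x r)\<^sup>2) < osc_mass w x r (lam * r)"
      using assms gh_le[of x] by (auto simp: bad_def osc_bad_def)
    then have "lam < 2 * L" using assms(1) by (intro osc_mass_radius(3)[of x r lam]) (auto intro: le_less_trans)
    then show False using assms by simp
  qed
  then show ?thesis by blast
qed

lemma bad_emeasure_finite: "0 < lam \<Longrightarrow> emeasure m (bad lam) < \<infinity>"
  by (rule emeasure_subset_ball(2)[of _ a "R + 2 * N / lam"]) (auto dest: bad_bounded)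

lemma good_central:
  assumes "x \<notin> bad lam" "r \<in> \<rat>" "0 < r"
  obtains c where "central w lam x r c"
proof -
  have "\<not> ennreal (s0 * (V x r)\<^sup>2) < osc_mass w x r (lam * r)"
    using assms by (auto simp: bad_def osc_bad_def)
  then show ?thesis using central_exists[OF w_measurable assms(3), of x lam] that unfolding not_less by blast
qed

text \<open>Telescoping over the radii \<open>r / 2 ^ n\<close>, which stay rational: consecutive
  central values differ by at most \<open>3 / 2 * lam * r / 2 ^ n\<close>, which sums to
  \<open>3 * lam * r\<close>, and their limit is \<open>w x\<close>.\<close>

lemma central_good:
  assumes "x \<notin> bad lam" "r \<in> \<rat>" "0 < r" "0 \<le> lam" and c: "central w lam x r c"
  shows "\<bar>c - w x\<bar> \<le> 3 * lam * r"
proof -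
  have "\<exists>c'. central w lam x (r / 2 ^ n) c' \<and> \<bar>c - c'\<bar> \<le> 3 * lam * r * (1 - 1 / 2 ^ n)" for n
  proof (induction n)
    case (Suc n)
    then obtain c' where c': "central w lam x (r / 2 ^ n) c'" "\<bar>c - c'\<bar> \<le> 3 * lam * r * (1 - 1 / 2 ^ n)" by blast
    obtain c'' where c'': "central w lam x (r / 2 ^ Suc n) c''"
      by (rule good_central[OF assms(1), of "r / 2 ^ Suc n"]) (use assms in auto)
    have "\<bar>c' - c''\<bar> \<le> lam * (r / 2 ^ n + r / 2 ^ Suc n)"
      using assms by (intro central_meet[OF w_measurable c'(1) c'']) (auto simp: field_simps)
    then have "\<bar>c - c''\<bar> \<le> 3 * lam * r * (1 - 1 / 2 ^ n) + lam * (r / 2 ^ n + r / 2 ^ Suc n)"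
      using c'(2) by linarith
    also have "\<dots> = 3 * lam * r * (1 - 1 / 2 ^ Suc n)" by (simp add: field_simps)
    finally show ?case using c'' by blast
  qed (use c in auto)
  then obtain c' where c': "\<And>n. central w lam x (r / 2 ^ n) (c' n)"
    "\<And>n. \<bar>c - c' n\<bar> \<le> 3 * lam * r * (1 - 1 / 2 ^ n)" by metis
  have "\<bar>c - w x\<bar> \<le> 3 * lam * r + (lam + L) * r * (1 / 2) ^ n" for n
  proof -
    have "\<bar>c' n - w x\<bar> \<le> (lam + L) * (r / 2 ^ n)"
      using assms by (intro central_near[OF w_measurable c'(1) w_lip]) auto
    moreover have "3 * lam * r * (1 - 1 / 2 ^ n) \<le> 3 * lam * r"
      using assms by (intro mult_left_le) auto
    ultimately show ?thesis using c'(2)[of n] by (simp add: power_divide)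
  qed
  moreover have "(\<lambda>n. 3 * lam * r + (lam + L) * r * (1 / 2) ^ n) \<longlonglongrightarrow> 3 * lam * r + (lam + L) * r * 0"
    by (intro tendsto_intros LIMSEQ_power_zero) auto
  ultimately show ?thesis by (intro LIMSEQ_le_const[of _ "3 * lam * r"]) auto
qed

text \<open>Choose a rational \<open>r\<close> between the distance and its double. In units of
  \<open>lam * r\<close>, the central values at radius \<open>2 * r\<close> around \<open>x\<close>
  and at radius \<open>r\<close> around \<open>y\<close> deviate from \<open>w\<close> by 6 and 3,
  and from each other by 3. The total 12 becomes 24 when \<open>r\<close> is replaced by twice the
  distance.\<close>

lemma good_lipschitz:
  assumes "x \<notin> bad lam" "y \<notin> bad lam" "0 \<le> lam"
  shows "\<bar>w x - w y\<bar> \<le> 24 * lam * dist x y"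
proof (cases "x = y")
  case False
  then have "dist x y < 2 * dist x y" by simp
  then obtain r where r: "r \<in> \<rat>" "dist x y < r" "r < 2 * dist x y" using Rats_dense_in_real by blast
  have r0: "0 < r" using r(2) by (meson dual_order.strict_trans2 zero_le_dist)
  obtain c where c: "central w lam x (2 * r) c"
    by (rule good_central[OF assms(1), of "2 * r"]) (use r r0 in auto)
  obtain c' where c': "central w lam y r c'"
    by (rule good_central[OF assms(2), of r]) (use r r0 in auto)
  have "\<bar>c - w x\<bar> \<le> 3 * lam * (2 * r)" using assms r r0 c by (intro central_good) auto
  moreover have "\<bar>c' - w y\<bar> \<le> 3 * lam * r" using assms r r0 c' by (intro central_good) auto
  moreover have "\<bar>c - c'\<bar> \<le> lam * (2 * r + r)" using r r0 by (intro central_meet[OF w_measurable c c']) auto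
  ultimately have "\<bar>w x - w y\<bar> \<le> 12 * lam * r" by (simp add: algebra_simps)
  also have "\<dots> \<le> 12 * lam * (2 * dist x y)" using r assms by (intro mult_left_mono) auto
  finally show ?thesis by simp
qed simp

text \<open>Pairs closer than \<open>eps\<close> are controlled by \<open>gh\<close> at a good
  point. Otherwise, moving both points to good ones at most triples the distance and costs one unit
  at each end: \<open>24 * 3 + 1 + 1 = 74\<close>.\<close>

lemma near_good_lipschitz:
  assumes "x' \<notin> bad lam" "dist x x' < eps" "y' \<notin> bad lam" "dist y y' < eps" "0 \<le> lam"
  shows "\<bar>w x - w y\<bar> \<le> 74 * lam * dist x y"
proof -
  have g: "gh x' \<le> lam" "gh y' \<le> lam" using assms by (auto simp: bad_def)
  show ?thesis
  proof (cases "dist x y < eps")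
    case True
    then have "\<bar>w x - w y\<bar> \<le> gh x' * dist x y"
      using assms eps_pos dist_triangle[of x' y x] by (intro gh_local) (auto simp: dist_commute)
    also have "\<dots> \<le> 74 * lam * dist x y" using g assms by (intro mult_right_mono) auto
    finally show ?thesis .
  next
    case False
    have 1: "\<bar>w z - w z'\<bar> \<le> lam * dist x y" if "gh z' \<le> lam" "dist z z' < eps" for z z'
    proof -
      have "\<bar>w z - w z'\<bar> \<le> gh z' * dist z z'"
        using that eps_pos by (intro gh_local) (auto simp: dist_commute)
      also have "\<dots> \<le> lam * dist x y" using that False assms(5) gh_nonneg[of z'] by (intro mult_mono) auto
      finally show ?thesis .
    qed
    have "dist x' y' \<le> dist x' x + dist x y + dist y y'" by metric
    then have "dist x' y' \<le> 3 * dist x y" using assms False by (simp add: dist_commute)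
    then have "24 * lam * dist x' y' \<le> 24 * lam * (3 * dist x y)" using assms by (intro mult_left_mono) auto
    then have "\<bar>w x' - w y'\<bar> \<le> 72 * lam * dist x y"
      using good_lipschitz[OF assms(1,3,5)] by simp
    then show ?thesis using 1[OF g(1) assms(2)] 1[OF g(2) assms(4)] by (simp add: algebra_simps)
  qed
qed

lemma truncate_exists:
  assumes "bad lam \<noteq> UNIV" "0 \<le> lam"
  obtains v where "(74 * lam)-lipschitz_on UNIV v" "\<And>x x'. x' \<notin> bad lam \<Longrightarrow> dist x x' < eps \<Longrightarrow> v x = w x"
proof -
  define S where "S = {x. \<exists>x'. x' \<notin> bad lam \<and> dist x x' < eps}"
  obtain x' where "x' \<notin> bad lam" using assms(1) by blast
  then have "x' \<in> S" using eps_pos by (auto simp: S_def)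
  then have "S \<noteq> {}" by blast
  moreover have "\<bar>w x - w y\<bar> \<le> 74 * lam * dist x y" if "x \<in> S" "y \<in> S" for x y
    using that near_good_lipschitz assms(2) by (auto simp: S_def)
  ultimately obtain v where "(74 * lam)-lipschitz_on UNIV v" "\<And>x. x \<in> S \<Longrightarrow> v x = w x"
    using mcshane_extension[of S "74 * lam" w] assms(2) by auto
  then show ?thesis by (intro that[of v]) (auto simp: S_def)
qed

end

lemma powr_sum_superadditive:
  fixes f :: "'b \<Rightarrow> real"
  assumes "finite T" "1 \<le> p" "\<And>i. i \<in> T \<Longrightarrow> 0 \<le> f i"
  shows "(\<Sum>i\<in>T. f i powr p) \<le> (\<Sum>i\<in>T. f i) powr p"
proof -
  define S where "S = (\<Sum>i\<in>T. f i)"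
  have S0: "0 \<le> S" using assms by (auto simp: S_def intro: sum_nonneg)
  have e: "t powr p = t * t powr (p - 1)" if "0 \<le> t" for t :: real
    using that assms(2) by (cases "t = 0") (auto simp: powr_mult_base)
  have "(\<Sum>i\<in>T. f i powr p) \<le> (\<Sum>i\<in>T. f i * S powr (p - 1))"
  proof (rule sum_mono)
    fix i assume i: "i \<in> T"
    have "f i \<le> S" using assms i unfolding S_def by (intro member_le_sum) auto
    then show "f i powr p \<le> f i * S powr (p - 1)"
      using assms i by (subst e) (auto intro!: mult_left_mono powr_mono2)
  qed
  also have "\<dots> = S powr p" by (subst e[OF S0]) (simp add: S_def sum_distrib_right)
  finally show ?thesis by (simp add: S_def)
qed

section \<open>Averaged truncations and the estimate for one bad ball\<close>

context poincare_space
begin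

text \<open>On a ball of large oscillation the Poincare inequality gives
  \<open>lam powr p \<le> C1\<close> times the mean of the \<open>p\<close>-th power of the slope.
  With \<open>c0\<close>, slopes up to \<open>c0 * lam\<close> account for at most half of this; the
  minimum with 1 keeps \<open>gh > lam\<close> inside \<open>gh > c0 * lam\<close>.
  \<open>K2\<close> and \<open>K3\<close> weight the higher bad sets after the factor
  \<open>D ^ 3\<close> of \<open>weak_type\<close>.\<close>

definition C1 :: real where "C1 = (4 * CP / s0) powr p"
definition c0 :: real where "c0 = min 1 ((1 / (2 * C1 * 4 powr p)) powr (1 / p))"
definition K2 :: real where "K2 = D ^ 3 * (2 * C1 * 4 powr p) * 74 powr p"
definition K3 :: real where "K3 = D ^ 3 * (4 / s0)"

lemma constants_pos: "0 < C1" "0 < c0" "c0 \<le> 1" "0 < K2" "0 < K3"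
  using CP_pos s0_pos D_ge_1 by (auto simp: C1_def c0_def K2_def K3_def min_def)

lemma s0_le_1: "s0 \<le> 1"
proof -
  have "1 \<le> D\<^sup>2" using D_ge_1 by simp
  then have "1 \<le> 8 * D\<^sup>2" by linarith
  then show ?thesis by (simp add: s0_def divide_le_eq_1)
qed

lemma c0_powr: "C1 * 4 powr p * c0 powr p \<le> 1 / 2"
proof -
  let ?z = "2 * C1 * 4 powr p"
  have z: "0 < ?z" using constants_pos by simp
  have "c0 powr p \<le> ((1 / ?z) powr (1 / p)) powr p"
    using p_gt_1 constants_pos(2) by (intro powr_mono2) (auto simp: c0_def)
  also have "\<dots> = 1 / ?z" using p_gt_1 z by (simp add: powr_powr)
  finally have "?z * c0 powr p \<le> ?z * (1 / ?z)" using z by (intro mult_left_mono) auto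
  moreover have "?z * (1 / ?z) = 1" using constants_pos(1) by simp
  ultimately have "?z * c0 powr p \<le> 1" by linarith
  then show ?thesis by (simp add: mult_ac)
qed

lemma absorption_index: "\<exists>k::nat. 0 < k \<and> K2 * real k powr (1 - p) + K3 * (2 ^ k) powr (- p) \<le> 1 / 2"
proof -
  have "(\<lambda>k::nat. K2 * real k powr (1 - p) + K3 * (2 ^ k) powr (- p)) \<longlonglongrightarrow> K2 * 0 + K3 * 0"
  proof (intro tendsto_intros)
    show "(\<lambda>k::nat. real k powr (1 - p)) \<longlonglongrightarrow> 0"
      using p_gt_1 by (intro tendsto_neg_powr filterlim_real_sequentially) auto
    have "filterlim (\<lambda>k::nat. (2::real) ^ k) at_top sequentially"
      by (rule filterlim_at_infinity_imp_filterlim_at_top[OF filterlim_realpow_sequentially_gt1]) auto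
    then show "(\<lambda>k::nat. ((2::real) ^ k) powr (- p)) \<longlonglongrightarrow> 0"
      using p_gt_1 by (intro tendsto_neg_powr) auto
  qed
  then have "\<forall>\<^sub>F k::nat in sequentially. K2 * real k powr (1 - p) + K3 * (2 ^ k) powr (- p) < 1 / 2"
    by (intro order_tendstoD(2)[of _ "K2 * 0 + K3 * 0"]) auto
  then have "\<forall>\<^sub>F k::nat in sequentially. 0 < k \<and> K2 * real k powr (1 - p) + K3 * (2 ^ k) powr (- p) < 1 / 2"
    using eventually_gt_at_top[of 0] by eventually_elim auto
  then show ?thesis by (auto dest!: eventually_happens simp: less_imp_le)
qed

end

context truncation
begin

text \<open>Off its bad set a truncation agrees with \<open>w\<close> on a ball of radius
  \<open>eps\<close>, so \<open>gh\<close> bounds its slope; on the bad set only the global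
  Lipschitz constant is left.\<close>

definition cap :: "nat \<Rightarrow> real \<Rightarrow> nat \<Rightarrow> 'a \<Rightarrow> real" where
  "cap k lam j x = (if x \<in> bad (2 ^ (k + j) * lam) then 74 * (2 ^ (k + j) * lam) else gh x)"

text \<open>Starting the heights at index \<open>k\<close> keeps \<open>h\<close> equal to
  \<open>w\<close> off \<open>bad (2 ^ k * lam)\<close>; in the dyadic sum this altered set enters
  with the small factor \<open>(2 ^ k) powr (- p)\<close>. The support stays bounded because the
  higher bad sets lie in \<open>bad lam\<close>.\<close>

lemma averaged_truncation:
  assumes k: "0 < k" and lam: "0 < lam" and ne: "bad (2 ^ k * lam) \<noteq> UNIV"
  obtains h where "h \<in> LIP_bs" "\<And>x. x \<notin> bad (2 ^ k * lam) \<Longrightarrow> h x = w x"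
    "\<And>x. 0 \<le> slope h x" "\<And>x. slope h x \<le> (\<Sum>j<k. cap k lam j x) / k"
proof -
  let ?l = "\<lambda>j. 2 ^ (k + j) * lam"
  have lj: "0 < ?l j" for j using lam by simp
  have kl: "lam \<le> ?l j" for j using mult_right_mono[of 1 "2 ^ (k + j)" lam] lam by simp
  have kl': "2 ^ k * lam \<le> ?l j" for j
    using lam by (intro mult_right_mono power_increasing) auto
  have "bad (?l j) \<noteq> UNIV" for j using ne bad_antimono[OF kl'[of j]] by blast
  then have "\<exists>v. (74 * ?l j)-lipschitz_on UNIV v \<and> (\<forall>x x'. x' \<notin> bad (?l j) \<longrightarrow> dist x x' < eps \<longrightarrow> v x = w x)" for j
    using truncate_exists[of "?l j"] lj[of j] by (metis less_imp_le)
  then obtain v where v: "\<And>j. (74 * ?l j)-lipschitz_on UNIV (v j)"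
    "\<And>j x x'. x' \<notin> bad (?l j) \<Longrightarrow> dist x x' < eps \<Longrightarrow> v j x = w x" by metis
  have vw: "v j x = w x" if "x \<notin> bad (?l j)" for j x using v(2)[OF that, of x] eps_pos by simp
  define h where "h x = (\<Sum>j<k. v j x) / k" for x
  have hdiff: "\<bar>h x - h y\<bar> \<le> (\<Sum>j<k. c j) / k * dist x y"
    if "\<And>j. j < k \<Longrightarrow> \<bar>v j x - v j y\<bar> \<le> c j * dist x y" for x y c
  proof -
    have "\<bar>h x - h y\<bar> = \<bar>\<Sum>j<k. v j x - v j y\<bar> / k"
      by (simp add: h_def sum_subtractf diff_divide_distrib[symmetric])
    also have "\<dots> \<le> (\<Sum>j<k. \<bar>v j x - v j y\<bar>) / k" by (intro divide_right_mono sum_abs) auto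
    also have "\<dots> \<le> (\<Sum>j<k. c j * dist x y) / k" using that by (intro divide_right_mono sum_mono) auto
    finally show ?thesis by (simp add: sum_distrib_right)
  qed
  have lip: "((\<Sum>j<k. 74 * ?l j) / k)-lipschitz_on UNIV h"
  proof (rule lipschitz_onI)
    fix x y show "dist (h x) (h y) \<le> (\<Sum>j<k. 74 * ?l j) / k * dist x y"
      unfolding dist_real_def by (rule hdiff) (rule lipschitz_abs_diff[OF v(1)])
  qed (use lj in \<open>auto intro!: divide_nonneg_nonneg sum_nonneg simp: less_imp_le\<close>)
  have N0: "0 \<le> N" using w_le[of a] by linarith
  have "h \<in> LIP_bs"
  proof (rule LIP_bsI[OF lip])
    fix x assume x: "R + 2 * N / lam \<le> dist a x"
    have "v j x = 0" for j
    proof -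
      have "x \<notin> bad lam" using bad_bounded[OF lam, of x] x by auto
      then have "v j x = w x" using bad_antimono[OF kl[of j]] by (intro vw) blast
      moreover have "R \<le> dist a x" using x N0 lam by (smt (verit) divide_nonneg_pos)
      ultimately show ?thesis using w_support by simp
    qed
    then show "h x = 0" by (simp add: h_def)
  qed
  moreover have "h x = w x" if "x \<notin> bad (2 ^ k * lam)" for x
  proof -
    have "v j x = w x" for j using that bad_antimono[OF kl'[of j]] by (intro vw) blast
    then show ?thesis using k by (simp add: h_def)
  qed
  moreover have "0 \<le> slope h x \<and> slope h x \<le> (\<Sum>j<k. cap k lam j x) / k" for x
  proof -
    have c0: "0 \<le> (\<Sum>j<k. cap k lam j x) / k"
      using lj gh_nonneg[of x] by (intro divide_nonneg_nonneg sum_nonneg) (auto simp: cap_def less_imp_le)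
    have "\<bar>h x - h y\<bar> \<le> (\<Sum>j<k. cap k lam j x) / k * dist x y" if xy: "dist x y < eps" for y
    proof (rule hdiff)
      fix j
      show "\<bar>v j x - v j y\<bar> \<le> cap k lam j x * dist x y"
      proof (cases "x \<in> bad (?l j)")
        case True
        then show ?thesis using lipschitz_abs_diff[OF v(1), of j x y] by (simp add: cap_def)
      next
        case False
        then have "v j x = w x" "v j y = w y" using vw v(2)[OF False, of y] xy by (auto simp: dist_commute)
        then show ?thesis using gh_local[of x x y] xy eps_pos False by (simp add: cap_def)
      qed
    qed
    then show ?thesis using slope_bounds[OF eps_pos c0] by blast
  qed
  ultimately show ?thesis using that by blast
qed

text \<open>Off the bad set of a level, \<open>gh\<close> is at most that level, hence at most
  \<open>4 ^ k * lam\<close>. This replaces \<open>gh powr p\<close> by a multiple of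
  \<open>lam powr p\<close> on \<open>gh > c0 * lam\<close> and removes the logarithm. The heights
  of the bad sets grow geometrically, so \<open>powr_sum_two_power_le\<close> leaves the factor
  \<open>k powr (- p)\<close> intact.\<close>

lemma cap_sum_powr:
  assumes k: "0 < k" and lam: "0 < lam"
  shows "((\<Sum>j<k. cap k lam j x) / k) powr p \<le> 4 powr p * ((c0 * lam) powr p
     + (4 ^ k * lam) powr p * indicator {x. c0 * lam < gh x} x
     + (74 / k) powr p * (\<Sum>j<k. (2 ^ (k + j) * lam) powr p * indicator (bad (2 ^ (k + j) * lam)) x))"
proof -
  let ?l = "\<lambda>j. 2 ^ (k + j) * lam"
  define X where "X = 4 ^ k * lam * (indicator {x. c0 * lam < gh x} x :: real)"
  define T where "T = {j. j < k \<and> x \<in> bad (?l j)}"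
  define Y where "Y = (\<Sum>j\<in>T. ?l j)"
  have fT: "finite T" by (simp add: T_def)
  have Ysum: "Y = (\<Sum>j<k. ?l j * indicator (bad (?l j)) x)"
    unfolding Y_def T_def by (intro sum.mono_neutral_cong_left) (auto simp: indicator_def)
  have c: "cap k lam j x \<le> c0 * lam + X + 74 * (?l j * indicator (bad (?l j)) x)" if "j < k" for j
  proof (cases "x \<in> bad (?l j)")
    case True
    then show ?thesis using lam constants_pos by (auto simp: cap_def X_def indicator_def)
  next
    case False
    then have "gh x \<le> ?l j" by (auto simp: bad_def)
    also have "?l j \<le> 2 ^ (k + k) * lam" using that lam by (intro mult_right_mono power_increasing) auto
    also have "(2::real) ^ (k + k) = 4 ^ k" by (simp add: power_add power_mult_distrib[symmetric])
    finally have "gh x \<le> 4 ^ k * lam" .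
    moreover have "0 < c0 * lam" using lam constants_pos by simp
    ultimately show ?thesis using False by (auto simp: cap_def X_def indicator_def)
  qed
  have "(\<Sum>j<k. cap k lam j x) \<le> (\<Sum>j<k. c0 * lam + X + 74 * (?l j * indicator (bad (?l j)) x))"
    using c by (intro sum_mono) auto
  also have "\<dots> = k * (c0 * lam + X) + 74 * Y" by (simp add: sum.distrib Ysum sum_distrib_left algebra_simps)
  finally have "(\<Sum>j<k. cap k lam j x) / k \<le> (k * (c0 * lam + X) + 74 * Y) / k" by (intro divide_right_mono) auto
  also have "\<dots> = (c0 * lam + X) + 74 / k * Y" using k by (simp add: field_simps)
  finally have 1: "(\<Sum>j<k. cap k lam j x) / k \<le> (c0 * lam + X) + 74 / k * Y" .
  have X0: "0 \<le> X" using lam by (simp add: X_def)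
  have Y0: "0 \<le> Y" using lam by (auto simp: Y_def intro!: sum_nonneg)
  have s0: "0 \<le> (\<Sum>j<k. cap k lam j x) / k"
    using lam gh_nonneg[of x] by (intro divide_nonneg_nonneg sum_nonneg) (auto simp: cap_def)
  have "Y = (\<Sum>j\<in>T. 2 ^ j * (2 ^ k * lam))" by (simp add: Y_def power_add mult_ac)
  then have "Y powr p \<le> 2 powr p * (\<Sum>j\<in>T. (2 ^ j * (2 ^ k * lam)) powr p)"
    using powr_sum_two_power_le[OF fT, of p "2 ^ k * lam"] p_gt_1 lam by simp
  also have "(\<Sum>j\<in>T. (2 ^ j * (2 ^ k * lam)) powr p) = (\<Sum>j<k. ?l j powr p * indicator (bad (?l j)) x)"
    unfolding T_def by (intro sum.mono_neutral_cong_left) (auto simp: indicator_def power_add mult_ac)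
  finally have Yp: "Y powr p \<le> 2 powr p * (\<Sum>j<k. ?l j powr p * indicator (bad (?l j)) x)" .
  have Yp': "(74 / k * Y) powr p \<le> (74 / k) powr p * (2 powr p * (\<Sum>j<k. ?l j powr p * indicator (bad (?l j)) x))"
    unfolding powr_mult[of "74 / k" Y] by (intro mult_left_mono Yp) auto
  have Xp: "X powr p = (4 ^ k * lam) powr p * indicator {x. c0 * lam < gh x} x"
    using p_gt_1 by (simp add: X_def indicator_def)
  have "((\<Sum>j<k. cap k lam j x) / k) powr p \<le> ((c0 * lam + X) + 74 / k * Y) powr p"
    using 1 s0 p_gt_1 by (intro powr_mono2) auto
  also have "\<dots> \<le> 2 powr p * ((c0 * lam + X) powr p + (74 / k * Y) powr p)"
    using X0 Y0 lam constants_pos p_gt_1 by (intro powr_add_le) auto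
  also have "\<dots> \<le> 2 powr p * (2 powr p * ((c0 * lam) powr p + X powr p)
      + (74 / k) powr p * (2 powr p * (\<Sum>j<k. ?l j powr p * indicator (bad (?l j)) x)))"
    using X0 lam constants_pos p_gt_1
    by (intro mult_left_mono add_mono powr_add_le Yp') auto
  also have "\<dots> = (2 powr p * 2 powr p) * ((c0 * lam) powr p + X powr p
      + (74 / k) powr p * (\<Sum>j<k. ?l j powr p * indicator (bad (?l j)) x))"
    by (simp add: algebra_simps)
  also have "(2::real) powr p * 2 powr p = 4 powr p" by (simp flip: powr_mult)
  finally show ?thesis by (simp only: Xp)
qed

text \<open>The bound of \<open>cap_sum_powr\<close> without its first term, scaled by
  \<open>2 * C1 / lam powr p\<close>, plus a density for the altered set. This normalisation gives
  every ball of large oscillation a mass of at least its volume, as \<open>weak_type\<close>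
  requires.\<close>

definition majorant :: "nat \<Rightarrow> real \<Rightarrow> 'a \<Rightarrow> real" where
  "majorant k lam x = 2 * C1 * 4 powr p * ((4 ^ k) powr p * indicator {x. c0 * lam < gh x} x
     + (74 / k) powr p * (\<Sum>j<k. (2 ^ (k + j)) powr p * indicator (bad (2 ^ (k + j) * lam)) x))
     + 4 / s0 * indicator (bad (2 ^ k * lam)) x"

lemma majorant_nonneg: "0 \<le> majorant k lam x"
  using constants_pos s0_pos unfolding majorant_def by (auto intro!: add_nonneg_nonneg mult_nonneg_nonneg sum_nonneg)

lemma majorant_measurable [measurable]: "majorant k lam \<in> borel_measurable m"
  unfolding majorant_def[abs_def] by measurable

text \<open>Either the altered set fills more than \<open>s0 / 4\<close> of the ball, and the last
  term of \<open>majorant\<close> pays, or replacing \<open>w\<close> by \<open>h\<close> loses at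
  most half of the oscillation, and the Poincare inequality for \<open>h\<close> applies.\<close>

lemma weak_step:
  assumes k: "0 < k" and lam: "0 < lam" and r: "0 < r"
    and osc: "ennreal (s0 * (V x r)\<^sup>2) < osc_mass w x r (lam * r)"
  shows "V x r \<le> (LINT y:ball x r|m. majorant k lam y)"
proof -
  let ?U = "bad (2 ^ k * lam)"
  let ?B = "ball x r"
  have V0: "0 < V x r" by (rule ball_pos[OF r])
  have maj_bd: "\<bar>majorant k lam y\<bar> \<le> 2 * C1 * 4 powr p * ((4 ^ k) powr p * 1
     + (74 / k) powr p * (\<Sum>j<k. (2 ^ (k + j)) powr p * 1)) + 4 / s0 * 1" for y
    unfolding abs_of_nonneg[OF majorant_nonneg] unfolding majorant_def
    using constants_pos s0_pos
    by (intro add_mono mult_left_mono sum_mono indicator_le_1) (auto intro!: mult_nonneg_nonneg)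
  have imaj: "set_integrable m ?B (majorant k lam)"
    by (rule set_integrable_ball[OF majorant_measurable maj_bd])
  show ?thesis
  proof (cases "measure m (?U \<inter> ?B) \<le> s0 / 4 * V x r")
    case False
    have "V x r \<le> 4 / s0 * measure m (?U \<inter> ?B)" using False s0_pos by (simp add: field_simps)
    also have "\<dots> = (LINT y:?B|m. 4 / s0 * indicator ?U y)"
      by (simp add: set_lebesgue_integral_def indicator_inter_arith[symmetric] Int_commute)
    also have "\<dots> \<le> (LINT y:?B|m. majorant k lam y)"
    proof (rule set_integral_mono[OF _ imaj])
      show "set_integrable m ?B (\<lambda>y. 4 / s0 * indicator ?U y)"
        using s0_pos by (intro set_integrable_ball[of _ "4 / s0"]) (auto simp: indicator_def)
      show "4 / s0 * indicator ?U y \<le> majorant k lam y" for y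
        using constants_pos unfolding majorant_def by (auto intro!: add_nonneg_nonneg mult_nonneg_nonneg sum_nonneg)
    qed
    finally show ?thesis .
  next
    case True
    \<comment> \<open>Truncation needs a good point. A bad set equal to the whole space would
      violate the case assumption, as \<open>s0 < 4\<close>.\<close>
    have "?U \<noteq> UNIV"
    proof
      assume "?U = UNIV"
      then have "V x r \<le> s0 / 4 * V x r" using True by simp
      moreover have "s0 < 4" using s0_le_1 by simp
      ultimately show False using V0 by simp
    qed
    then obtain h where h: "h \<in> LIP_bs" "\<And>x. x \<notin> ?U \<Longrightarrow> h x = w x"
      "\<And>x. 0 \<le> slope h x" "\<And>x. slope h x \<le> (\<Sum>j<k. cap k lam j x) / k"
      using averaged_truncation[OF k lam] by blast
    obtain Lh Nh ah Rh where hL: "Lh-lipschitz_on UNIV h" and hN: "\<And>x. \<bar>h x\<bar> \<le> Nh"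
      by (rule LIP_bsE[OF h(1)]) blast
    have hc: "continuous_on UNIV h" by (rule lipschitz_on_continuous_on[OF hL])
    have [measurable]: "h \<in> borel_measurable m"
      using borel_measurable_continuous_onI[OF hc] measurable_cong_sets[OF sets_m refl] by blast
    have [measurable]: "slope h \<in> borel_measurable m"
      using slope_measurable[OF hc] measurable_cong_sets[OF sets_m refl] by blast
    define A where "A = ball_avg m x r (\<lambda>y. slope h y powr p)"
    define b where "b = ball_avg m x r (\<lambda>y. \<bar>h y - ball_avg m x r h\<bar>)"
    have "ennreal (s0 * (V x r)\<^sup>2) < ennreal (2 * (V x r)\<^sup>2 / (lam * r) * b) + ennreal (2 * measure m (?U \<inter> ?B) * V x r)"
    proof -
      have "osc_mass w x r (lam * r) \<le> osc_mass h x r (lam * r) + ennreal (2 * measure m (?U \<inter> ?B) * V x r)"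
        by (rule osc_mass_change) (use h in auto)
      also have "osc_mass h x r (lam * r) \<le> ennreal (2 * (V x r)\<^sup>2 / (lam * r) * b)"
        unfolding b_def using hN lam r by (intro osc_mass_chebyshev) auto
      finally show ?thesis using osc by (auto intro: less_le_trans add_right_mono)
    qed
    moreover have b0: "0 \<le> b" unfolding b_def by (rule ball_avg_nonneg) simp
    ultimately have "s0 * (V x r)\<^sup>2 < 2 * (V x r)\<^sup>2 / (lam * r) * b + 2 * measure m (?U \<inter> ?B) * V x r"
      using lam r V0 s0_pos by (subst (asm) ennreal_plus[symmetric]) (auto simp: ennreal_less_iff simp del: ennreal_plus)
    also have "\<dots> \<le> 2 * (V x r)\<^sup>2 / (lam * r) * b + 2 * (s0 / 4 * V x r) * V x r"
      using True V0 by (intro add_left_mono mult_right_mono mult_left_mono) auto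
    finally have *: "s0 * (V x r)\<^sup>2 < 2 * (V x r)\<^sup>2 / (lam * r) * b + 2 * (s0 / 4 * V x r) * V x r" .
    have "2 * (V x r)\<^sup>2 / (lam * r) * b = (V x r)\<^sup>2 * (2 / (lam * r) * b)"
      "2 * (s0 / 4 * V x r) * V x r = s0 * (V x r)\<^sup>2 - (V x r)\<^sup>2 * (s0 / 2)"
      by (simp_all add: power2_eq_square)
    with * have "(V x r)\<^sup>2 * (s0 / 2) < (V x r)\<^sup>2 * (2 / (lam * r) * b)" by linarith
    then have "s0 / 2 < 2 / (lam * r) * b" using V0 by (subst (asm) mult_less_cancel_left_pos) auto
    also have "\<dots> \<le> 2 / (lam * r) * (CP * r * A powr (1 / p))"
      unfolding b_def A_def using poincare[OF h(1) r, of x] lam r by (intro mult_left_mono) auto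
    finally have "lam < 4 * CP / s0 * A powr (1 / p)" using s0_pos lam r by (simp add: field_simps)
    then have "lam powr p \<le> (4 * CP / s0 * A powr (1 / p)) powr p" using lam p_gt_1 by (intro powr_mono2) auto
    also have "\<dots> = C1 * A"
    proof -
      have "0 \<le> A" unfolding A_def by (rule ball_avg_nonneg) simp
      then show ?thesis using CP_pos s0_pos p_gt_1 unfolding C1_def by (subst powr_mult) (auto simp: powr_powr)
    qed
    finally have lamA: "lam powr p \<le> C1 * A" .
    let ?g = "\<lambda>y. lam powr p / (2 * C1) * majorant k lam y"
    have pt: "slope h y powr p \<le> 4 powr p * (c0 * lam) powr p + ?g y" for y
    proof -
      have "slope h y powr p \<le> ((\<Sum>j<k. cap k lam j y) / k) powr p"
        using h p_gt_1 by (intro powr_mono2) auto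
      also note cap_sum_powr[OF k lam, of y]
      also have "4 powr p * ((c0 * lam) powr p
         + (4 ^ k * lam) powr p * indicator {x. c0 * lam < gh x} y
         + (74 / k) powr p * (\<Sum>j<k. (2 ^ (k + j) * lam) powr p * indicator (bad (2 ^ (k + j) * lam)) y))
         = 4 powr p * (c0 * lam) powr p + lam powr p / (2 * C1) * (2 * C1 * 4 powr p * ((4 ^ k) powr p * indicator {x. c0 * lam < gh x} y
         + (74 / k) powr p * (\<Sum>j<k. (2 ^ (k + j)) powr p * indicator (bad (2 ^ (k + j) * lam)) y)))"
      proof -
        define S where "S = (\<Sum>j<k. (2 ^ (k + j)) powr p * (indicator (bad (2 ^ (k + j) * lam)) y :: real))"
        have "(\<Sum>j<k. (2 ^ (k + j) * lam) powr p * (indicator (bad (2 ^ (k + j) * lam)) y :: real)) = lam powr p * S"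
          unfolding S_def sum_distrib_left by (intro sum.cong refl) (simp only: powr_mult mult_ac)
        then show ?thesis unfolding S_def[symmetric] using lam constants_pos
          by (simp only: powr_mult) (simp add: algebra_simps)
      qed
      also have "\<dots> \<le> 4 powr p * (c0 * lam) powr p + ?g y"
        unfolding majorant_def using lam constants_pos s0_pos by (intro add_left_mono mult_left_mono) auto
      finally show ?thesis .
    qed
    have ig: "set_integrable m ?B ?g" using imaj by (intro set_integrable_mult_right) auto
    have ic: "set_integrable m ?B (\<lambda>_. 4 powr p * (c0 * lam) powr p)"
      by (rule set_integrable_ball[of _ "4 powr p * (c0 * lam) powr p"]) auto
    have "(LINT y:?B|m. slope h y powr p) \<le> (LINT y:?B|m. 4 powr p * (c0 * lam) powr p + ?g y)"
    proof (rule set_integral_mono[OF _ set_integral_add(1)[OF ic ig] pt])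
      show "set_integrable m ?B (\<lambda>y. slope h y powr p)"
        using slope_lipschitz[OF hL] p_gt_1
        by (intro set_integrable_ball[of _ "Lh powr p"]) (auto intro!: powr_mono2)
    qed
    also have "\<dots> = V x r * (4 powr p * (c0 * lam) powr p) + lam powr p / (2 * C1) * (LINT y:?B|m. majorant k lam y)"
      using finite_ball[of x r] by (subst set_integral_add(2)[OF ic ig]) (simp add: set_lebesgue_integral_def mult_ac)
    finally have "V x r * (C1 * A) \<le> C1 * (V x r * (4 powr p * (c0 * lam) powr p) + lam powr p / (2 * C1) * (LINT y:?B|m. majorant k lam y))"
      using V0 constants_pos(1) by (simp add: A_def ball_avg_def)
    also have "\<dots> = V x r * lam powr p * (C1 * 4 powr p * c0 powr p) + lam powr p / 2 * (LINT y:?B|m. majorant k lam y)"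
      using lam constants_pos by (simp add: powr_mult algebra_simps)
    \<comment> \<open>By the choice of \<open>c0\<close> the constant part is at most half of the
      left side and can be subtracted.\<close>
    also have "\<dots> \<le> V x r * lam powr p * (1 / 2) + lam powr p / 2 * (LINT y:?B|m. majorant k lam y)"
      using c0_powr V0 by (intro add_right_mono mult_left_mono) auto
    finally have "V x r * lam powr p \<le> V x r * lam powr p * (1 / 2) + lam powr p / 2 * (LINT y:?B|m. majorant k lam y)"
      using mult_left_mono[OF lamA, of "V x r"] V0 by linarith
    then have "lam powr p / 2 * V x r \<le> lam powr p / 2 * (LINT y:?B|m. majorant k lam y)" by (simp add: mult_ac)
    then show ?thesis using lam by (subst (asm) mult_le_cancel_left_pos) auto
  qed
qed

end

section \<open>Summation over dyadic levels and the Hajlasz gradient\<close>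

text \<open>As \<open>a\<close> is nonnegative and vanishes from \<open>n\<close> on, every shifted
  sum is bounded by the unshifted one; the \<open>k\<close> shifts in the middle term turn
  \<open>Ka\<close> into \<open>Ka * k\<close>. The sum is finite, so half of it can be
  subtracted.\<close>

lemma absorb_shifted_sums:
  fixes a b :: "nat \<Rightarrow> real"
  assumes a0: "\<And>i. 0 \<le> a i" and an: "\<And>i. n \<le> i \<Longrightarrow> a i = 0" and K: "0 \<le> Ka" "0 \<le> Kb"
    and le: "\<And>i. a i \<le> K1 * b i + Ka * (\<Sum>j<k. a (i + k + j)) + Kb * a (i + k)"
    and small: "Ka * k + Kb \<le> 1 / 2"
  shows "(\<Sum>i<n. a i) \<le> 2 * K1 * (\<Sum>i<n. b i)"
proof -
  define A where "A = (\<Sum>i<n. a i)"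
  have shift: "(\<Sum>i<n. a (i + l)) \<le> A" for l
  proof -
    have "(\<Sum>i<n. a (i + l)) = (\<Sum>i\<in>(\<lambda>i. i + l) ` {..<n}. a i)" by (subst sum.reindex) auto
    also have "\<dots> \<le> (\<Sum>i<n + l. a i)" using a0 by (intro sum_mono2) auto
    also have "\<dots> = A" unfolding A_def using an by (intro sum.mono_neutral_right) auto
    finally show ?thesis .
  qed
  have A0: "0 \<le> A" using a0 by (auto simp: A_def intro: sum_nonneg)
  have "A \<le> (\<Sum>i<n. K1 * b i + Ka * (\<Sum>j<k. a (i + k + j)) + Kb * a (i + k))"
    unfolding A_def by (intro sum_mono le)
  also have "\<dots> = K1 * (\<Sum>i<n. b i) + Ka * (\<Sum>j<k. \<Sum>i<n. a (i + (k + j))) + Kb * (\<Sum>i<n. a (i + k))"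
    by (subst sum.swap[of _ "{..<n}"]) (simp add: sum.distrib sum_distrib_left add.assoc)
  also have "\<dots> \<le> K1 * (\<Sum>i<n. b i) + Ka * (\<Sum>j<k. A) + Kb * A"
    using K shift by (intro add_mono[OF add_mono[OF order_refl mult_left_mono] mult_left_mono] sum_mono) auto
  also have "\<dots> = K1 * (\<Sum>i<n. b i) + (Ka * k + Kb) * A" by (simp add: algebra_simps)
  also have "\<dots> \<le> K1 * (\<Sum>i<n. b i) + 1 / 2 * A" using small A0 by (intro add_left_mono mult_right_mono) auto
  finally show ?thesis by (simp add: A_def)
qed

context doubling_space
begin

text \<open>The slack \<open>24 * l\<close> is there because only levels above \<open>l\<close> are summed, which keeps all sums finite.\<close>

definition hajlasz_gradient :: "('a \<Rightarrow> real) \<Rightarrow> real \<Rightarrow> ('a \<Rightarrow> real) \<Rightarrow> bool" where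
  "hajlasz_gradient w l G \<longleftrightarrow> G \<in> borel_measurable m \<and> (\<forall>x. 0 \<le> G x) \<and>
     (\<forall>x y. \<bar>w x - w y\<bar> - 24 * l * dist x y \<le> dist x y * max (G x) (G y))"

end

context poincare_space
begin

abbreviation pint :: "('a \<Rightarrow> real) \<Rightarrow> ennreal" where
  "pint h \<equiv> \<integral>\<^sup>+x. ennreal (h x powr p) \<partial>m"

definition K1 :: "nat \<Rightarrow> real" where "K1 k = 1 + D ^ 3 * (2 * C1 * 4 powr p) * (4 ^ k) powr p"

definition Kh :: "nat \<Rightarrow> real" where "Kh k = 48 powr p * (2 * K1 k * (2 / c0) powr p)"

lemma K1_nonneg: "0 \<le> K1 k"
  using constants_pos D_ge_1 unfolding K1_def by (intro add_nonneg_nonneg mult_nonneg_nonneg) auto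

end

context truncation
begin

lemma gh_level_fmeasurable: "0 \<le> t \<Longrightarrow> {x. t < gh x} \<in> fmeasurable m"
proof (rule fmeasurableI2[OF ball_fmeasurable[of a R]])
  assume "0 \<le> t"
  show "{x. t < gh x} \<subseteq> ball a R"
  proof
    fix x assume "x \<in> {x. t < gh x}"
    then have "gh x \<noteq> 0" using \<open>0 \<le> t\<close> by auto
    then show "x \<in> ball a R" using gh_support[of x] by (simp add: not_le[symmetric]) blast
  qed
qed simp

lemma bad_fmeasurable: "0 < lam \<Longrightarrow> bad lam \<in> fmeasurable m"
  using bad_emeasure_finite by (intro fmeasurableI) auto

lemma gh_powr_integrable: "integrable m (\<lambda>x. gh x powr p)"
  using gh_le gh_nonneg gh_support p_gt_1
  by (intro integrable_bounded_support[of _ a R "M powr p"]) (auto intro!: powr_mono2)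

definition mb :: "real \<Rightarrow> real" where "mb lam = measure m (bad lam)"
definition mg :: "real \<Rightarrow> real" where "mg t = measure m {x. t < gh x}"

lemma bad_estimate:
  assumes k: "0 < k" and lam: "0 < lam"
  shows "mb lam \<le> K1 k * mg (c0 * lam)
     + K2 * real k powr (- p) * (\<Sum>j<k. (2 ^ (k + j)) powr p * mb (2 ^ (k + j) * lam)) + K3 * mb (2 ^ k * lam)"
proof -
  define A where "A = osc_bad lam"
  have Am [measurable]: "A \<in> sets m" by (simp add: A_def)
  have ind_int: "integrable m (indicator S :: 'a \<Rightarrow> real)" if "S \<in> fmeasurable m" for S
    using that by (auto simp: fmeasurable_def intro!: integrable_real_indicator)
  have c0lam: "0 \<le> c0 * lam" using constants_pos lam by simp
  have ii: "integrable m (indicator {x. c0 * lam < gh x} :: 'a \<Rightarrow> real)"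
    "\<And>l. integrable m (indicator (bad (2 ^ l * lam)) :: 'a \<Rightarrow> real)"
    using lam by (auto intro!: ind_int gh_level_fmeasurable[OF c0lam] bad_fmeasurable)
  have im: "integrable m (majorant k lam)"
    unfolding majorant_def[abs_def] by (intro Bochner_Integration.integrable_add integrable_mult_right Bochner_Integration.integrable_sum ii)
  define I where "I = 2 * C1 * 4 powr p * ((4 ^ k) powr p * mg (c0 * lam)
     + (74 / k) powr p * (\<Sum>j<k. (2 ^ (k + j)) powr p * mb (2 ^ (k + j) * lam)))
     + 4 / s0 * mb (2 ^ k * lam)"
  have I: "(\<integral>x. majorant k lam x \<partial>m) = I"
    unfolding majorant_def I_def mg_def mb_def using ii
    by (simp add: Bochner_Integration.integral_sum Bochner_Integration.integrable_sum del: sum_mult_indicator)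
  have "emeasure m A \<le> ennreal (D ^ 3) * (\<integral>\<^sup>+x. ennreal (majorant k lam x) \<partial>m)"
  proof (rule weak_type[of _ _ "2 * N / lam"])
    fix x assume "x \<in> A"
    then obtain r where r: "0 < r" "ennreal (s0 * (V x r)\<^sup>2) < osc_mass w x r (lam * r)"
      by (auto simp: A_def osc_bad_def)
    \<comment> \<open>The covering argument needs bounded radii; the bound on \<open>w\<close>
      supplies one for each positive level.\<close>
    have "r < 2 * N / lam" using r lam by (intro osc_mass_radius(1)[of x]) (auto intro: le_less_trans)
    moreover have "ennreal (V x r) \<le> (\<integral>\<^sup>+y\<in>ball x r. ennreal (majorant k lam y) \<partial>m)"
    proof -
      have "set_integrable m (ball x r) (majorant k lam)"
        using im unfolding set_integrable_def by (intro integrable_mult_indicator) auto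
      then have "(\<integral>\<^sup>+y\<in>ball x r. ennreal (majorant k lam y) \<partial>m) = ennreal (LINT y:ball x r|m. majorant k lam y)"
      proof -
        have "(\<integral>\<^sup>+y\<in>ball x r. ennreal (majorant k lam y) \<partial>m) = (\<integral>\<^sup>+y. ennreal (indicator (ball x r) y *\<^sub>R majorant k lam y) \<partial>m)"
          by (intro nn_integral_cong) (auto simp: indicator_def)
        also have "\<dots> = ennreal (LINT y:ball x r|m. majorant k lam y)"
          unfolding set_lebesgue_integral_def
          using \<open>set_integrable m (ball x r) (majorant k lam)\<close> majorant_nonneg
          by (intro nn_integral_eq_integral) (auto simp: set_integrable_def)
        finally show ?thesis .
      qed
      then show ?thesis using weak_step[OF k lam r] by (simp add: ennreal_leI)
    qed
    ultimately show "\<exists>r>0. r \<le> 2 * N / lam \<and> ennreal (V x r) \<le> (\<integral>\<^sup>+y\<in>ball x r. ennreal (majorant k lam y) \<partial>m)"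
      using r by (intro exI[of _ r]) auto
  qed measurable
  also have "(\<integral>\<^sup>+x. ennreal (majorant k lam x) \<partial>m) = ennreal I"
    using im majorant_nonneg I by (subst nn_integral_eq_integral) auto
  finally have eA: "emeasure m A \<le> ennreal (D ^ 3 * I)" using D_ge_1 by (simp add: ennreal_mult')
  have I0: "0 \<le> I" using I majorant_nonneg by (metis Bochner_Integration.integral_nonneg)
  have Af: "A \<in> fmeasurable m" using eA by (intro fmeasurableI) (auto intro: le_less_trans)
  have mA: "measure m A \<le> D ^ 3 * I"
    using eA I0 D_ge_1 unfolding measure_def by (intro enn2real_leI) auto
  have "bad lam = {x. lam < gh x} \<union> A" by (simp add: bad_def A_def)
  then have "mb lam \<le> measure m {x. lam < gh x} + measure m A"
    unfolding mb_def using Af gh_level_fmeasurable[of lam] lam by (auto intro!: measure_Un_le)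
  also have "measure m {x. lam < gh x} \<le> mg (c0 * lam)"
  proof -
    have "c0 * lam \<le> lam" using constants_pos lam by (simp add: mult_left_le_one_le)
    then show ?thesis unfolding mg_def
      by (intro measure_mono_fmeasurable gh_level_fmeasurable[OF c0lam]) auto
  qed
  finally have "mb lam \<le> mg (c0 * lam) + D ^ 3 * I" using mA by linarith
  also have "\<dots> = K1 k * mg (c0 * lam)
     + K2 * real k powr (- p) * (\<Sum>j<k. (2 ^ (k + j)) powr p * mb (2 ^ (k + j) * lam)) + K3 * mb (2 ^ k * lam)"
  proof -
    have "(74 / real k) powr p = 74 powr p * real k powr (- p)"
      by (simp add: powr_divide powr_minus_divide)
    then show ?thesis unfolding I_def K1_def K2_def K3_def by (simp only:) (simp add: algebra_simps)
  qed
  finally show ?thesis .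
qed

text \<open>A discrete layer-cake formula: at a point only levels below \<open>gh x / c0\<close>
  contribute. Superadditivity of the power moves it outside their geometric sum, which is at most
  \<open>2 * gh x / c0\<close>.\<close>

lemma level_sum_estimate:
  assumes "0 < l0"
  shows "(\<Sum>i<n. (2 ^ i * l0) powr p * mg (c0 * (2 ^ i * l0))) \<le> (2 / c0) powr p * (\<integral>x. gh x powr p \<partial>m)"
proof -
  have c0: "0 < c0" by (rule constants_pos)
  let ?l = "\<lambda>i. 2 ^ i * l0"
  have ii: "integrable m (\<lambda>x. ?l i powr p * indicator {x. c0 * ?l i < gh x} x)" for i
    using gh_level_fmeasurable[of "c0 * ?l i"] c0 assms
    by (intro integrable_mult_right integrable_real_indicator) (auto simp: fmeasurable_def)
  have "(\<Sum>i<n. ?l i powr p * mg (c0 * ?l i)) = (\<integral>x. (\<Sum>i<n. ?l i powr p * indicator {x. c0 * ?l i < gh x} x) \<partial>m)"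
    using ii by (subst Bochner_Integration.integral_sum) (auto simp: mg_def)
  also have "\<dots> \<le> (\<integral>x. (2 / c0) powr p * gh x powr p \<partial>m)"
  proof (rule integral_mono)
    fix x
    define T where "T = {i. i < n \<and> c0 * ?l i < gh x}"
    have fT: "finite T" by (simp add: T_def)
    have "(\<Sum>i<n. ?l i powr p * indicator {x. c0 * ?l i < gh x} x) = (\<Sum>i\<in>T. ?l i powr p)"
      unfolding T_def by (intro sum.mono_neutral_cong_right) (auto simp: indicator_def)
    also have "\<dots> \<le> (\<Sum>i\<in>T. ?l i) powr p"
      using assms p_gt_1 fT by (intro powr_sum_superadditive) auto
    also have "\<dots> \<le> (2 / c0 * gh x) powr p"
    proof (intro powr_mono2)
      have "(\<Sum>i\<in>T. ?l i) \<le> 2 * (gh x / c0)"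
        using fT assms c0 gh_nonneg[of x] by (intro sum_two_power_le) (auto simp: T_def field_simps)
      then show "(\<Sum>i\<in>T. ?l i) \<le> 2 / c0 * gh x" by simp
    qed (use p_gt_1 assms in \<open>auto intro!: sum_nonneg\<close>)
    also have "\<dots> = (2 / c0) powr p * gh x powr p" by (rule powr_mult)
    finally show "(\<Sum>i<n. ?l i powr p * indicator {x. c0 * ?l i < gh x} x) \<le> (2 / c0) powr p * gh x powr p" .
  qed (intro Bochner_Integration.integrable_sum ii integrable_mult_right gh_powr_integrable)+
  also have "\<dots> = (2 / c0) powr p * (\<integral>x. gh x powr p \<partial>m)" by simp
  finally show ?thesis .
qed

lemma bad_sum_estimate:
  assumes k: "0 < k" and small: "K2 * real k powr (1 - p) + K3 * (2 ^ k) powr (- p) \<le> 1 / 2"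
    and l0: "0 < l0" and n: "\<And>i. n \<le> i \<Longrightarrow> bad (2 ^ i * l0) = {}"
  shows "(\<Sum>i<n. (2 ^ i * l0) powr p * mb (2 ^ i * l0))
    \<le> 2 * K1 k * ((2 / c0) powr p * (\<integral>x. gh x powr p \<partial>m))"
proof -
  let ?l = "\<lambda>i. 2 ^ i * l0"
  let ?K = "K1 k"
  define A where "A i = ?l i powr p * mb (?l i)" for i
  have "(\<Sum>i<n. A i) \<le> 2 * ?K * (\<Sum>i<n. ?l i powr p * mg (c0 * ?l i))"
  proof (rule absorb_shifted_sums)
    show "0 \<le> A i" for i by (simp add: A_def mb_def)
    show "A i = 0" if "n \<le> i" for i using n[OF that] by (simp add: A_def mb_def)
    show "0 \<le> K2 * real k powr (- p)" "0 \<le> K3 * (2 ^ k) powr (- p)" using constants_pos by auto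
    show "K2 * real k powr - p * real k + K3 * (2 ^ k) powr - p \<le> 1 / 2"
    proof -
      have "real k powr (- p) * real k = real k powr (1 - p)"
        using k powr_mult_base[of "real k" "- p"] by (simp add: mult.commute)
      then show ?thesis using small by (simp add: mult.assoc)
    qed
    fix i
    have li: "0 < ?l i" using l0 by simp
    have eq: "?l i powr p * ((2 ^ l) powr p * mb (2 ^ l * ?l i)) = A (i + l)" for l
      unfolding A_def by (simp add: power_add mult_ac flip: powr_mult)
    have e2: "?l i powr p * mb (2 ^ k * ?l i) = (2 ^ k) powr (- p) * A (i + k)"
      unfolding eq[of k, symmetric] by (simp add: powr_minus)
    have "A i \<le> ?l i powr p * (?K * mg (c0 * ?l i)
     + K2 * real k powr (- p) * (\<Sum>j<k. (2 ^ (k + j)) powr p * mb (2 ^ (k + j) * ?l i)) + K3 * mb (2 ^ k * ?l i))"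
      unfolding A_def by (intro mult_left_mono bad_estimate[OF k li]) auto
    also have "\<dots> = ?K * (?l i powr p * mg (c0 * ?l i))
     + K2 * real k powr (- p) * (\<Sum>j<k. ?l i powr p * ((2 ^ (k + j)) powr p * mb (2 ^ (k + j) * ?l i)))
     + K3 * (?l i powr p * mb (2 ^ k * ?l i))"
      by (simp only: sum_distrib_left[symmetric]) (simp only: distrib_left mult_ac)
    also have "\<dots> = ?K * (?l i powr p * mg (c0 * ?l i)) + K2 * real k powr (- p) * (\<Sum>j<k. A (i + k + j))
      + K3 * (2 ^ k) powr (- p) * A (i + k)"
      by (simp only: eq e2) (simp only: add.assoc mult.assoc)
    finally show "A i \<le> ?K * (?l i powr p * mg (c0 * ?l i)) + K2 * real k powr (- p) * (\<Sum>j<k. A (i + k + j))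
      + K3 * (2 ^ k) powr (- p) * A (i + k)" .
  qed
  also have "\<dots> \<le> 2 * ?K * ((2 / c0) powr p * (\<integral>x. gh x powr p \<partial>m))"
  proof (intro mult_left_mono level_sum_estimate l0)
    show "0 \<le> 2 * ?K" using K1_nonneg by simp
  qed
  finally show ?thesis by (simp add: A_def)
qed

text \<open>\<open>G powr p\<close> adds \<open>(48 * level) powr p\<close> over the bad sets
  containing the point, so its integral is a sum already estimated. For a pair, take the first level
  whose Lipschitz bound holds. Level 0 is covered by the slack; otherwise
  \<open>good_lipschitz\<close> fails one level lower, so an endpoint is bad there. The factor 2
  between levels turns 24 into 48.\<close>

lemma hajlasz_majorant:
  assumes k: "0 < k" and small: "K2 * real k powr (1 - p) + K3 * (2 ^ k) powr (- p) \<le> 1 / 2"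
    and l0: "0 < l0"
  shows "\<exists>G. hajlasz_gradient w l0 G \<and> pint G \<le> ennreal (Kh k) * pint gh"
proof -
  let ?l = "\<lambda>i::nat. 2 ^ i * l0"
  have li: "0 < ?l i" for i using l0 by simp
  obtain n where n: "max M (2 * L) / l0 < 2 ^ n" using real_arch_pow[of 2] by auto
  have empty: "bad (?l i) = {}" if "n \<le> i" for i
  proof -
    have "max M (2 * L) < 2 ^ n * l0" using n l0 by (simp add: field_simps)
    also have "\<dots> \<le> ?l i" using that l0 by (intro mult_right_mono power_increasing) auto
    finally show ?thesis using li[of i] by (intro bad_empty) auto
  qed
  define S where "S x = (\<Sum>i<n. (48 * ?l i) powr p * indicator (bad (?l i)) x)" for x
  define G where "G x = S x powr (1 / p)" for x
  have S0: "0 \<le> S x" for x by (auto simp: S_def intro!: sum_nonneg)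
  have Gp: "G x powr p = S x" for x using S0[of x] p_gt_1 by (simp add: G_def powr_powr)
  have Sm [measurable]: "S \<in> borel_measurable m" unfolding S_def[abs_def] by measurable
  have "G \<in> borel_measurable m" unfolding G_def[abs_def] by measurable
  moreover have "0 \<le> G x" for x by (simp add: G_def)
  moreover have "\<bar>w x - w y\<bar> - 24 * l0 * dist x y \<le> dist x y * max (G x) (G y)" for x y
  proof (cases "\<bar>w x - w y\<bar> \<le> 24 * l0 * dist x y")
    case True
    moreover have "0 \<le> dist x y * max (G x) (G y)" by (simp add: G_def le_max_iff_disj)
    ultimately show ?thesis by linarith
  next
    case False
    then have d: "0 < dist x y" by (cases "x = y") auto
    obtain j where j: "\<bar>w x - w y\<bar> / (24 * l0 * dist x y) < 2 ^ j" using real_arch_pow[of 2] by auto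
    let ?P = "\<lambda>i::nat. \<bar>w x - w y\<bar> \<le> 24 * ?l i * dist x y"
    have "?P j" using j d l0 by (simp add: divide_less_eq mult_ac)
    define i where "i = (LEAST i. ?P i)"
    have Pi: "?P i" unfolding i_def using \<open>?P j\<close> by (rule LeastI)
    have "i \<noteq> 0" using Pi False by (auto simp: mult_ac intro: ccontr)
    then obtain i' where i': "i = Suc i'" using not0_implies_Suc by blast
    have "\<not> ?P i'" using not_less_Least[of i' ?P] i' by (simp add: i_def)
    have "x \<in> bad (?l i') \<or> y \<in> bad (?l i')"
      using good_lipschitz[of x "?l i'" y] \<open>\<not> ?P i'\<close> li[of i'] by auto
    then obtain z where z: "z \<in> bad (?l i')" "z = x \<or> z = y" by blast
    then have "i' < n" using empty[of i'] by (cases "n \<le> i'") auto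
    then have "(48 * ?l i') powr p \<le> S z"
      unfolding S_def using z(1)
      by (intro order_trans[OF _ member_le_sum[of i' "{..<n}" "\<lambda>i. (48 * ?l i) powr p * indicator (bad (?l i)) z"]]) auto
    then have "((48 * ?l i') powr p) powr (1 / p) \<le> G z"
      unfolding G_def using p_gt_1 by (intro powr_mono2) auto
    then have "48 * ?l i' \<le> G z" using p_gt_1 l0 by (simp add: powr_powr)
    have "\<bar>w x - w y\<bar> \<le> dist x y * (48 * ?l i')" using Pi i' by (simp add: mult_ac)
    also have "\<dots> \<le> dist x y * max (G x) (G y)"
      using \<open>48 * ?l i' \<le> G z\<close> z(2) by (intro mult_left_mono) auto
    finally show ?thesis using d l0 by (smt (verit) mult_nonneg_nonneg)
  qed
  moreover have "pint G \<le> ennreal (Kh k) * pint gh"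
  proof -
    have ii: "integrable m (\<lambda>x. (48 * ?l i) powr p * indicator (bad (?l i)) x)" for i
      using bad_fmeasurable[OF li[of i]] by (intro integrable_mult_right integrable_real_indicator) (auto simp: fmeasurable_def)
    have iS: "integrable m S" unfolding S_def[abs_def] by (intro Bochner_Integration.integrable_sum ii)
    have "(\<integral>x. S x \<partial>m) = (\<Sum>i<n. (48 * ?l i) powr p * mb (?l i))"
      unfolding S_def mb_def using ii by (subst Bochner_Integration.integral_sum) auto
    also have "\<dots> = 48 powr p * (\<Sum>i<n. ?l i powr p * mb (?l i))"
      unfolding sum_distrib_left by (intro sum.cong refl) (simp only: powr_mult[of 48] mult.assoc)
    also have "\<dots> \<le> 48 powr p * (2 * K1 k * ((2 / c0) powr p * (\<integral>x. gh x powr p \<partial>m)))"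
      by (intro mult_left_mono bad_sum_estimate[OF k small l0 empty]) auto
    finally have *: "(\<integral>x. S x \<partial>m) \<le> Kh k * (\<integral>x. gh x powr p \<partial>m)"
      by (simp only: Kh_def mult.assoc)
    have "pint G = ennreal (\<integral>x. S x \<partial>m)"
      unfolding Gp using iS S0 by (intro nn_integral_eq_integral) auto
    also have "\<dots> \<le> ennreal (Kh k * (\<integral>x. gh x powr p \<partial>m))"
      by (rule ennreal_leI[OF *])
    also have "\<dots> = ennreal (Kh k) * ennreal (\<integral>x. gh x powr p \<partial>m)"
      by (intro ennreal_mult'' Bochner_Integration.integral_nonneg) auto
    also have "ennreal (\<integral>x. gh x powr p \<partial>m) = pint gh"
      using gh_powr_integrable by (intro nn_integral_eq_integral[symmetric]) auto
    finally show ?thesis .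
  qed
  ultimately show ?thesis unfolding hajlasz_gradient_def by blast
qed

end

context poincare_space
begin

text \<open>The constant precedes the quantifiers over the truncation data, since an approximating
  sequence need not have bounded Lipschitz constants.\<close>

lemma hajlasz_constant:
  obtains K where "0 \<le> K" "\<And>w gh eps L N M R a l0. truncation m D p CP w gh eps L N M R a \<Longrightarrow> 0 < l0 \<Longrightarrow>
     \<exists>G. hajlasz_gradient w l0 G \<and> pint G \<le> ennreal K * pint gh"
proof -
  obtain k :: nat where k: "0 < k" "K2 * real k powr (1 - p) + K3 * (2 ^ k) powr (- p) \<le> 1 / 2"
    using absorption_index by blast
  have "0 \<le> Kh k" using K1_nonneg[of k] by (simp add: Kh_def)
  then show ?thesis using truncation.hajlasz_majorant[OF _ k] by (rule that)
qed

end

section \<open>Nonlocal energies of Sobolev functions\<close>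

text \<open>Weighted arithmetic-geometric mean of 1/2 and 1. It bounds the geometric series of ratio
  \<open>2 powr (- \<delta>)\<close> by \<open>2 / \<delta>\<close>, which the factor \<delta> of
  the energy cancels.\<close>

lemma one_minus_two_powr_ge:
  fixes \<delta> :: real assumes "0 < \<delta>" "\<delta> \<le> 1" shows "\<delta> / 2 \<le> 1 - 2 powr (- \<delta>)"
proof -
  have "(1 / 2) powr \<delta> * 1 powr (1 - \<delta>) \<le> \<delta> * (1 / 2) + (1 - \<delta>) * 1"
    using assms by (intro Youngs_inequality_0) auto
  moreover have "(1 / 2::real) powr \<delta> = 2 powr (- \<delta>)" by (simp add: powr_divide powr_minus_divide)
  ultimately show ?thesis by (simp add: field_simps)
qed

lemma ennreal_term_le_suminf: "f n \<le> (\<Sum>i. f i :: ennreal)"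
  using sum_le_suminf[of f "{n}"] by simp

section \<open>The kernel, its near and far integrals, and Hajlasz gradients\<close>

context doubling_space
begin

abbreviation dint :: "('a \<Rightarrow> 'a \<Rightarrow> ennreal) \<Rightarrow> ennreal" where
  "dint F \<equiv> \<integral>\<^sup>+x. (\<integral>\<^sup>+y. F x y \<partial>m) \<partial>m"

lemma nn_integral_slices:
  assumes "(\<lambda>(x, y). F x y) \<in> borel_measurable (m \<Otimes>\<^sub>M m)"
  shows "F x \<in> borel_measurable m" "(\<lambda>x. \<integral>\<^sup>+y. F x y \<partial>m) \<in> borel_measurable m"
  using measurable_compose_Pair1[OF _ assms, of x] borel_measurable_nn_integral[OF assms] by simp_all

text \<open>On the diagonal the ball is empty, and division by zero gives 0, in accordance with the
  convention for the first double integral.\<close>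

definition kern :: "real \<Rightarrow> 'a \<Rightarrow> 'a \<Rightarrow> real" where
  "kern p x y = 1 / (V x (dist x y) * dist x y powr p)"

lemma kern_nonneg: "0 \<le> kern p x y" by (simp add: kern_def)

lemma kern_measurable [measurable]: "(\<lambda>(x, y). kern p x y) \<in> borel_measurable (m \<Otimes>\<^sub>M m)"
proof -
  have [measurable]: "(\<lambda>z. V (fst z) (dist (fst z) (snd z))) \<in> borel_measurable (m \<Otimes>\<^sub>M m)"
    using V_measurable(2) by (simp add: split_beta')
  show ?thesis unfolding kern_def split_beta' by measurable
qed

text \<open>The kernel is not symmetric; one doubling compares the balls of radius
  \<open>dist x y\<close> around the two points.\<close>

lemma kern_swap: "kern p x y \<le> D * kern p y x"
proof (cases "x = y")
  case False
  then have d: "0 < dist x y" by simp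
  have "V y (dist x y) \<le> D ^ 1 * V x (dist x y)" using d by (intro V_compare) (auto simp: dist_commute)
  then have "1 / V x (dist x y) \<le> D / V y (dist x y)"
    using ball_pos[OF d, of x] ball_pos[OF d, of y] by (simp add: field_simps)
  then have "1 / V x (dist x y) / dist x y powr p \<le> D / V y (dist x y) / dist x y powr p"
    by (intro divide_right_mono) auto
  then show ?thesis by (simp add: kern_def dist_commute)
qed (simp add: kern_def)

text \<open>Common to both ends of the kernel: a bound relative to the volume of the ball of half
  the radius costs one doubling per scale, whether the scales shrink or grow.\<close>

lemma dyadic_annuli_integral:
  assumes t: "\<And>n. 0 < t n" and c: "\<And>n. 0 \<le> c n"
    and h: "\<And>y. h y \<noteq> 0 \<Longrightarrow> \<exists>n. dist x y < 2 * t n \<and> h y \<le> ennreal (c n / V x (t n))"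
  shows "(\<integral>\<^sup>+y. h y \<partial>m) \<le> (\<Sum>n. ennreal (D * c n))"
proof -
  have "(\<integral>\<^sup>+y. h y \<partial>m) \<le> (\<integral>\<^sup>+y. (\<Sum>n. ennreal (c n / V x (t n)) * indicator (ball x (2 * t n)) y) \<partial>m)"
  proof (intro nn_integral_mono)
    fix y
    show "h y \<le> (\<Sum>n. ennreal (c n / V x (t n)) * indicator (ball x (2 * t n)) y)"
    proof (cases "h y = 0")
      case False
      then obtain n where "dist x y < 2 * t n" "h y \<le> ennreal (c n / V x (t n))" using h by blast
      then show ?thesis
        using ennreal_term_le_suminf[of "\<lambda>n. ennreal (c n / V x (t n)) * indicator (ball x (2 * t n)) y" n]
        by (auto intro: order_trans)
    qed simp
  qed
  also have "\<dots> = (\<Sum>n. ennreal (c n / V x (t n)) * ennreal (V x (2 * t n)))"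
    by (subst nn_integral_suminf) (auto simp: nn_integral_cmult emeasure_ball)
  also have "\<dots> \<le> (\<Sum>n. ennreal (D * c n))"
  proof (intro suminf_le allI)
    fix n
    have "c n / V x (t n) * V x (2 * t n) \<le> c n / V x (t n) * (D * V x (t n))"
      using c by (intro mult_left_mono doubling t) auto
    also have "\<dots> = D * c n" using ball_pos[OF t, of x n] by simp
    finally show "ennreal (c n / V x (t n)) * ennreal (V x (2 * t n)) \<le> ennreal (D * c n)"
      using c[of n] by (simp add: ennreal_mult[symmetric] ennreal_leI)
  qed auto
  finally show ?thesis .
qed

lemma near_integral:
  assumes R: "0 < R" and \<delta>: "0 < \<delta>" "\<delta> \<le> 1"
  shows "(\<integral>\<^sup>+y. (if 0 < dist x y \<and> dist x y < R then ennreal (dist x y powr \<delta> / V x (dist x y)) else 0) \<partial>m)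
    \<le> ennreal (2 * D * R powr \<delta> / \<delta>)"
proof -
  define \<rho> where "\<rho> n = R / 2 ^ n" for n
  have \<rho>: "0 < \<rho> n" for n using R by (simp add: \<rho>_def)
  define q where "q = 2 powr (- \<delta>)"
  have q: "0 \<le> q" "q < 1" using \<delta> one_minus_two_powr_ge[OF \<delta>] by (auto simp: q_def)
  have \<rho>q: "\<rho> n powr \<delta> = R powr \<delta> * q ^ n" for n
  proof -
    have "\<rho> n = R * 2 powr (- real n)" by (simp add: \<rho>_def powr_minus powr_realpow divide_inverse)
    moreover have "q ^ n = 2 powr (- real n * \<delta>)" by (simp add: q_def powr_power mult.commute)
    ultimately show ?thesis by (simp add: powr_mult powr_powr)
  qed
  have "(\<integral>\<^sup>+y. (if 0 < dist x y \<and> dist x y < R then ennreal (dist x y powr \<delta> / V x (dist x y)) else 0) \<partial>m)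
    \<le> (\<Sum>n. ennreal (D * \<rho> n powr \<delta>))"
  proof (rule dyadic_annuli_integral[OF \<rho>[of "Suc _"]])
    fix y assume "(if 0 < dist x y \<and> dist x y < R then ennreal (dist x y powr \<delta> / V x (dist x y)) else 0) \<noteq> 0"
    then have y: "0 < dist x y" "dist x y < R" by (auto split: if_splits)
    obtain k where "R / dist x y < 2 ^ k" using real_arch_pow[of 2] by auto
    then have "\<rho> k \<le> dist x y" using y by (simp add: \<rho>_def field_simps)
    define n where "n = (LEAST k. \<rho> k \<le> dist x y)"
    have n: "\<rho> n \<le> dist x y" unfolding n_def using \<open>\<rho> k \<le> dist x y\<close> by (rule LeastI)
    have "n \<noteq> 0" using n y by (auto simp: \<rho>_def intro: ccontr)
    then obtain n' where n': "n = Suc n'" using not0_implies_Suc by blast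
    then have lt: "dist x y < \<rho> n'"
      using not_less_Least[of n' "\<lambda>k. \<rho> k \<le> dist x y"] by (simp add: n_def)
    have "dist x y powr \<delta> / V x (dist x y) \<le> \<rho> n' powr \<delta> / V x (\<rho> (Suc n'))"
      using lt n n' \<delta> y by (intro frac_le powr_mono2 V_mono' ball_pos \<rho>) auto
    then show "\<exists>n. dist x y < 2 * \<rho> (Suc n) \<and> (if 0 < dist x y \<and> dist x y < R then ennreal (dist x y powr \<delta> / V x (dist x y)) else 0)
        \<le> ennreal (\<rho> n powr \<delta> / V x (\<rho> (Suc n)))"
      using y lt by (intro exI[of _ n']) (auto simp: \<rho>_def ennreal_leI)
  qed simp
  also have "\<dots> = ennreal (D * R powr \<delta> * (1 / (1 - q)))"
    unfolding \<rho>q mult.assoc[symmetric] using q D_ge_1 by (intro suminf_ennreal_eq sums_mult geometric_sums) auto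
  also have "\<dots> \<le> ennreal (D * R powr \<delta> * (1 / (\<delta> / 2)))"
    using one_minus_two_powr_ge[OF \<delta>] \<delta> D_ge_1 by (intro ennreal_leI mult_left_mono divide_left_mono) (auto simp: q_def)
  finally show ?thesis by (simp add: mult_ac)
qed

lemma far_integral:
  assumes R: "0 < R" and p: "1 < p"
  shows "(\<integral>\<^sup>+y. (if R \<le> dist x y then ennreal (kern p x y) else 0) \<partial>m) \<le> ennreal (2 * D * R powr (- p))"
proof -
  define \<rho> where "\<rho> n = 2 ^ n * R" for n
  have \<rho>: "0 < \<rho> n" for n using R by (simp add: \<rho>_def)
  have "(\<integral>\<^sup>+y. (if R \<le> dist x y then ennreal (kern p x y) else 0) \<partial>m) \<le> (\<Sum>n. ennreal (D * (1 / \<rho> n powr p)))"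
  proof (rule dyadic_annuli_integral[OF \<rho>])
    fix y assume "(if R \<le> dist x y then ennreal (kern p x y) else 0) \<noteq> 0"
    then have y: "R \<le> dist x y" by (auto split: if_splits)
    obtain k where "dist x y / R < 2 ^ k" using real_arch_pow[of 2] by auto
    then have k: "dist x y < \<rho> k" using R by (simp add: \<rho>_def field_simps)
    define n where "n = (LEAST k. dist x y < \<rho> k)"
    have n: "dist x y < \<rho> n" unfolding n_def using k by (rule LeastI)
    have "n \<noteq> 0" using n y by (auto simp: \<rho>_def intro: ccontr)
    then obtain n' where n': "n = Suc n'" using not0_implies_Suc by blast
    then have ge: "\<rho> n' \<le> dist x y"
      using not_less_Least[of n' "\<lambda>k. dist x y < \<rho> k"] by (simp add: n_def)
    have "kern p x y \<le> 1 / (V x (\<rho> n') * \<rho> n' powr p)"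
      unfolding kern_def using ge \<rho>[of n'] p ball_pos[OF \<rho>[of n'], of x]
      by (intro divide_left_mono mult_mono V_mono' powr_mono2 mult_pos_pos) (auto intro: ball_pos less_le_trans)
    then show "\<exists>n. dist x y < 2 * \<rho> n \<and> (if R \<le> dist x y then ennreal (kern p x y) else 0) \<le> ennreal (1 / \<rho> n powr p / V x (\<rho> n))"
      using y n n' by (intro exI[of _ n']) (auto simp: \<rho>_def ennreal_leI mult.commute)
  qed simp
  also have "\<dots> \<le> (\<Sum>n. ennreal (D * R powr (- p) * (1 / 2) ^ n))"
  proof (intro suminf_le allI ennreal_leI)
    fix n
    have "(2::real) ^ n = (2 ^ n) powr 1" by simp
    also have "\<dots> \<le> (2 ^ n) powr p" using p by (intro powr_mono) auto
    finally have "2 ^ n * R powr p \<le> \<rho> n powr p" unfolding \<rho>_def powr_mult by (intro mult_right_mono) auto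
    then have "1 / \<rho> n powr p \<le> 1 / (2 ^ n * R powr p)" using R \<rho>[of n] by (intro divide_left_mono) auto
    then have "D * (1 / \<rho> n powr p) \<le> D * (1 / (2 ^ n * R powr p))" using D_ge_1 by (intro mult_left_mono) auto
    then show "D * (1 / \<rho> n powr p) \<le> D * R powr (- p) * (1 / 2) ^ n"
      by (simp add: powr_minus_divide power_one_over mult_ac)
  qed auto
  also have "\<dots> = ennreal (D * R powr (- p) * (1 / (1 - 1 / 2)))"
    using D_ge_1 by (intro suminf_ennreal_eq sums_mult geometric_sums) auto
  finally show ?thesis by (simp add: mult_ac)
qed

text \<open>Split at \<open>R = 1 / g\<close>, where \<open>dist x y * g\<close> reaches 1. The near
  part gives \<open>g powr (p + \<delta>) * R powr \<delta> = g powr p\<close>, its divisor \<delta>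
  being cancelled by the prefactor; the far part gives \<open>R powr (- p) = g powr p\<close>, with
  \<delta> bounded by 1. Each contributes \<open>2 * D\<close>.\<close>

lemma kernel_integral:
  assumes g: "0 \<le> g" and p: "1 < p" and \<delta>: "0 < \<delta>" "\<delta> \<le> 1"
  shows "(\<integral>\<^sup>+y. ennreal (\<delta> * min (dist x y * g) 1 powr (p + \<delta>) * kern p x y) \<partial>m) \<le> ennreal (4 * D * g powr p)"
proof (cases "g = 0")
  case True
  then show ?thesis by simp
next
  case False
  then have g: "0 < g" using g by simp
  define R where "R = 1 / g"
  have R: "0 < R" using g by (simp add: R_def)
  let ?near = "\<lambda>y. (if 0 < dist x y \<and> dist x y < R then ennreal (dist x y powr \<delta> / V x (dist x y)) else 0)"
  let ?far = "\<lambda>y. (if R \<le> dist x y then ennreal (kern p x y) else 0)"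
  have [measurable]: "(\<lambda>y. V x (dist x y)) \<in> borel_measurable m"
    using measurable_compose_Pair1[OF _ V_measurable(2), of x] by simp
  have [measurable]: "(\<lambda>y. kern p x y) \<in> borel_measurable m"
    using measurable_compose_Pair1[OF _ kern_measurable, of x] by simp
  have "(\<integral>\<^sup>+y. ennreal (\<delta> * min (dist x y * g) 1 powr (p + \<delta>) * kern p x y) \<partial>m)
    \<le> (\<integral>\<^sup>+y. ennreal (\<delta> * g powr (p + \<delta>)) * ?near y + ?far y \<partial>m)"
  proof (intro nn_integral_mono)
    fix y
    consider "x = y" | "x \<noteq> y" "dist x y < R" | "x \<noteq> y" "R \<le> dist x y" by linarith
    then show "ennreal (\<delta> * min (dist x y * g) 1 powr (p + \<delta>) * kern p x y) \<le> ennreal (\<delta> * g powr (p + \<delta>)) * ?near y + ?far y"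
    proof cases
      case 1
      then show ?thesis by simp
    next
      case 2
      then have "min (dist x y * g) 1 = dist x y * g" using g by (simp add: R_def field_simps)
      then have "\<delta> * min (dist x y * g) 1 powr (p + \<delta>) * kern p x y = \<delta> * g powr (p + \<delta>) * (dist x y powr \<delta> / V x (dist x y))"
        using 2 by (simp add: kern_def powr_mult powr_add)
      then show ?thesis using 2 \<delta> by (simp add: ennreal_mult'[symmetric])
    next
      case 3
      have "\<delta> * min (dist x y * g) 1 powr (p + \<delta>) \<le> 1 * 1"
        using \<delta> p g by (intro mult_mono powr_le1) auto
      then have "\<delta> * min (dist x y * g) 1 powr (p + \<delta>) * kern p x y \<le> 1 * kern p x y"
        by (intro mult_right_mono kern_nonneg) auto
      then show ?thesis using 3 by (simp add: ennreal_leI)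
    qed
  qed
  also have "\<dots> = ennreal (\<delta> * g powr (p + \<delta>)) * (\<integral>\<^sup>+y. ?near y \<partial>m) + (\<integral>\<^sup>+y. ?far y \<partial>m)"
    by (subst nn_integral_add) (auto simp: nn_integral_cmult)
  also have "\<dots> \<le> ennreal (\<delta> * g powr (p + \<delta>)) * ennreal (2 * D * R powr \<delta> / \<delta>) + ennreal (2 * D * R powr (- p))"
    by (intro add_mono mult_left_mono near_integral far_integral R \<delta> p) auto
  also have "\<dots> = ennreal (\<delta> * g powr (p + \<delta>) * (2 * D * R powr \<delta> / \<delta>) + 2 * D * R powr (- p))"
    using \<delta> D_ge_1 by (simp add: ennreal_mult[symmetric] ennreal_plus[symmetric] del: ennreal_plus)
  also have "\<delta> * g powr (p + \<delta>) * (2 * D * R powr \<delta> / \<delta>) + 2 * D * R powr (- p) = 4 * D * g powr p"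
    using \<delta> g by (simp add: R_def powr_divide powr_add powr_minus_divide)
  finally show ?thesis .
qed

text \<open>The maximum of \<open>G x\<close> and \<open>G y\<close> is replaced by two terms;
  Tonelli and \<open>kern_swap\<close> reduce the term with \<open>G y\<close> to the other at the
  cost of \<open>D\<close>. \<open>T\<close> is general so that the slack of a Hajlasz gradient can
  be subtracted first.\<close>

lemma hajlasz_functional:
  fixes T :: "'a \<Rightarrow> 'a \<Rightarrow> real"
  assumes [measurable]: "G \<in> borel_measurable m" and G0: "\<And>x. 0 \<le> G x" and T: "\<And>x y. T x y \<le> dist x y * max (G x) (G y)"
    and p: "1 < p" and \<delta>: "0 < \<delta>" "\<delta> \<le> 1"
  shows "dint (\<lambda>x y. ennreal (\<delta> * min (max (T x y) 0) 1 powr (p + \<delta>) * kern p x y))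
     \<le> ennreal (4 * D * (1 + D)) * (\<integral>\<^sup>+x. ennreal (G x powr p) \<partial>m)"
proof -
  interpret P: pair_sigma_finite m m by unfold_locales
  define F where "F g x y = ennreal (\<delta> * min (dist x y * g) 1 powr (p + \<delta>) * kern p x y)" for g x y
  have [measurable]: "(\<lambda>(x, y). F (G x) x y) \<in> borel_measurable (m \<Otimes>\<^sub>M m)"
    "(\<lambda>(x, y). F (G y) x y) \<in> borel_measurable (m \<Otimes>\<^sub>M m)"
    unfolding F_def by measurable
  have F1: "dint (\<lambda>x y. F (G x) x y) \<le> ennreal (4 * D) * (\<integral>\<^sup>+x. ennreal (G x powr p) \<partial>m)"
  proof -
    have "dint (\<lambda>x y. F (G x) x y) \<le> (\<integral>\<^sup>+x. ennreal (4 * D * G x powr p) \<partial>m)"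
      unfolding F_def by (intro nn_integral_mono kernel_integral G0 p \<delta>)
    also have "\<dots> = ennreal (4 * D) * (\<integral>\<^sup>+x. ennreal (G x powr p) \<partial>m)"
      using D_ge_1 by (simp add: ennreal_mult nn_integral_cmult)
    finally show ?thesis .
  qed
  have F2: "dint (\<lambda>x y. F (G y) x y) \<le> ennreal D * (dint (\<lambda>x y. F (G x) x y))"
  proof -
    have "dint (\<lambda>x y. F (G y) x y) = (\<integral>\<^sup>+y. (\<integral>\<^sup>+x. F (G y) x y \<partial>m) \<partial>m)"
      by (rule P.Fubini'[symmetric]) measurable
    also have "\<dots> \<le> (\<integral>\<^sup>+y. (\<integral>\<^sup>+x. ennreal D * F (G y) y x \<partial>m) \<partial>m)"
    proof (intro nn_integral_mono)
      fix x y
      have "\<delta> * min (dist x y * G y) 1 powr (p + \<delta>) * kern p x y \<le> \<delta> * min (dist x y * G y) 1 powr (p + \<delta>) * (D * kern p y x)"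
        using \<delta> by (intro mult_left_mono kern_swap) auto
      then show "F (G y) x y \<le> ennreal D * F (G y) y x"
        using D_ge_1 by (simp add: F_def ennreal_mult'[symmetric] ennreal_leI dist_commute mult_ac)
    qed
    also have "\<dots> = ennreal D * (dint (\<lambda>x y. F (G x) x y))"
    proof -
      have "(\<integral>\<^sup>+x. ennreal D * F (G y) y x \<partial>m) = ennreal D * (\<integral>\<^sup>+x. F (G y) y x \<partial>m)" for y
        using measurable_compose_Pair1[OF _ \<open>(\<lambda>(x, y). F (G x) x y) \<in> _\<close>, of y]
        by (intro nn_integral_cmult) simp
      then show ?thesis by (simp add: nn_integral_cmult)
    qed
    finally show ?thesis .
  qed
  have "dint (\<lambda>x y. ennreal (\<delta> * min (max (T x y) 0) 1 powr (p + \<delta>) * kern p x y))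
    \<le> dint (\<lambda>x y. F (G x) x y + F (G y) x y)"
  proof (intro nn_integral_mono)
    fix x y
    have "max (T x y) 0 \<le> dist x y * max (G x) (G y)" using T[of x y] G0[of x] by (simp add: le_max_iff_disj)
    then have "\<delta> * min (max (T x y) 0) 1 powr (p + \<delta>) * kern p x y \<le> \<delta> * min (dist x y * max (G x) (G y)) 1 powr (p + \<delta>) * kern p x y"
      using \<delta> p by (intro mult_right_mono mult_left_mono powr_mono2 kern_nonneg) auto
    then have "ennreal (\<delta> * min (max (T x y) 0) 1 powr (p + \<delta>) * kern p x y) \<le> F (max (G x) (G y)) x y"
      unfolding F_def by (rule ennreal_leI)
    also have "\<dots> \<le> F (G x) x y + F (G y) x y" by (cases "G x \<le> G y") (auto simp: max_def)
    finally show "ennreal (\<delta> * min (max (T x y) 0) 1 powr (p + \<delta>) * kern p x y) \<le> F (G x) x y + F (G y) x y" .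
  qed
  also have "\<dots> = dint (\<lambda>x y. F (G x) x y) + dint (\<lambda>x y. F (G y) x y)"
  proof -
    have "(\<integral>\<^sup>+y. F (G x) x y + F (G y) x y \<partial>m) = (\<integral>\<^sup>+y. F (G x) x y \<partial>m) + (\<integral>\<^sup>+y. F (G y) x y \<partial>m)" for x
      using measurable_compose_Pair1[OF _ \<open>(\<lambda>(x, y). F (G x) x y) \<in> _\<close>, of x]
        measurable_compose_Pair1[OF _ \<open>(\<lambda>(x, y). F (G y) x y) \<in> _\<close>, of x]
      by (intro nn_integral_add) auto
    then show ?thesis by (simp add: nn_integral_add)
  qed
  also have "\<dots> \<le> dint (\<lambda>x y. F (G x) x y) + ennreal D * (dint (\<lambda>x y. F (G x) x y))"
    by (intro add_left_mono F2)
  also have "\<dots> = ennreal (1 + D) * (dint (\<lambda>x y. F (G x) x y))"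
    using D_ge_1 by (simp add: ennreal_plus distrib_right)
  also have "\<dots> \<le> ennreal (1 + D) * (ennreal (4 * D) * (\<integral>\<^sup>+x. ennreal (G x powr p) \<partial>m))"
    by (intro mult_left_mono F1) auto
  also have "\<dots> = ennreal (4 * D * (1 + D)) * (\<integral>\<^sup>+x. ennreal (G x powr p) \<partial>m)"
  proof -
    have "4 * D * (1 + D) = (1 + D) * (4 * D)" by simp
    then show ?thesis using D_ge_1 ennreal_mult[of "1 + D" "4 * D"] by (simp only: mult.assoc)
  qed
  finally show ?thesis .
qed

lemma mol_uniform:
  assumes L: "L-lipschitz_on UNIV u" and N: "\<And>x. \<bar>u x\<bar> \<le> N" and r: "0 < r" and [measurable]: "u \<in> borel_measurable m"
  shows "\<bar>mol r u x - u x\<bar> \<le> 2 * r * L"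
proof -
  have "ker r x q * \<bar>u q - u x\<bar> \<le> ker r x q * (2 * r * L)" for q
  proof (cases "dist x q < 2 * r")
    case True
    have "\<bar>u q - u x\<bar> \<le> L * dist q x" by (rule lipschitz_abs_diff[OF L])
    also have "\<dots> \<le> L * (2 * r)" using True lipschitz_on_nonneg[OF L] by (intro mult_left_mono) (auto simp: dist_commute)
    finally show ?thesis using ker_bounds(1)[of r x q] by (intro mult_left_mono) (auto simp: mult_ac)
  qed (use ker_eq_0[OF r, of x q] in simp)
  then show ?thesis
    using mol_deviation[OF assms(4) N r, where h = "\<lambda>q. ker r x q * (2 * r * L)" and x = x and c = "u x"]
      ker_integrable[OF r, of x] ker_integral_pos[OF r, of x] by simp
qed

lemma ball_avg_measurable [measurable]:
  fixes h :: "'a \<Rightarrow> real"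
  assumes [measurable]: "h \<in> borel_measurable m"
  shows "(\<lambda>x. ball_avg m x r h) \<in> borel_measurable m"
proof -
  have "(\<lambda>x. \<integral>y. (if dist x y < r then h y else 0) \<partial>m) \<in> borel_measurable m"
    by measurable
  moreover have "(LINT y:ball x r|m. h y) = (\<integral>y. (if dist x y < r then h y else 0) \<partial>m)" for x
    unfolding set_lebesgue_integral_def by (intro Bochner_Integration.integral_cong) auto
  ultimately show ?thesis unfolding ball_avg_def by simp
qed

text \<open>Tonelli: for \<open>dist x y < r\<close> one doubling gives
  \<open>1 / V x r \<le> D / V y r\<close>, and integrating in \<open>x\<close> over the ball around
  \<open>y\<close> cancels its volume.\<close>

lemma ball_avg_nn_integral:
  assumes [measurable]: "h \<in> borel_measurable m" and h: "\<And>q. 0 \<le> h q" "\<And>q. h q \<le> N" and r: "0 < r"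
  shows "(\<integral>\<^sup>+x. ennreal (ball_avg m x r h) \<partial>m) \<le> ennreal D * (\<integral>\<^sup>+x. ennreal (h x) \<partial>m)"
proof -
  interpret P: pair_sigma_finite m m by unfold_locales
  have "ennreal (ball_avg m x r h) = (\<integral>\<^sup>+y. (if dist x y < r then ennreal (1 / V x r * h y) else 0) \<partial>m)" for x
  proof -
    have "set_integrable m (ball x r) (\<lambda>y. 1 / V x r * h y)"
      using h by (intro set_integrable_mult_right set_integrable_ball[of _ N]) auto
    then have "(\<integral>\<^sup>+y. ennreal (indicator (ball x r) y *\<^sub>R (1 / V x r * h y)) \<partial>m) = ennreal (LINT y:ball x r|m. 1 / V x r * h y)"
      unfolding set_lebesgue_integral_def using h
      by (intro nn_integral_eq_integral) (auto simp: set_integrable_def)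
    then show ?thesis unfolding ball_avg_def
      by (subst set_integral_mult_right[symmetric], subst \<open>_ = ennreal _\<close>[symmetric])
         (intro nn_integral_cong, auto simp: indicator_def)
  qed
  then have "(\<integral>\<^sup>+x. ennreal (ball_avg m x r h) \<partial>m) = dint (\<lambda>x y. (if dist x y < r then ennreal (1 / V x r * h y) else 0))"
    by simp
  also have "\<dots> = (\<integral>\<^sup>+y. (\<integral>\<^sup>+x. (if dist x y < r then ennreal (1 / V x r * h y) else 0) \<partial>m) \<partial>m)"
    by (rule P.Fubini'[symmetric]) measurable
  also have "\<dots> \<le> (\<integral>\<^sup>+y. (\<integral>\<^sup>+x. ennreal (D / V y r * h y) * indicator (ball y r) x \<partial>m) \<partial>m)"
  proof (intro nn_integral_mono)
    fix x y
    show "(if dist x y < r then ennreal (1 / V x r * h y) else 0) \<le> ennreal (D / V y r * h y) * indicator (ball y r) x"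
    proof (cases "dist x y < r")
      case True
      have "V y r \<le> D ^ 1 * V x r" using True r by (intro V_compare) (auto simp: dist_commute)
      then have "1 / V x r \<le> D / V y r" using ball_pos[OF r] by (simp add: field_simps)
      then have "1 / V x r * h y \<le> D / V y r * h y" using h by (intro mult_right_mono) auto
      then show ?thesis using True by (simp add: dist_commute ennreal_leI)
    qed simp
  qed
  also have "\<dots> = (\<integral>\<^sup>+y. ennreal D * ennreal (h y) \<partial>m)"
  proof (intro nn_integral_cong)
    fix y
    have "(\<integral>\<^sup>+x. ennreal (D / V y r * h y) * indicator (ball y r) x \<partial>m) = ennreal (D / V y r * h y) * ennreal (V y r)"
      by (simp add: nn_integral_cmult emeasure_ball)
    also have "\<dots> = ennreal D * ennreal (h y)"
      using ball_pos[OF r, of y] D_ge_1 h(1)[of y] by (simp add: ennreal_mult[symmetric])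
    finally show "(\<integral>\<^sup>+x. ennreal (D / V y r * h y) * indicator (ball y r) x \<partial>m) = ennreal D * ennreal (h y)" .
  qed
  also have "\<dots> = ennreal D * (\<integral>\<^sup>+x. ennreal (h x) \<partial>m)" by (simp add: nn_integral_cmult)
  finally show ?thesis .
qed

end

section \<open>From Hajlasz gradients to energies by Fatou's lemma\<close>

lemma Lp_diff_integrable:
  assumes "f \<in> Lp p m" "g \<in> Lp p m" "0 \<le> p"
  shows "integrable m (\<lambda>x. \<bar>f x - g x\<bar> powr p)"
proof (rule Bochner_Integration.integrable_bound)
  have [measurable]: "f \<in> borel_measurable m" "g \<in> borel_measurable m" using assms by (auto simp: Lp_def)
  show "integrable m (\<lambda>x. 2 powr p * (\<bar>f x\<bar> powr p + \<bar>g x\<bar> powr p))"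
    using assms by (auto simp: Lp_def)
  show "(\<lambda>x. \<bar>f x - g x\<bar> powr p) \<in> borel_measurable m" by measurable
  show "AE x in m. norm (\<bar>f x - g x\<bar> powr p) \<le> norm (2 powr p * (\<bar>f x\<bar> powr p + \<bar>g x\<bar> powr p))"
  proof (rule AE_I2)
    fix x
    have "\<bar>f x - g x\<bar> powr p \<le> (\<bar>f x\<bar> + \<bar>g x\<bar>) powr p" using assms by (intro powr_mono2) auto
    also have "\<dots> \<le> 2 powr p * (\<bar>f x\<bar> powr p + \<bar>g x\<bar> powr p)" using assms by (intro powr_add_le) auto
    finally show "norm (\<bar>f x - g x\<bar> powr p) \<le> norm (2 powr p * (\<bar>f x\<bar> powr p + \<bar>g x\<bar> powr p))"
      by simp
  qed
qed

lemma Lp_convergence_AE_subseq: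
  assumes u: "\<And>k. u k \<in> Lp p m" and f: "f \<in> Lp p m" and p: "0 < p"
    and lim: "(\<lambda>k. Lp_norm p m (\<lambda>x. u k x - f x)) \<longlonglongrightarrow> 0"
  obtains s :: "nat \<Rightarrow> nat" where "strict_mono s" "AE x in m. (\<lambda>k. u (s k) x) \<longlonglongrightarrow> f x"
proof -
  have "(\<lambda>k. Lp_norm p m (\<lambda>x. u k x - f x) powr p) \<longlonglongrightarrow> 0"
    using p by (intro tendsto_zero_powrI[OF lim tendsto_const]) (auto simp: Lp_norm_def)
  moreover have "Lp_norm p m (\<lambda>x. u k x - f x) powr p = (\<integral>x. norm (\<bar>u k x - f x\<bar> powr p) \<partial>m)" for k
  proof -
    have "0 \<le> (\<integral>x. \<bar>u k x - f x\<bar> powr p \<partial>m)" by (intro Bochner_Integration.integral_nonneg) auto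
    then show ?thesis using p by (simp add: Lp_norm_def powr_powr)
  qed
  ultimately have "(\<lambda>k. \<integral>x. norm (\<bar>u k x - f x\<bar> powr p) \<partial>m) \<longlonglongrightarrow> 0" by simp
  then obtain s :: "nat \<Rightarrow> nat" where s: "strict_mono s" "AE x in m. (\<lambda>k. \<bar>u (s k) x - f x\<bar> powr p) \<longlonglongrightarrow> 0"
    using tendsto_L1_AE_subseq[of m "\<lambda>k x. \<bar>u k x - f x\<bar> powr p"] Lp_diff_integrable[OF u f] p by auto
  have "AE x in m. (\<lambda>k. u (s k) x) \<longlonglongrightarrow> f x"
    using s(2)
  proof eventually_elim
    case (elim x)
    have "(\<lambda>k. (\<bar>u (s k) x - f x\<bar> powr p) powr (1 / p)) \<longlonglongrightarrow> 0"
      using p by (intro tendsto_zero_powrI[OF elim tendsto_const]) auto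
    then have "(\<lambda>k. \<bar>u (s k) x - f x\<bar>) \<longlonglongrightarrow> 0" using p by (simp add: powr_powr)
    then show ?case by (simp add: tendsto_rabs_zero_iff LIM_zero_iff)
  qed
  with s show ?thesis by (intro that)
qed

context poincare_space
begin

text \<open>Combines \<open>mol_diff\<close> with the Poincare inequality on the ball of radius
  \<open>4 * r\<close>: the factor is \<open>2 * D ^ 6 / r * (CP * (4 * r))\<close>, in which
  \<open>r\<close> cancels.\<close>

definition CG :: real where "CG = 8 * D ^ 6 * CP"

definition mol_grad :: "real \<Rightarrow> ('a \<Rightarrow> real) \<Rightarrow> 'a \<Rightarrow> real" where
  "mol_grad r u x = CG * ball_avg m x (4 * r) (\<lambda>q. slope u q powr p) powr (1 / p)"

lemma CG_pos: "0 < CG" using CP_pos D_ge_1 by (simp add: CG_def)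

lemma LIP_measurable:
  assumes "u \<in> LIP_bs" shows "u \<in> borel_measurable m" "slope u \<in> borel_measurable m"
proof -
  obtain L where "L-lipschitz_on UNIV u" using assms by (auto simp: LIP_bs_def)
  then have uc: "continuous_on UNIV u" by (rule lipschitz_on_continuous_on)
  show "u \<in> borel_measurable m"
    using borel_measurable_continuous_onI[OF uc] measurable_cong_sets[OF sets_m refl] by blast
  show "slope u \<in> borel_measurable m"
    using slope_measurable[OF uc] measurable_cong_sets[OF sets_m refl] by blast
qed

lemma mollified_truncation:
  assumes u: "u \<in> LIP_bs" and r: "0 < r"
  shows "\<exists>L N M R a. truncation m D p CP (mol r u) (mol_grad r u) r L N M R a"
proof -
  obtain L N a R where L: "L-lipschitz_on UNIV u" and N: "\<And>x. \<bar>u x\<bar> \<le> N" and R: "0 < R"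
    and supp: "\<And>x. R \<le> dist a x \<Longrightarrow> u x = 0" by (rule LIP_bsE[OF u]) blast
  note [measurable] = LIP_measurable[OF u]
  have L0: "0 \<le> L" by (rule lipschitz_on_nonneg[OF L])
  have sl: "0 \<le> slope u q powr p" "slope u q powr p \<le> L powr p" for q
    using slope_lipschitz[OF L, of q] p_gt_1 by (auto intro!: powr_mono2)
  have avg: "0 \<le> ball_avg m x (4 * r) (\<lambda>q. slope u q powr p)" "ball_avg m x (4 * r) (\<lambda>q. slope u q powr p) \<le> L powr p" for x
    by (rule ball_avg_abs_le[OF sl], measurable)+
  have slope0: "slope u q = 0" if "R + 1 \<le> dist a q" for q
  proof -
    have "\<bar>u q - u y\<bar> \<le> 0 * dist q y" if "dist q y < 1" for y
    proof -
      have "R \<le> dist a y" "R \<le> dist a q" using that \<open>R + 1 \<le> dist a q\<close> dist_triangle[of a q y] by (auto simp: dist_commute)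
      then show ?thesis using supp by simp
    qed
    then show ?thesis using slope_bounds[of 1 0 q u] by fastforce
  qed
  \<comment> \<open>\<open>u\<close> vanishes from distance \<open>R\<close> on and its slope from
    \<open>R + 1\<close> on; averaging over balls of radius \<open>4 * r\<close> adds the
    rest.\<close>
  have "truncation m D p CP (mol r u) (mol_grad r u) r (2 * D ^ 6 * N / r) N (CG * (L powr p) powr (1 / p)) (R + 1 + 4 * r) a"
  proof
    show "0 < r" by (rule r)
    show "(2 * D ^ 6 * N / r)-lipschitz_on UNIV (mol r u)" using N r by (intro mol_lipschitz) auto
    show "mol_grad r u \<in> borel_measurable m" unfolding mol_grad_def[abs_def] by measurable
    fix x
    show "0 \<le> mol_grad r u x" using CG_pos by (simp add: mol_grad_def)
    show "mol_grad r u x \<le> CG * (L powr p) powr (1 / p)"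
      unfolding mol_grad_def using avg CG_pos p_gt_1 by (intro mult_left_mono powr_mono2) auto
    show "\<bar>mol r u x\<bar> \<le> N" using N r by (intro mol_bounded) auto
    show "mol r u x = 0" if "R + 1 + 4 * r \<le> dist a x"
      by (rule mol_eq_0[of R a]) (use supp r that in auto)
    show "mol_grad r u x = 0" if x: "R + 1 + 4 * r \<le> dist a x"
    proof -
      have "indicator (ball x (4 * r)) q *\<^sub>R (slope u q powr p) = 0" for q
        using slope0[of q] x dist_triangle[of a x q] by (auto simp: indicator_def dist_commute)
      then have "(LINT q:ball x (4 * r)|m. slope u q powr p) = 0" by (simp only: set_lebesgue_integral_def Bochner_Integration.integral_zero)
      then show ?thesis by (simp add: mol_grad_def ball_avg_def)
    qed
    fix y z assume yz: "dist x y < 2 * r" "dist x z < 2 * r"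
    have "\<bar>mol r u y - mol r u z\<bar> \<le> 2 * D ^ 6 / r * ball_avg m x (4 * r) (\<lambda>q. \<bar>u q - ball_avg m x (4 * r) u\<bar>) * dist y z"
      using N r yz by (intro mol_diff) auto
    also have "\<dots> \<le> 2 * D ^ 6 / r * (CP * (4 * r) * ball_avg m x (4 * r) (\<lambda>q. slope u q powr p) powr (1 / p)) * dist y z"
      using r D_ge_1 by (intro mult_right_mono mult_left_mono poincare u) auto
    also have "\<dots> = mol_grad r u x * dist y z" using r by (simp add: mol_grad_def CG_def)
    finally show "\<bar>mol r u y - mol r u z\<bar> \<le> mol_grad r u x * dist y z" .
  qed
  then show ?thesis by blast
qed

lemma mol_grad_nn_integral:
  assumes u: "u \<in> LIP_bs" and r: "0 < r"
  shows "pint (mol_grad r u) \<le> ennreal (CG powr p * D) * pint (slope u)"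
proof -
  obtain L where L: "L-lipschitz_on UNIV u" using u by (auto simp: LIP_bs_def)
  note [measurable] = LIP_measurable[OF u]
  have sl: "0 \<le> slope u q powr p" "slope u q powr p \<le> L powr p" for q
    using slope_lipschitz[OF L, of q] p_gt_1 by (auto intro!: powr_mono2)
  let ?A = "\<lambda>x. ball_avg m x (4 * r) (\<lambda>q. slope u q powr p)"
  have avg: "0 \<le> ?A x" for x by (rule ball_avg_abs_le[OF sl], measurable)
  have "mol_grad r u x powr p = CG powr p * ?A x" for x
    using avg[of x] p_gt_1 unfolding mol_grad_def by (simp add: powr_mult powr_powr)
  then have "pint (mol_grad r u) = ennreal (CG powr p) * (\<integral>\<^sup>+x. ennreal (?A x) \<partial>m)"
    using avg by (simp add: ennreal_mult nn_integral_cmult)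
  also have "\<dots> \<le> ennreal (CG powr p) * (ennreal D * pint (slope u))"
    using r by (intro mult_left_mono ball_avg_nn_integral[OF _ sl]) auto
  also have "\<dots> = ennreal (CG powr p * D) * pint (slope u)"
    using D_ge_1 by (simp add: ennreal_mult mult.assoc)
  finally show ?thesis .
qed

lemma LIP_hajlasz:
  obtains K where "0 \<le> K" "\<And>u e. u \<in> LIP_bs \<Longrightarrow> 0 < e \<Longrightarrow> \<exists>w G. w \<in> borel_measurable m \<and>
     (\<forall>x. \<bar>w x - u x\<bar> \<le> e) \<and> hajlasz_gradient w e G \<and> pint G \<le> ennreal K * pint (slope u)"
proof -
  obtain K where K: "0 \<le> K" "\<And>w gh eps L N M R a l0. truncation m D p CP w gh eps L N M R a \<Longrightarrow> 0 < l0 \<Longrightarrow>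
     \<exists>G. hajlasz_gradient w l0 G \<and> pint G \<le> ennreal K * pint gh"
    using hajlasz_constant by blast
  have "\<exists>w G. w \<in> borel_measurable m \<and> (\<forall>x. \<bar>w x - u x\<bar> \<le> e) \<and> hajlasz_gradient w e G
      \<and> pint G \<le> ennreal (K * (CG powr p * D)) * pint (slope u)"
    if u: "u \<in> LIP_bs" and e: "0 < e" for u e
  proof -
    obtain L N a R where L: "L-lipschitz_on UNIV u" and N: "\<And>x. \<bar>u x\<bar> \<le> N" by (rule LIP_bsE[OF u]) blast
    have L0: "0 \<le> L" by (rule lipschitz_on_nonneg[OF L])
    \<comment> \<open>Small enough for \<open>mol_uniform\<close> to give an error of at most
      \<open>e\<close>; adding 1 to \<open>L\<close> avoids division by zero.\<close>
    define r where "r = e / (2 * (L + 1))"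
    have r: "0 < r" using e L0 by (simp add: r_def)
    have rL: "2 * r * L \<le> e" using e L0 by (simp add: r_def divide_simps)
    obtain L' N' M R' a' where T: "truncation m D p CP (mol r u) (mol_grad r u) r L' N' M R' a'"
      using mollified_truncation[OF u r] by blast
    obtain G where G: "hajlasz_gradient (mol r u) e G" "pint G \<le> ennreal K * pint (mol_grad r u)"
      using K(2)[OF T e] by blast
    have "ennreal K * pint (mol_grad r u) \<le> ennreal K * (ennreal (CG powr p * D) * pint (slope u))"
      by (intro mult_left_mono mol_grad_nn_integral u r) auto
    also have "\<dots> = ennreal (K * (CG powr p * D)) * pint (slope u)"
      using K(1) D_ge_1 ennreal_mult[of K "CG powr p * D"] by (simp add: mult.assoc)
    finally have "pint G \<le> ennreal (K * (CG powr p * D)) * pint (slope u)"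
      using G(2) by (rule order_trans[rotated])
    moreover have "\<bar>mol r u x - u x\<bar> \<le> e" for x
      using mol_uniform[OF L N r LIP_measurable(1)[OF u], of x] rL by linarith
    moreover have "mol r u \<in> borel_measurable m" by (rule truncation.w_measurable[OF T])
    ultimately show ?thesis using G(1) by blast
  qed
  moreover have "0 \<le> K * (CG powr p * D)" using K(1) D_ge_1 by simp
  ultimately show ?thesis by (rule that[rotated])
qed

text \<open>The bound is uniform in \<delta> and includes \<delta> = 1, where the integrand equals
  the kernel on large jumps; this yields the second integral of the theorem.\<close>

lemma nonlocal_energy_bounded:
  assumes f: "f \<in> W1p p m"
  obtains B where "0 \<le> B" "\<And>\<delta>. 0 < \<delta> \<Longrightarrow> \<delta> \<le> 1 \<Longrightarrow>
    dint (\<lambda>x y. ennreal (\<delta> * min \<bar>f x - f y\<bar> 1 powr (p + \<delta>) * kern p x y)) \<le> ennreal B"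
proof -
  have fLp: "f \<in> Lp p m" and Chf: "Ch p m f < \<infinity>" using f by (auto simp: W1p_def)
  have [measurable]: "f \<in> borel_measurable m" using fLp by (simp add: Lp_def)
  obtain u where u: "\<And>k. u k \<in> LIP_bs \<inter> Lp p m" "(\<lambda>k. Lp_norm p m (\<lambda>x. u k x - f x)) \<longlonglongrightarrow> 0"
    and fin: "liminf (\<lambda>k. \<integral>\<^sup>+x. ennreal (slope (u k) x powr p) \<partial>m) < \<infinity>"
    using Chf unfolding Ch_def Inf_less_iff by blast
  define E where "E k = pint (slope (u k))" for k
  obtain A :: real where A: "0 \<le> A" "liminf E < ennreal A"
  proof -
    obtain b where b: "0 \<le> b" "liminf E = ennreal b"
      using fin by (cases "liminf E" rule: ennreal_cases) (auto simp: E_def[abs_def])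
    then have "liminf E < ennreal (b + 1)" by (simp add: ennreal_less_iff del: ennreal_plus)
    then show ?thesis using that[of "b + 1"] b(1) by simp
  qed
  \<comment> \<open>A lower limit below \<open>A\<close> gives infinitely many indices with energy
    below \<open>A\<close>; convergence almost everywhere takes one more subsequence.\<close>
  have "\<not> (\<forall>\<^sub>F k in sequentially. ennreal A \<le> E k)"
    using A(2) Liminf_bounded[of "ennreal A" E sequentially] by (auto simp: not_le[symmetric])
  then have "\<exists>\<^sub>F k in sequentially. E k < ennreal A" by (simp add: frequently_def not_less)
  then have inf: "infinite {k. E k < ennreal A}"
    by (simp add: frequently_sequentially infinite_nat_iff_unbounded_le)
  obtain s0 :: "nat \<Rightarrow> nat" where s0: "strict_mono s0" "\<And>k. E (s0 k) < ennreal A"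
    using infinite_enumerate[OF inf] by auto
  obtain s :: "nat \<Rightarrow> nat" where s: "strict_mono s" "AE x in m. (\<lambda>k. u (s0 (s k)) x) \<longlonglongrightarrow> f x"
  proof (rule Lp_convergence_AE_subseq[of "\<lambda>k. u (s0 k)" p m f])
    show "(\<lambda>k. Lp_norm p m (\<lambda>x. u (s0 k) x - f x)) \<longlonglongrightarrow> 0"
      using LIMSEQ_subseq_LIMSEQ[OF u(2) s0(1)] by (simp add: o_def)
  qed (use u fLp p_gt_1 in auto)
  define v where "v k = u (s0 (s k))" for k
  have v: "v k \<in> LIP_bs" "pint (slope (v k)) \<le> ennreal A" for k
    using u(1) s0(2)[of "s k"] by (auto simp: v_def E_def)
  obtain K where K: "0 \<le> K" and Kex: "\<And>u e. u \<in> LIP_bs \<Longrightarrow> 0 < e \<Longrightarrow> \<exists>w G. w \<in> borel_measurable m \<and>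
     (\<forall>x. \<bar>w x - u x\<bar> \<le> e) \<and> hajlasz_gradient w e G \<and> pint G \<le> ennreal K * pint (slope u)"
    using LIP_hajlasz by blast
  \<comment> \<open>One null sequence bounds both the uniform error of the regularisation and the
    slack of its gradient.\<close>
  define l where "l k = 1 / real (Suc k)" for k
  have "\<exists>w G. w \<in> borel_measurable m \<and> (\<forall>x. \<bar>w x - v k x\<bar> \<le> l k) \<and> hajlasz_gradient w (l k) G
      \<and> pint G \<le> ennreal K * pint (slope (v k))" for k
    by (rule Kex[OF v(1)]) (simp add: l_def)
  then obtain w G where w: "\<And>k. w k \<in> borel_measurable m" "\<And>k x. \<bar>w k x - v k x\<bar> \<le> l k"
    and "\<And>k. hajlasz_gradient (w k) (l k) (G k)" and Gp: "\<And>k. pint (G k) \<le> ennreal K * pint (slope (v k))"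
    by metis
  then have G: "\<And>k. G k \<in> borel_measurable m" "\<And>k x. 0 \<le> G k x"
      "\<And>k x y. \<bar>w k x - w k y\<bar> - 24 * l k * dist x y \<le> dist x y * max (G k x) (G k y)"
    by (auto simp: hajlasz_gradient_def)
  note [measurable] = w(1)
  have llim: "l \<longlonglongrightarrow> 0" unfolding l_def using LIMSEQ_Suc[OF lim_1_over_n] by simp
  have wlim: "AE x in m. (\<lambda>k. w k x) \<longlonglongrightarrow> f x"
    using s(2)
  proof eventually_elim
    case (elim x)
    have "(\<lambda>k. w k x - v k x) \<longlonglongrightarrow> 0"
      by (rule Lim_null_comparison[OF _ llim]) (use w(2) in auto)
    from tendsto_add[OF this elim[folded v_def]] show ?case by simp
  qed
  define B where "B = 4 * D * (1 + D) * (K * A)"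
  have B0: "0 \<le> B" using D_ge_1 K A by (simp add: B_def)
  have "dint (\<lambda>x y. ennreal (\<delta> * min \<bar>f x - f y\<bar> 1 powr (p + \<delta>) * kern p x y)) \<le> ennreal B"
    if \<delta>: "0 < \<delta>" "\<delta> \<le> 1" for \<delta>
  proof -
    define T where "T k x y = \<bar>w k x - w k y\<bar> - 24 * l k * dist x y" for k x y
    define F where "F k x y = ennreal (\<delta> * min (max (T k x y) 0) 1 powr (p + \<delta>) * kern p x y)" for k x y
    have Fm: "(\<lambda>(x, y). F k x y) \<in> borel_measurable (m \<Otimes>\<^sub>M m)" for k
      unfolding F_def T_def by measurable
    note [measurable] = nn_integral_slices[OF Fm]
    have Fk: "dint (F k) \<le> ennreal B" for k
    proof -
      have "dint (F k) \<le> ennreal (4 * D * (1 + D)) * pint (G k)"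
        unfolding F_def by (rule hajlasz_functional) (use G T_def p_gt_1 \<delta> in auto)
      also have "\<dots> \<le> ennreal (4 * D * (1 + D)) * (ennreal K * ennreal A)"
        using v(2)[of k] by (intro mult_left_mono order_trans[OF Gp[of k]]) auto
      also have "\<dots> = ennreal B"
        using D_ge_1 K A by (simp add: B_def ennreal_mult[symmetric] del: ennreal_plus)
      finally show ?thesis .
    qed
    have pt: "(\<lambda>k. F k x y) \<longlonglongrightarrow> ennreal (\<delta> * min \<bar>f x - f y\<bar> 1 powr (p + \<delta>) * kern p x y)"
      if "(\<lambda>k. w k x) \<longlonglongrightarrow> f x" "(\<lambda>k. w k y) \<longlonglongrightarrow> f y" for x y
    proof -
      have "(\<lambda>k. T k x y) \<longlonglongrightarrow> \<bar>f x - f y\<bar> - 24 * 0 * dist x y"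
        unfolding T_def by (intro tendsto_intros that llim)
      then have "(\<lambda>k. min (max (T k x y) 0) 1) \<longlonglongrightarrow> min (max \<bar>f x - f y\<bar> 0) 1"
        by (intro tendsto_intros) simp
      then have "(\<lambda>k. min (max (T k x y) 0) 1 powr (p + \<delta>)) \<longlonglongrightarrow> min (max \<bar>f x - f y\<bar> 0) 1 powr (p + \<delta>)"
        using p_gt_1 \<delta> by (intro tendsto_powr2) auto
      then have "(\<lambda>k. \<delta> * min (max (T k x y) 0) 1 powr (p + \<delta>) * kern p x y)
          \<longlonglongrightarrow> \<delta> * min (max \<bar>f x - f y\<bar> 0) 1 powr (p + \<delta>) * kern p x y"
        by (rule tendsto_mult[OF tendsto_mult[OF tendsto_const] tendsto_const])
      then show ?thesis unfolding F_def by (intro tendsto_ennrealI) simp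
    qed
    have "dint (\<lambda>x y. ennreal (\<delta> * min \<bar>f x - f y\<bar> 1 powr (p + \<delta>) * kern p x y))
      \<le> dint (\<lambda>x y. liminf (\<lambda>k. F k x y))"
    proof (rule nn_integral_mono_AE)
      show "AE x in m. (\<integral>\<^sup>+y. ennreal (\<delta> * min \<bar>f x - f y\<bar> 1 powr (p + \<delta>) * kern p x y) \<partial>m) \<le> (\<integral>\<^sup>+y. liminf (\<lambda>k. F k x y) \<partial>m)"
        using wlim
      proof eventually_elim
        case (elim x)
        show ?case
        proof (rule nn_integral_mono_AE)
          show "AE y in m. ennreal (\<delta> * min \<bar>f x - f y\<bar> 1 powr (p + \<delta>) * kern p x y) \<le> liminf (\<lambda>k. F k x y)"
            using wlim
          proof eventually_elim
            case (elim y)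
            then show ?case using lim_imp_Liminf[OF sequentially_bot pt[OF \<open>(\<lambda>k. w k x) \<longlonglongrightarrow> f x\<close> elim]] by simp
          qed
        qed
      qed
    qed
    also have "\<dots> \<le> (\<integral>\<^sup>+x. liminf (\<lambda>k. \<integral>\<^sup>+y. F k x y \<partial>m) \<partial>m)"
      by (intro nn_integral_mono nn_integral_liminf) auto
    also have "\<dots> \<le> liminf (\<lambda>k. \<integral>\<^sup>+x. (\<integral>\<^sup>+y. F k x y \<partial>m) \<partial>m)"
      by (intro nn_integral_liminf) auto
    also have "\<dots> \<le> ennreal B"
      using Fk by (intro order_trans[OF Liminf_le_Limsup Limsup_bounded]) auto
    finally show ?thesis .
  qed
  with B0 show ?thesis by (rule that)
qed

end

section \<open>Sobolev regularity from nonlocal energies\<close>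

lemma one_minus_two_powr_le: fixes \<delta> :: real assumes "0 < \<delta>" shows "1 - 2 powr (- \<delta>) \<le> \<delta>"
proof -
  have "1 + - \<delta> * ln 2 \<le> exp (- \<delta> * ln 2)" by (rule exp_ge_add_one_self)
  also have "\<dots> = 2 powr (- \<delta>)" by (simp add: powr_def)
  finally have "1 - 2 powr (- \<delta>) \<le> \<delta> * ln 2" by simp
  also have "\<dots> \<le> \<delta> * 1" using assms ln_2_less_1 by (intro mult_left_mono) auto
  finally show ?thesis by simp
qed

text \<open>Above \<open>l\<close> the factor \<open>(t / l) powr \<delta>\<close> is at least 1;
  below \<open>l\<close> the second term suffices. This compares the exponents \<open>p\<close> and
  \<open>p + \<delta>\<close> at a fixed scale.\<close>

lemma powr_split:
  fixes t l p \<delta> :: real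
  assumes "0 \<le> t" "0 < l" "0 < p" "0 < \<delta>"
  shows "t powr p \<le> l powr (- \<delta>) * t powr (p + \<delta>) + l powr p"
proof (cases "l \<le> t")
  case True
  then have t: "0 < t" using assms by simp
  have "l powr \<delta> \<le> t powr \<delta>" using True assms by (intro powr_mono2) auto
  then have "1 \<le> l powr (- \<delta>) * t powr \<delta>" using assms by (simp add: powr_minus divide_simps)
  then have "t powr p * 1 \<le> t powr p * (l powr (- \<delta>) * t powr \<delta>)" by (intro mult_left_mono) auto
  then show ?thesis using assms by (simp add: powr_add mult_ac) (smt (verit) powr_ge_zero)
next
  case False
  then have "t powr p \<le> l powr p" using assms by (intro powr_mono2) auto
  then show ?thesis by (simp add: add_increasing)
qed

section \<open>Energies at dyadic scales and the choice of a good scale\<close>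

context doubling_space
begin

definition step :: "real \<Rightarrow> nat \<Rightarrow> 'a \<Rightarrow> 'a \<Rightarrow> real" where
  "step p j x y = (if dist x y < 1 / 2 ^ j then (2 ^ j) powr p / V x (1 / 2 ^ j) else 0)"

lemma step_nonneg: "0 \<le> step p j x y" by (simp add: step_def)

lemma step_measurable [measurable]: "(\<lambda>(x, y). step p j x y) \<in> borel_measurable (m \<Otimes>\<^sub>M m)"
  unfolding step_def split_beta' by measurable

lemma step_measurable' [measurable]: "step p j x \<in> borel_measurable m"
  using measurable_compose_Pair1[OF _ step_measurable, of x p j] by simp

lemma step_nn_integral: "(\<integral>\<^sup>+y. ennreal (step p j x y) \<partial>m) = ennreal ((2 ^ j) powr p)"
proof -
  have "(\<integral>\<^sup>+y. ennreal (step p j x y) \<partial>m) = (\<integral>\<^sup>+y. ennreal ((2 ^ j) powr p / V x (1 / 2 ^ j)) * indicator (ball x (1 / 2 ^ j)) y \<partial>m)"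
    by (intro nn_integral_cong) (auto simp: step_def)
  also have "\<dots> = ennreal ((2 ^ j) powr p / V x (1 / 2 ^ j)) * ennreal (V x (1 / 2 ^ j))"
    by (simp add: nn_integral_cmult emeasure_ball)
  also have "\<dots> = ennreal ((2 ^ j) powr p)"
    using ball_pos[of "1 / 2 ^ j" x] by (simp add: ennreal_mult[symmetric])
  finally show ?thesis .
qed

text \<open>Only scales with \<open>2 ^ j < 1 / dist x y\<close> contribute, and their balls have
  volume at least \<open>V x (dist x y)\<close>. Superadditivity of the power reduces the sum of the
  weights to a geometric one.\<close>

lemma step_suminf_le_kern:
  assumes "x \<noteq> y" "1 < p"
  shows "(\<Sum>j. ennreal (step p j x y)) \<le> ennreal (2 powr p * kern p x y)"
proof -
  have d: "0 < dist x y" using assms by simp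
  define T where "T = {j. dist x y < 1 / 2 ^ j}"
  obtain n where "1 / dist x y < 2 ^ n" using real_arch_pow[of 2] by auto
  then have n: "1 / 2 ^ n < dist x y" using d by (simp add: field_simps)
  have "j < n" if "j \<in> T" for j
  proof (rule ccontr)
    assume "\<not> j < n"
    then have "(2::real) ^ n \<le> 2 ^ j" by (intro power_increasing) auto
    then have "1 / 2 ^ j \<le> (1 / 2 ^ n :: real)" by (intro divide_left_mono) auto
    then show False using that n by (simp add: T_def)
  qed
  then have fT: "finite T" by (intro finite_subset[of T "{..<n}"]) auto
  have "(\<Sum>j. ennreal (step p j x y)) = (\<Sum>j\<in>T. ennreal (step p j x y))"
    by (intro suminf_finite fT) (auto simp: T_def step_def)
  also have "\<dots> = ennreal (\<Sum>j\<in>T. step p j x y)" by (intro sum_ennreal step_nonneg)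
  also have "\<dots> \<le> ennreal (2 powr p * kern p x y)"
  proof (rule ennreal_leI)
    have "(\<Sum>j\<in>T. step p j x y) \<le> (\<Sum>j\<in>T. (2 ^ j) powr p / V x (dist x y))"
      using d by (intro sum_mono) (auto simp: step_def T_def intro!: divide_left_mono V_mono' mult_pos_pos ball_pos)
    also have "\<dots> = (\<Sum>j\<in>T. (2 ^ j) powr p) / V x (dist x y)" by (simp add: sum_divide_distrib)
    also have "\<dots> \<le> (2 / dist x y) powr p / V x (dist x y)"
    proof (rule divide_right_mono)
      have "(\<Sum>j\<in>T. (2 ^ j) powr p) \<le> (\<Sum>j\<in>T. 2 ^ j) powr p"
        using assms fT by (intro powr_sum_superadditive) auto
      also have "\<dots> \<le> (2 / dist x y) powr p"
      proof (intro powr_mono2)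
        show "(\<Sum>j\<in>T. 2 ^ j) \<le> 2 / dist x y"
          using sum_two_power_le[OF fT, of 1 "1 / dist x y"] d by (auto simp: T_def field_simps)
      qed (use assms in \<open>auto intro!: sum_nonneg\<close>)
      finally show "(\<Sum>j\<in>T. (2 ^ j) powr p) \<le> (2 / dist x y) powr p" .
    qed simp
    also have "\<dots> = 2 powr p * kern p x y" by (simp add: kern_def powr_divide)
    finally show "(\<Sum>j\<in>T. step p j x y) \<le> 2 powr p * kern p x y" .
  qed
  finally show ?thesis .
qed

text \<open>Confining the first variable to \<open>S\<close> is enough to make the loss in
  \<open>powr_split\<close> finite after integration.\<close>

definition level_energy :: "real \<Rightarrow> 'a set \<Rightarrow> ('a \<Rightarrow> real) \<Rightarrow> nat \<Rightarrow> real \<Rightarrow> ennreal" where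
  "level_energy p S g j q = (\<integral>\<^sup>+x\<in>S. (\<integral>\<^sup>+y. ennreal (step p j x y * \<bar>g x - g y\<bar> powr q) \<partial>m) \<partial>m)"

text \<open>With the threshold \<open>e / 2 ^ j\<close> in \<open>powr_split\<close>, the weight
  \<open>(2 ^ j) powr p\<close> of the kernel turns the loss into \<open>e powr p\<close> at every
  scale.\<close>

lemma level_energy_split:
  assumes [measurable]: "g \<in> borel_measurable m" "S \<in> sets m" and p: "1 < p" and \<delta>: "0 < \<delta>" and e: "0 < e"
  shows "level_energy p S g j p \<le> ennreal (e powr (- \<delta>) * (2 ^ j) powr \<delta>) * level_energy p S g j (p + \<delta>)
    + ennreal (e powr p) * emeasure m S"
proof -
  let ?l = "e / 2 ^ j"
  let ?c = "e powr (- \<delta>) * (2 ^ j) powr \<delta>"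
  have m1: "(\<lambda>(x, y). ennreal (step p j x y * \<bar>g x - g y\<bar> powr q)) \<in> borel_measurable (m \<Otimes>\<^sub>M m)" for q
    by measurable
  note [measurable] = nn_integral_slices[OF m1]
  have lc: "?l powr (- \<delta>) = ?c" using e by (simp add: powr_divide powr_minus field_simps)
  have inner: "(\<integral>\<^sup>+y. ennreal (step p j x y * \<bar>g x - g y\<bar> powr p) \<partial>m)
    \<le> ennreal ?c * (\<integral>\<^sup>+y. ennreal (step p j x y * \<bar>g x - g y\<bar> powr (p + \<delta>)) \<partial>m) + ennreal (e powr p)" for x
  proof -
    have "(\<integral>\<^sup>+y. ennreal (step p j x y * \<bar>g x - g y\<bar> powr p) \<partial>m)
      \<le> (\<integral>\<^sup>+y. ennreal ?c * ennreal (step p j x y * \<bar>g x - g y\<bar> powr (p + \<delta>)) + ennreal (?l powr p) * ennreal (step p j x y) \<partial>m)"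
    proof (intro nn_integral_mono)
      fix y
      have "step p j x y * \<bar>g x - g y\<bar> powr p \<le> step p j x y * (?c * \<bar>g x - g y\<bar> powr (p + \<delta>) + ?l powr p)"
        unfolding lc[symmetric] using e p \<delta> by (intro mult_left_mono step_nonneg powr_split) auto
      also have "\<dots> = ?c * (step p j x y * \<bar>g x - g y\<bar> powr (p + \<delta>)) + ?l powr p * step p j x y"
        by (simp add: algebra_simps)
      finally have "ennreal (step p j x y * \<bar>g x - g y\<bar> powr p) \<le> ennreal \<dots>" by (rule ennreal_leI)
      also have "\<dots> = ennreal ?c * ennreal (step p j x y * \<bar>g x - g y\<bar> powr (p + \<delta>)) + ennreal (?l powr p) * ennreal (step p j x y)"
        using step_nonneg[of p j x y] by (subst ennreal_plus) (auto simp: ennreal_mult' ennreal_mult'')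
      finally show "ennreal (step p j x y * \<bar>g x - g y\<bar> powr p) \<le> \<dots>" .
    qed
    also have "\<dots> = ennreal ?c * (\<integral>\<^sup>+y. ennreal (step p j x y * \<bar>g x - g y\<bar> powr (p + \<delta>)) \<partial>m)
      + ennreal (?l powr p) * ennreal ((2 ^ j) powr p)"
      by (subst nn_integral_add) (auto simp: nn_integral_cmult step_nn_integral)
    also have "ennreal (?l powr p) * ennreal ((2 ^ j) powr p) = ennreal (e powr p)"
      by (simp add: ennreal_mult[symmetric] powr_mult[symmetric])
    finally show ?thesis .
  qed
  have "level_energy p S g j p \<le> (\<integral>\<^sup>+x. ennreal ?c * ((\<integral>\<^sup>+y. ennreal (step p j x y * \<bar>g x - g y\<bar> powr (p + \<delta>)) \<partial>m) * indicator S x)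
     + ennreal (e powr p) * indicator S x \<partial>m)"
    unfolding level_energy_def using inner by (intro nn_integral_mono) (auto simp: indicator_def)
  also have "\<dots> = ennreal ?c * level_energy p S g j (p + \<delta>) + ennreal (e powr p) * emeasure m S"
    unfolding level_energy_def by (subst nn_integral_add) (auto simp: nn_integral_cmult)
  finally show ?thesis .
qed

lemma level_energy_suminf:
  assumes [measurable]: "g \<in> borel_measurable m" "S \<in> sets m" and p: "1 < p"
  shows "(\<Sum>j. level_energy p S g j q) \<le> ennreal (2 powr p) * (dint (\<lambda>x y. ennreal (\<bar>g x - g y\<bar> powr q * kern p x y)))"
proof -
  have m1: "(\<lambda>(x, y). ennreal (step p j x y * \<bar>g x - g y\<bar> powr q)) \<in> borel_measurable (m \<Otimes>\<^sub>M m)" for j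
    by measurable
  have m2: "(\<lambda>(x, y). ennreal (\<bar>g x - g y\<bar> powr q * kern p x y)) \<in> borel_measurable (m \<Otimes>\<^sub>M m)"
    by measurable
  note [measurable] = nn_integral_slices[OF m1] nn_integral_slices[OF m2]
  have "(\<Sum>j. level_energy p S g j q) \<le> (\<Sum>j. \<integral>\<^sup>+x. (\<integral>\<^sup>+y. ennreal (step p j x y * \<bar>g x - g y\<bar> powr q) \<partial>m) \<partial>m)"
    unfolding level_energy_def by (intro suminf_le nn_integral_mono) (auto simp: indicator_def)
  also have "\<dots> = dint (\<lambda>x y. (\<Sum>j. ennreal (step p j x y * \<bar>g x - g y\<bar> powr q)))"
    by (simp add: nn_integral_suminf)
  also have "\<dots> \<le> dint (\<lambda>x y. ennreal (2 powr p) * ennreal (\<bar>g x - g y\<bar> powr q * kern p x y))"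
  proof (intro nn_integral_mono)
    fix x y
    show "(\<Sum>j. ennreal (step p j x y * \<bar>g x - g y\<bar> powr q)) \<le> ennreal (2 powr p) * ennreal (\<bar>g x - g y\<bar> powr q * kern p x y)"
    proof (cases "x = y")
      case False
      have "(\<Sum>j. ennreal (step p j x y * \<bar>g x - g y\<bar> powr q)) = (\<Sum>j. ennreal (step p j x y)) * ennreal (\<bar>g x - g y\<bar> powr q)"
        using step_nonneg by (simp add: ennreal_mult)
      also have "\<dots> \<le> ennreal (2 powr p * kern p x y) * ennreal (\<bar>g x - g y\<bar> powr q)"
        by (intro mult_right_mono step_suminf_le_kern False p) auto
      also have "\<dots> = ennreal (2 powr p) * ennreal (\<bar>g x - g y\<bar> powr q * kern p x y)"
        using kern_nonneg by (simp add: ennreal_mult mult_ac)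
      finally show ?thesis .
    qed simp
  qed
  also have "\<dots> = ennreal (2 powr p) * (dint (\<lambda>x y. ennreal (\<bar>g x - g y\<bar> powr q * kern p x y)))"
    by (simp add: nn_integral_cmult)
  finally show ?thesis .
qed

definition clip :: "real \<Rightarrow> ('a \<Rightarrow> real) \<Rightarrow> 'a \<Rightarrow> real" where
  "clip N f x = max (- N) (min N (f x))"

lemma clip_props: assumes "0 \<le> N"
  shows "\<bar>clip N f x\<bar> \<le> N" "\<bar>clip N f x\<bar> \<le> \<bar>f x\<bar>" "\<bar>clip N f x - clip N f y\<bar> \<le> \<bar>f x - f y\<bar>"
    "\<bar>clip N f x - clip N f y\<bar> \<le> 2 * N" "\<bar>f x\<bar> \<le> N \<Longrightarrow> clip N f x = f x"
  using assms unfolding clip_def by linarith+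

lemma clip_measurable [measurable]:
  assumes [measurable]: "f \<in> borel_measurable m" shows "clip N f \<in> borel_measurable m"
  unfolding clip_def[abs_def] by measurable

definition small_jump :: "real \<Rightarrow> real \<Rightarrow> ('a \<Rightarrow> real) \<Rightarrow> 'a \<Rightarrow> 'a \<Rightarrow> ennreal" where
  "small_jump p \<delta> f x y =
     (if \<bar>f x - f y\<bar> \<le> 1 then ennreal (\<delta> * \<bar>f x - f y\<bar> powr (p + \<delta>) * kern p x y) else 0)"

definition large_jump :: "real \<Rightarrow> ('a \<Rightarrow> real) \<Rightarrow> 'a \<Rightarrow> 'a \<Rightarrow> ennreal" where
  "large_jump p f x y = (if \<bar>f x - f y\<bar> > 1 then ennreal (kern p x y) else 0)"

definition jump_bound :: "real \<Rightarrow> ('a \<Rightarrow> real) \<Rightarrow> real \<Rightarrow> real \<Rightarrow> bool" where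
  "jump_bound p f B1 B2 \<longleftrightarrow> 0 \<le> B1 \<and> 0 \<le> B2 \<and>
     (\<forall>\<delta>. 0 < \<delta> \<longrightarrow> \<delta> < 1 \<longrightarrow> dint (small_jump p \<delta> f) \<le> ennreal B1) \<and>
     dint (large_jump p f) \<le> ennreal B2"

lemma clipped_energy:
  assumes [measurable]: "f \<in> borel_measurable m" and N: "0 \<le> N" and p: "1 < p" and \<delta>: "0 < \<delta>"
    and "\<delta> < 1" and B: "jump_bound p f B1 B2"
  shows "ennreal \<delta> * (dint (\<lambda>x y. ennreal (\<bar>clip N f x - clip N f y\<bar> powr (p + \<delta>) * kern p x y)))
    \<le> ennreal (B1 + \<delta> * (2 * N) powr (p + \<delta>) * B2)"
proof -
  let ?c = "\<delta> * (2 * N) powr (p + \<delta>)"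
  let ?F = "small_jump p \<delta> f" and ?H = "large_jump p f"
  have B0: "0 \<le> B1" "0 \<le> B2" using B by (auto simp: jump_bound_def)
  define C where "C x y = ennreal (\<bar>clip N f x - clip N f y\<bar> powr (p + \<delta>) * kern p x y)" for x y
  have m: "(\<lambda>(x, y). ?F x y) \<in> borel_measurable (m \<Otimes>\<^sub>M m)" "(\<lambda>(x, y). ?H x y) \<in> borel_measurable (m \<Otimes>\<^sub>M m)"
    "(\<lambda>(x, y). C x y) \<in> borel_measurable (m \<Otimes>\<^sub>M m)"
    unfolding small_jump_def large_jump_def C_def by measurable
  note [measurable] = m[THEN nn_integral_slices(1)] m[THEN nn_integral_slices(2)]
  have "ennreal \<delta> * (dint (\<lambda>x y. C x y)) = dint (\<lambda>x y. ennreal \<delta> * C x y)"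
    by (simp add: nn_integral_cmult)
  also have "\<dots> \<le> dint (\<lambda>x y. ?F x y + ennreal ?c * ?H x y)"
  proof (intro nn_integral_mono)
    fix x y
    let ?t = "\<bar>clip N f x - clip N f y\<bar>"
    have e: "ennreal \<delta> * C x y = ennreal (\<delta> * ?t powr (p + \<delta>) * kern p x y)"
      using \<delta> kern_nonneg by (simp add: C_def ennreal_mult'[symmetric] mult.assoc)
    show "ennreal \<delta> * C x y \<le> ?F x y + ennreal ?c * ?H x y"
    proof (cases "\<bar>f x - f y\<bar> \<le> 1")
      case True
      have "\<delta> * ?t powr (p + \<delta>) * kern p x y \<le> \<delta> * \<bar>f x - f y\<bar> powr (p + \<delta>) * kern p x y"
        using \<delta> p clip_props(3)[OF N, of f x y] by (intro mult_right_mono mult_left_mono powr_mono2 kern_nonneg) auto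
      then show ?thesis using True unfolding e by (simp add: small_jump_def large_jump_def ennreal_leI)
    next
      case False
      have "\<delta> * ?t powr (p + \<delta>) * kern p x y \<le> ?c * kern p x y"
        using \<delta> p clip_props(4)[OF N, of f x y] by (intro mult_right_mono mult_left_mono powr_mono2 kern_nonneg) auto
      then show ?thesis using False \<delta> unfolding e by (simp add: small_jump_def large_jump_def ennreal_leI ennreal_mult'[symmetric])
    qed
  qed
  also have "\<dots> = dint (\<lambda>x y. ?F x y) + ennreal ?c * (dint (\<lambda>x y. ?H x y))"
    by (simp add: nn_integral_add nn_integral_cmult)
  also have "\<dots> \<le> ennreal B1 + ennreal ?c * ennreal B2"
    using B \<delta> \<open>\<delta> < 1\<close> by (intro add_mono mult_left_mono) (auto simp: jump_bound_def)
  also have "\<dots> = ennreal (B1 + ?c * B2)" using B0 \<delta> by (simp add: ennreal_mult'[symmetric])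
  finally show ?thesis by (simp add: C_def)
qed

text \<open>If all scales from \<open>j0\<close> on had large energy, summing the geometric series of the lower bounds
  and letting \<open>\<delta>\<close> tend to 0 would contradict the bound on the small jumps.\<close>

lemma good_scale:
  assumes [measurable]: "f \<in> borel_measurable m" "S \<in> sets m" and S: "emeasure m S < \<infinity>" and N: "0 \<le> N" and p: "1 < p"
    and B: "jump_bound p f B1 B2"
  shows "\<exists>j\<ge>j0. level_energy p S (clip N f) j p \<le> ennreal (2 powr p * B1 + 2)"
proof (rule ccontr)
  \<comment> \<open>Of the 2 in the claimed bound, one unit pays for the loss in
    \<open>level_energy_split\<close>; the other makes \<open>M\<close> exceed
    \<open>2 powr p * B1\<close>, which the limit contradicts.\<close>
  define M where "M = 2 powr p * B1 + 1"
  assume no: "\<not> ?thesis"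
  have big: "ennreal (M + 1) < level_energy p S (clip N f) j p" if "j0 \<le> j" for j
  proof -
    have "M + 1 = 2 powr p * B1 + 2" by (simp add: M_def)
    then show ?thesis using no that by (metis not_le)
  qed
  have B0: "0 \<le> B1" "0 \<le> B2" using B by (auto simp: jump_bound_def)
  have M0: "0 < M" using B0 by (simp add: M_def add_nonneg_pos)
  define s where "s = measure m S"
  have s: "emeasure m S = ennreal s" unfolding s_def using S by (intro emeasure_eq_ennreal_measure) auto
  have s0: "0 \<le> s" by (simp add: s_def)
  \<comment> \<open>Chosen so that the loss \<open>e powr p\<close> times the measure of
    \<open>S\<close> is at most 1.\<close>
  define e where "e = (1 / (s + 1)) powr (1 / p)"
  have e: "0 < e" using s0 by (simp add: e_def)
  have "e powr p * s \<le> 1" using s0 p by (simp add: e_def powr_powr divide_le_eq_1)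
  then have es: "ennreal (e powr p) * emeasure m S \<le> 1"
    unfolding s using s0 by (simp add: ennreal_mult[symmetric])
  \<comment> \<open>The lower bounds over all scales from \<open>j0\<close> on sum to a multiple of
    \<open>1 / (1 - 2 powr (- \<delta>))\<close>, which is at least \<open>1 / \<delta>\<close>.
    After multiplication by \<delta> the left side keeps its size, while the large jumps on the
    right retain a factor \<delta>.\<close>
  have key: "M * (e powr \<delta> * (2 ^ j0) powr (- \<delta>)) \<le> 2 powr p * (B1 + \<delta> * (2 * N) powr (p + \<delta>) * B2)"
    if \<delta>: "0 < \<delta>" "\<delta> < 1" for \<delta>
  proof -
    let ?q = "2 powr (- \<delta>)"
    have q: "0 < ?q" "?q < 1" using \<delta> one_minus_two_powr_ge[of \<delta>] by auto
    have low: "ennreal (M * e powr \<delta> * ?q ^ j) \<le> level_energy p S (clip N f) j (p + \<delta>)" if j: "j0 \<le> j" for j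
    proof -
      let ?c = "e powr (- \<delta>) * (2 ^ j) powr \<delta>"
      let ?X = "level_energy p S (clip N f) j (p + \<delta>)"
      have c0: "0 < ?c" using e by simp
      have "ennreal (M + 1) < ennreal ?c * ?X + ennreal (e powr p) * emeasure m S"
        using big[OF j] level_energy_split[of "clip N f" S p \<delta> e j] p \<delta> e by auto
      also have "\<dots> \<le> ennreal ?c * ?X + 1" using es by (rule add_left_mono)
      finally have "ennreal M + 1 < ennreal ?c * ?X + 1" using M0 by simp
      then have "ennreal M \<le> ennreal ?c * ?X" by (auto simp: not_le[symmetric] dest: add_right_mono)
      then have "ennreal (1 / ?c) * ennreal M \<le> ennreal (1 / ?c) * (ennreal ?c * ?X)" by (intro mult_left_mono) auto
      also have "\<dots> = ?X" using c0 e by (simp add: mult.assoc[symmetric] ennreal_mult[symmetric])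
      finally have "ennreal (1 / ?c * M) \<le> ?X" using M0 c0 by (subst ennreal_mult) auto
      moreover have "1 / ?c * M = M * e powr \<delta> * ?q ^ j"
      proof -
        have "?q ^ j = 2 powr (- \<delta> * real j)" by (simp add: powr_power mult.commute)
        moreover have "(2 ^ j) powr \<delta> = 2 powr (\<delta> * real j)" by (simp add: powr_realpow[symmetric] powr_powr mult.commute)
        ultimately show ?thesis by (simp add: powr_minus field_simps)
      qed
      ultimately show ?thesis by simp
    qed
    have "ennreal (M * e powr \<delta> * ?q ^ j0 * (1 / (1 - ?q))) = (\<Sum>i. ennreal (M * e powr \<delta> * ?q ^ (i + j0)))"
    proof -
      have "(\<lambda>i. M * e powr \<delta> * ?q ^ j0 * ?q ^ i) sums (M * e powr \<delta> * ?q ^ j0 * (1 / (1 - ?q)))"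
        using q by (intro sums_mult geometric_sums) auto
      then show ?thesis using q M0 by (intro suminf_ennreal_eq[symmetric]) (auto simp: power_add mult_ac)
    qed
    also have "\<dots> \<le> (\<Sum>i. level_energy p S (clip N f) (i + j0) (p + \<delta>))"
      using low by (intro suminf_le) auto
    also have "\<dots> \<le> (\<Sum>i. level_energy p S (clip N f) i (p + \<delta>))"
    proof -
      have "(\<Sum>i. level_energy p S (clip N f) i (p + \<delta>)) = (\<Sum>i. level_energy p S (clip N f) (i + j0) (p + \<delta>)) + (\<Sum>i<j0. level_energy p S (clip N f) i (p + \<delta>))"
        by (rule suminf_offset) simp
      then show ?thesis by simp
    qed
    also have "\<dots> \<le> ennreal (2 powr p) * (dint (\<lambda>x y. ennreal (\<bar>clip N f x - clip N f y\<bar> powr (p + \<delta>) * kern p x y)))"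
      using p by (intro level_energy_suminf) auto
    finally have "ennreal \<delta> * ennreal (M * e powr \<delta> * ?q ^ j0 * (1 / (1 - ?q)))
      \<le> ennreal \<delta> * (ennreal (2 powr p) * (dint (\<lambda>x y. ennreal (\<bar>clip N f x - clip N f y\<bar> powr (p + \<delta>) * kern p x y))))"
      by (intro mult_left_mono) auto
    also have "\<dots> = ennreal (2 powr p) * (ennreal \<delta> * (dint (\<lambda>x y. ennreal (\<bar>clip N f x - clip N f y\<bar> powr (p + \<delta>) * kern p x y))))"
      by (simp only: mult_ac)
    also have "\<dots> \<le> ennreal (2 powr p) * ennreal (B1 + \<delta> * (2 * N) powr (p + \<delta>) * B2)"
      by (intro mult_left_mono clipped_energy[OF _ N p \<delta> B]) auto
    finally have "ennreal (\<delta> * (M * e powr \<delta> * ?q ^ j0 * (1 / (1 - ?q)))) \<le> ennreal (2 powr p * (B1 + \<delta> * (2 * N) powr (p + \<delta>) * B2))"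
      using \<delta> B0 M0 q by (simp add: ennreal_mult[symmetric] del: ennreal_plus)
    then have "\<delta> * (M * e powr \<delta> * ?q ^ j0 * (1 / (1 - ?q))) \<le> 2 powr p * (B1 + \<delta> * (2 * N) powr (p + \<delta>) * B2)"
      using \<delta> B0 by (subst (asm) ennreal_le_iff) (auto intro!: mult_nonneg_nonneg add_nonneg_nonneg)
    moreover have "M * (e powr \<delta> * (2 ^ j0) powr (- \<delta>)) \<le> \<delta> * (M * e powr \<delta> * ?q ^ j0 * (1 / (1 - ?q)))"
    proof -
      have "?q ^ j0 = (2 ^ j0) powr (- \<delta>)" by (simp add: powr_realpow[symmetric] powr_powr powr_power mult.commute)
      moreover have "1 \<le> \<delta> * (1 / (1 - ?q))" using one_minus_two_powr_le[OF \<delta>(1)] q by (simp add: le_divide_eq)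
      then have "M * e powr \<delta> * ?q ^ j0 * 1 \<le> M * e powr \<delta> * ?q ^ j0 * (\<delta> * (1 / (1 - ?q)))"
        using M0 by (intro mult_left_mono) auto
      ultimately show ?thesis by (simp add: mult_ac)
    qed
    ultimately show ?thesis by linarith
  qed
  define d where "d n = 1 / real (Suc (Suc n))" for n
  have d: "0 < d n" "d n < 1" for n by (auto simp: d_def)
  have dlim: "d \<longlonglongrightarrow> 0" unfolding d_def using LIMSEQ_Suc[OF LIMSEQ_Suc[OF lim_1_over_n]] by simp
  have l1: "(\<lambda>n. M * (e powr (d n) * (2 ^ j0) powr (- d n))) \<longlonglongrightarrow> M * (e powr 0 * (2 ^ j0) powr (- 0))"
    using e by (intro tendsto_intros dlim) auto
  \<comment> \<open>The base \<open>2 * N + 1\<close> is positive even for \<open>N = 0\<close>, as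
    continuity of the power requires.\<close>
  have l2: "(\<lambda>n. 2 powr p * (B1 + d n * (2 * N + 1) powr (p + d n) * B2)) \<longlonglongrightarrow> 2 powr p * (B1 + 0 * (2 * N + 1) powr (p + 0) * B2)"
    using N by (intro tendsto_intros dlim) auto
  have l3: "M * (e powr (d n) * (2 ^ j0) powr (- d n)) \<le> 2 powr p * (B1 + d n * (2 * N + 1) powr (p + d n) * B2)" for n
  proof -
    have "2 powr p * (B1 + d n * (2 * N) powr (p + d n) * B2) \<le> 2 powr p * (B1 + d n * (2 * N + 1) powr (p + d n) * B2)"
      using N B0 p d(1)[of n] by (intro mult_left_mono add_left_mono mult_right_mono powr_mono2) auto
    then show ?thesis using key[OF d, of n] by linarith
  qed
  have "M * (e powr 0 * (2 ^ j0) powr (- 0)) \<le> 2 powr p * (B1 + 0 * (2 * N + 1) powr (p + 0) * B2)"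
    by (rule LIMSEQ_le[OF l1 l2]) (use l3 in blast)
  then show False using e by (simp add: M_def)
qed


section \<open>Cut-off approximations and membership in the Sobolev space\<close>

definition cutoff :: "'a \<Rightarrow> nat \<Rightarrow> 'a \<Rightarrow> real" where
  "cutoff a k x = max 0 (min 1 (2 - dist a x / k))"

lemma cutoff_props:
  assumes "0 < k"
  shows "0 \<le> cutoff a k x" "cutoff a k x \<le> 1" "2 * k \<le> dist a x \<Longrightarrow> cutoff a k x = 0"
    "dist a x \<le> k \<Longrightarrow> cutoff a k x = 1" "\<bar>cutoff a k x - cutoff a k y\<bar> \<le> dist x y"
proof -
  have "\<bar>dist a x - dist a y\<bar> \<le> dist x y" by metric
  then have "\<bar>dist a x / k - dist a y / k\<bar> \<le> dist x y / k"
    by (simp add: divide_right_mono flip: diff_divide_distrib)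
  also have "\<dots> \<le> dist x y" using assms mult_left_mono[of 1 "real k" "dist x y"] by (simp add: divide_le_eq)
  finally show "\<bar>cutoff a k x - cutoff a k y\<bar> \<le> dist x y" unfolding cutoff_def by linarith
qed (use assms in \<open>auto simp: cutoff_def field_simps\<close>)

lemma cutoff_measurable [measurable]: "cutoff a k \<in> borel_measurable m"
  unfolding cutoff_def[abs_def] by measurable

text \<open>The product lies between 0 and \<open>f x\<close>. This supplies the dominating function
  for the error of cutting off and clipping.\<close>

lemma cutoff_clip_diff: "\<bar>cutoff a k x * clip (real n) f x - f x\<bar> \<le> \<bar>f x\<bar>"
proof -
  define c where "c = cutoff a k x"
  have c: "0 \<le> c" "c \<le> 1" by (auto simp: c_def cutoff_def)
  show ?thesis
  proof (cases "0 \<le> f x")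
    case True
    then have "0 \<le> clip (real n) f x" "clip (real n) f x \<le> f x" by (auto simp: clip_def)
    with c show ?thesis unfolding c_def[symmetric]
      using mult_left_le_one_le[of "clip (real n) f x" c] mult_nonneg_nonneg[of c "clip (real n) f x"] by linarith
  next
    case False
    then have "clip (real n) f x \<le> 0" "f x \<le> clip (real n) f x" by (auto simp: clip_def)
    with c show ?thesis unfolding c_def[symmetric]
      using mult_left_le_one_le[of "- clip (real n) f x" c] mult_nonneg_nonpos[of c "clip (real n) f x"]
      by simp
  qed
qed

lemma step_ball_avg:
  assumes [measurable]: "g \<in> borel_measurable m" and g: "\<And>x. \<bar>g x\<bar> \<le> N" and p: "1 < p"
  shows "(\<integral>\<^sup>+y. ennreal (step p j x y * \<bar>g x - g y\<bar> powr p) \<partial>m)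
    = ennreal ((2 ^ j) powr p * ball_avg m x (1 / 2 ^ j) (\<lambda>q. \<bar>g q - g x\<bar> powr p))"
proof -
  let ?r = "1 / 2 ^ j :: real"
  let ?c = "(2 ^ j) powr p / V x ?r"
  have "set_integrable m (ball x ?r) (\<lambda>q. ?c * \<bar>g q - g x\<bar> powr p)"
  proof (intro set_integrable_mult_right set_integrable_ball[of _ "(2 * N) powr p"])
    fix q
    have "\<bar>g q - g x\<bar> \<le> 2 * N" using g[of q] g[of x] by linarith
    then show "\<bar>\<bar>g q - g x\<bar> powr p\<bar> \<le> (2 * N) powr p" using p by (simp add: powr_mono2)
  qed measurable
  then have "(\<integral>\<^sup>+y. ennreal (indicator (ball x ?r) y *\<^sub>R (?c * \<bar>g y - g x\<bar> powr p)) \<partial>m) = ennreal (LINT q:ball x ?r|m. ?c * \<bar>g q - g x\<bar> powr p)"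
    unfolding set_lebesgue_integral_def
    by (intro nn_integral_eq_integral) (auto simp: set_integrable_def)
  moreover have "(\<integral>\<^sup>+y. ennreal (step p j x y * \<bar>g x - g y\<bar> powr p) \<partial>m) = (\<integral>\<^sup>+y. ennreal (indicator (ball x ?r) y *\<^sub>R (?c * \<bar>g y - g x\<bar> powr p)) \<partial>m)"
    by (intro nn_integral_cong) (auto simp: step_def indicator_def abs_minus_commute)
  ultimately show ?thesis by (simp add: ball_avg_def)
qed

text \<open>Bounded energy at a scale \<open>1 / 2 ^ j\<close> with \<open>k \<le> j\<close> is used
  twice. It bounds the slope of the mollified function, and since it carries the weight
  \<open>(2 ^ j) powr p \<ge> 2 ^ k\<close>, the mollification error to the power \<open>p\<close>
  is of order \<open>(1 / 2) ^ k\<close>.\<close>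

lemma cutoff_approximation:
  assumes f: "f \<in> Lp p m" and p: "1 < p" and k: "0 < k"
    and B: "jump_bound p f B1 B2"
  shows "\<exists>v. v \<in> LIP_bs \<inter> Lp p m
    \<and> (\<integral>\<^sup>+x. ennreal (slope v x powr p) \<partial>m) \<le> ennreal (2 powr p * ((16 * D ^ 6) powr p * (2 powr p * B1 + 2) + (\<integral>x. \<bar>f x\<bar> powr p \<partial>m)))
    \<and> (\<integral>\<^sup>+x. ennreal (\<bar>v x - f x\<bar> powr p) \<partial>m) \<le> ennreal (2 powr p * ((D\<^sup>2) powr p * (2 powr p * B1 + 2) * (1 / 2) ^ k
        + (\<integral>x. \<bar>cutoff a k x * clip k f x - f x\<bar> powr p \<partial>m)))"
proof -
  have [measurable]: "f \<in> borel_measurable m" and fi: "integrable m (\<lambda>x. \<bar>f x\<bar> powr p)"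
    using f by (auto simp: Lp_def)
  define M where "M = 2 powr p * B1 + 2"
  have M0: "0 \<le> M" using B by (simp add: M_def jump_bound_def)
  \<comment> \<open>One unit beyond the support of the cut-off, so that \<open>v\<close> vanishes on
    a unit ball around each point off \<open>S\<close>.\<close>
  define S where "S = ball a (2 * real k + 1)"
  have [measurable]: "S \<in> sets m" by (simp add: S_def)
  define g where "g = clip (real k) f"
  have [measurable]: "g \<in> borel_measurable m" unfolding g_def by measurable
  have g: "\<bar>g x\<bar> \<le> k" "\<bar>g x\<bar> \<le> \<bar>f x\<bar>" for x using clip_props[of "real k" f x] by (auto simp: g_def)
  obtain j where j: "k \<le> j" "level_energy p S g j p \<le> ennreal M"
    using good_scale[of f S "real k" p B1 B2 k] finite_ball[of a "2 * real k + 1"] p B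
    by (auto simp: S_def g_def M_def)
  \<comment> \<open>Makes the balls of radius \<open>4 * r\<close> in the mollifier estimates
    coincide with the balls of \<open>step p j\<close>.\<close>
  define r where "r = 1 / (4 * 2 ^ j :: real)"
  have r: "0 < r" "4 * r = 1 / 2 ^ j" by (auto simp: r_def)
  define u where "u = mol r g"
  define v where "v x = cutoff a k x * u x" for x
  define A where "A x = ball_avg m x (1 / 2 ^ j) (\<lambda>q. \<bar>g q - g x\<bar>)" for x
  define Q where "Q x = ball_avg m x (1 / 2 ^ j) (\<lambda>q. \<bar>g q - g x\<bar> powr p)" for x
  define E where "E x = (\<integral>\<^sup>+y. ennreal (step p j x y * \<bar>g x - g y\<bar> powr p) \<partial>m)" for x
  have Em [measurable]: "E \<in> borel_measurable m"
  proof -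
    have "(\<lambda>(x, y). ennreal (step p j x y * \<bar>g x - g y\<bar> powr p)) \<in> borel_measurable (m \<Otimes>\<^sub>M m)"
      by measurable
    then show ?thesis unfolding E_def[abs_def] using borel_measurable_nn_integral by simp
  qed
  have EQ: "E x = ennreal ((2 ^ j) powr p * Q x)" for x
    unfolding E_def Q_def by (rule step_ball_avg) (use g(1) p in auto)
  have EM: "(\<integral>\<^sup>+x. E x * indicator S x \<partial>m) \<le> ennreal M"
    using j(2) by (simp add: level_energy_def E_def)
  have g2: "\<bar>g q - g x\<bar> \<le> 2 * k" for q x using g(1)[of q] g(1)[of x] by linarith
  have A0: "0 \<le> A x" for x unfolding A_def by (rule ball_avg_abs_le) (use g2 in auto)
  have AQ: "A x powr p \<le> Q x" for x
    unfolding A_def Q_def by (rule ball_avg_powr) (use g2 p in auto)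
  have Q0: "0 \<le> Q x" for x using AQ[of x] order_trans[OF powr_ge_zero] by blast
  have ub: "\<bar>u x\<bar> \<le> k" for x unfolding u_def using g(1) r by (intro mol_bounded) auto
  have ulip: "(2 * D ^ 6 * k / r)-lipschitz_on UNIV u" unfolding u_def using g(1) r by (intro mol_lipschitz) auto
  have ug: "\<bar>u x - g x\<bar> \<le> D\<^sup>2 * A x" for x
    using mol_close[of g "real k" r x] g(1) r by (simp add: u_def A_def)
  have [measurable]: "u \<in> borel_measurable m"
    using borel_measurable_continuous_onI[OF lipschitz_on_continuous_on[OF ulip]] measurable_cong_sets[OF sets_m refl] by blast
  have [measurable]: "v \<in> borel_measurable m" unfolding v_def[abs_def] by measurable
  have vdiff: "\<bar>v x - v y\<bar> \<le> \<bar>u x - u y\<bar> + \<bar>u x\<bar> * dist x y" for x y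
  proof -
    have "v x - v y = cutoff a k y * (u x - u y) + u x * (cutoff a k x - cutoff a k y)"
      by (simp add: v_def algebra_simps)
    then have "\<bar>v x - v y\<bar> \<le> \<bar>cutoff a k y\<bar> * \<bar>u x - u y\<bar> + \<bar>u x\<bar> * \<bar>cutoff a k x - cutoff a k y\<bar>"
      by (metis abs_mult abs_triangle_ineq)
    also have "\<dots> \<le> 1 * \<bar>u x - u y\<bar> + \<bar>u x\<bar> * dist x y"
      using cutoff_props[OF k, of a y] cutoff_props(5)[OF k, of a x y] by (intro add_mono mult_right_mono mult_left_mono) auto
    finally show ?thesis by simp
  qed
  have v0: "v x = 0" if "2 * k \<le> dist a x" for x using cutoff_props(3)[OF k] that by (simp add: v_def)
  have vlip: "(2 * D ^ 6 * k / r + k)-lipschitz_on UNIV v"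
  proof (rule lipschitz_onI)
    fix x y
    have "\<bar>u x\<bar> * dist x y \<le> k * dist x y" using ub by (intro mult_right_mono) auto
    then show "dist (v x) (v y) \<le> (2 * D ^ 6 * k / r + k) * dist x y"
      using vdiff[of x y] lipschitz_abs_diff[OF ulip, of x y] by (simp add: dist_real_def distrib_right)
  qed (use lipschitz_on_nonneg[OF ulip] in auto)
  have vb: "\<bar>v x\<bar> \<le> k" for x
    using mult_mono[of "\<bar>cutoff a k x\<bar>" 1 "\<bar>u x\<bar>" k] ub[of x] cutoff_props[OF k, of a x] by (simp add: v_def abs_mult)
  have "v \<in> LIP_bs" by (rule LIP_bsI[OF vlip v0])
  moreover have "v \<in> Lp p m"
  proof -
    have "integrable m (\<lambda>x. \<bar>v x\<bar> powr p)"
      using vb v0 p by (intro integrable_bounded_support[of _ a "2 * k" "real k powr p"]) (auto intro!: powr_mono2)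
    then show ?thesis by (simp add: Lp_def)
  qed
  moreover have "(\<integral>\<^sup>+x. ennreal (slope v x powr p) \<partial>m) \<le> ennreal (2 powr p * ((16 * D ^ 6) powr p * M + (\<integral>x. \<bar>f x\<bar> powr p \<partial>m)))"
  proof -
    have pt: "ennreal (slope v x powr p) \<le> ennreal (2 powr p * (16 * D ^ 6) powr p) * (E x * indicator S x) + ennreal (2 powr p) * ennreal (\<bar>f x\<bar> powr p)" for x
    proof (cases "x \<in> S")
      case False
      have "\<bar>v x - v y\<bar> \<le> 0 * dist x y" if "dist x y < 1" for y
        using False v0[of x] v0[of y] that dist_triangle[of a x y] by (auto simp: S_def dist_commute)
      then have "slope v x = 0" using slope_bounds[of 1 0 x v] by fastforce
      then show ?thesis by simp
    next
      case True
      let ?c = "2 * D ^ 6 / r * A x + \<bar>u x\<bar>"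
      have c0: "0 \<le> ?c" using A0[of x] r D_ge_1 by simp
      have "\<bar>v x - v y\<bar> \<le> ?c * dist x y" if "dist x y < 2 * r" for y
      proof -
        have "\<bar>u x - u y\<bar> \<le> 2 * D ^ 6 / r * A x * dist x y"
          using mol_diff[of g "real k" r x x y "g x"] g(1) r that by (simp add: u_def A_def)
        then show ?thesis using vdiff[of x y] by (simp add: distrib_right)
      qed
      then have sl: "0 \<le> slope v x" "slope v x \<le> ?c" using slope_bounds[of "2 * r" ?c x v] r c0 by auto
      \<comment> \<open>The term \<open>\<bar>u x\<bar>\<close> comes from the slope of the cut-off.
        Its excess over \<open>\<bar>f x\<bar>\<close> is absorbed by the gradient term, whose
        constant rises from 8 to 16.\<close>
      have "\<bar>u x\<bar> \<le> \<bar>f x\<bar> + D\<^sup>2 * A x" using ug[of x] g(2)[of x] by linarith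
      moreover have "D\<^sup>2 * A x \<le> 8 * D ^ 6 * 2 ^ j * A x"
      proof (rule mult_right_mono[OF _ A0])
        have "D\<^sup>2 \<le> D ^ 6" using D_ge_1 by (intro power_increasing) auto
        also have "\<dots> \<le> D ^ 6 * (8 * 2 ^ j)"
        proof -
          have "(1::real) \<le> 8 * 2 ^ j" using one_le_power[of "2::real" j] by linarith
          then show ?thesis using mult_left_mono[of 1 "8 * 2 ^ j" "D ^ 6"] D_ge_1 by simp
        qed
        finally show "D\<^sup>2 \<le> 8 * D ^ 6 * 2 ^ j" by (simp add: mult_ac)
      qed
      moreover have "2 * D ^ 6 / r * A x = 8 * D ^ 6 * 2 ^ j * A x" by (simp add: r_def)
      ultimately have "?c \<le> 16 * D ^ 6 * 2 ^ j * A x + \<bar>f x\<bar>" by linarith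
      with sl have "slope v x powr p \<le> (16 * D ^ 6 * 2 ^ j * A x + \<bar>f x\<bar>) powr p" using p by (intro powr_mono2) auto
      also have "\<dots> \<le> 2 powr p * ((16 * D ^ 6 * 2 ^ j * A x) powr p + \<bar>f x\<bar> powr p)"
        using A0[of x] D_ge_1 p by (intro powr_add_le) auto
      also have "(16 * D ^ 6 * 2 ^ j * A x) powr p = (16 * D ^ 6) powr p * ((2 ^ j) powr p * A x powr p)"
        by (simp only: powr_mult mult.assoc)
      also have "2 powr p * ((16 * D ^ 6) powr p * ((2 ^ j) powr p * A x powr p) + \<bar>f x\<bar> powr p)
         \<le> 2 powr p * ((16 * D ^ 6) powr p * ((2 ^ j) powr p * Q x) + \<bar>f x\<bar> powr p)"
        using AQ[of x] by (intro mult_left_mono add_right_mono) auto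
      finally have "ennreal (slope v x powr p) \<le> ennreal (2 powr p * (16 * D ^ 6) powr p * ((2 ^ j) powr p * Q x) + 2 powr p * \<bar>f x\<bar> powr p)"
        by (intro ennreal_leI) (simp add: distrib_left mult.assoc)
      also have "\<dots> = ennreal (2 powr p * (16 * D ^ 6) powr p) * E x + ennreal (2 powr p) * ennreal (\<bar>f x\<bar> powr p)"
        using Q0[of x] by (simp add: EQ ennreal_mult[symmetric])
      finally show ?thesis using True by simp
    qed
    have "(\<integral>\<^sup>+x. ennreal (slope v x powr p) \<partial>m) \<le> ennreal (2 powr p * (16 * D ^ 6) powr p) * (\<integral>\<^sup>+x. E x * indicator S x \<partial>m)
       + ennreal (2 powr p) * (\<integral>\<^sup>+x. ennreal (\<bar>f x\<bar> powr p) \<partial>m)"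
      using nn_integral_mono[OF pt, of m "\<lambda>x. x"] by (subst (asm) nn_integral_add) (auto simp: nn_integral_cmult)
    also have "(\<integral>\<^sup>+x. ennreal (\<bar>f x\<bar> powr p) \<partial>m) = ennreal (\<integral>x. \<bar>f x\<bar> powr p \<partial>m)"
      using fi by (intro nn_integral_eq_integral) auto
    also have "ennreal (2 powr p * (16 * D ^ 6) powr p) * (\<integral>\<^sup>+x. E x * indicator S x \<partial>m) \<le> ennreal (2 powr p * (16 * D ^ 6) powr p) * ennreal M"
      by (intro mult_left_mono EM) auto
    also have "ennreal (2 powr p * (16 * D ^ 6) powr p) * ennreal M + ennreal (2 powr p) * ennreal (\<integral>x. \<bar>f x\<bar> powr p \<partial>m)
      = ennreal (2 powr p * ((16 * D ^ 6) powr p * M + (\<integral>x. \<bar>f x\<bar> powr p \<partial>m)))"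
      using M0 by (simp add: ennreal_mult[symmetric] ennreal_plus[symmetric] distrib_left mult.assoc del: ennreal_plus)
    finally show ?thesis by simp
  qed
  moreover have "(\<integral>\<^sup>+x. ennreal (\<bar>v x - f x\<bar> powr p) \<partial>m) \<le> ennreal (2 powr p * ((D\<^sup>2) powr p * M * (1 / 2) ^ k
        + (\<integral>x. \<bar>cutoff a k x * clip k f x - f x\<bar> powr p \<partial>m)))"
  proof -
    let ?J = "\<lambda>x. \<bar>cutoff a k x * g x - f x\<bar> powr p"
    have Ji: "integrable m ?J"
    proof (rule Bochner_Integration.integrable_bound[OF fi])
      show "AE x in m. norm (?J x) \<le> norm (\<bar>f x\<bar> powr p)"
        using p by (intro AE_I2) (auto simp: g_def intro!: powr_mono2 cutoff_clip_diff)
    qed measurable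
    let ?d = "2 powr p * (D\<^sup>2) powr p * (1 / 2) ^ k"
    have pt: "ennreal (\<bar>v x - f x\<bar> powr p) \<le> ennreal ?d * (E x * indicator S x) + ennreal (2 powr p) * ennreal (?J x)" for x
    proof -
      define z where "z = \<bar>cutoff a k x * (u x - g x)\<bar>"
      have z0: "0 \<le> z" by (simp add: z_def)
      have "v x - f x = cutoff a k x * (u x - g x) + (cutoff a k x * g x - f x)"
        by (simp add: v_def algebra_simps)
      then have "\<bar>v x - f x\<bar> \<le> z + \<bar>cutoff a k x * g x - f x\<bar>" unfolding z_def by (metis abs_triangle_ineq)
      then have "\<bar>v x - f x\<bar> powr p \<le> (z + \<bar>cutoff a k x * g x - f x\<bar>) powr p" using p by (intro powr_mono2) auto
      also have "\<dots> \<le> 2 powr p * (z powr p + ?J x)" using z0 p by (intro powr_add_le) auto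
      finally have "ennreal (\<bar>v x - f x\<bar> powr p) \<le> ennreal (2 powr p * (z powr p + ?J x))" by (rule ennreal_leI)
      also have "\<dots> = ennreal (2 powr p * z powr p) + ennreal (2 powr p) * ennreal (?J x)"
        by (simp add: ennreal_mult[symmetric] distrib_left)
      also have "ennreal (2 powr p * z powr p) \<le> ennreal ?d * (E x * indicator S x)"
      proof (cases "x \<in> S")
        case False
        then have "z = 0" using cutoff_props(3)[OF k, of a x] by (simp add: z_def S_def)
        then show ?thesis by simp
      next
        case True
        have "z \<le> 1 * (D\<^sup>2 * A x)"
          unfolding z_def abs_mult using cutoff_props[OF k, of a x] ug[of x] by (intro mult_mono) auto
        then have "z powr p \<le> (D\<^sup>2 * A x) powr p" using z0 p by (intro powr_mono2) auto
        also have "\<dots> = (D\<^sup>2) powr p * A x powr p" by (rule powr_mult)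
        also have "\<dots> \<le> (D\<^sup>2) powr p * Q x" by (intro mult_left_mono AQ) auto
        also have "\<dots> \<le> (D\<^sup>2) powr p * ((1 / 2) ^ k * ((2 ^ j) powr p * Q x))"
        proof (rule mult_left_mono)
          have "(2::real) ^ k \<le> 2 ^ j" using j(1) by (intro power_increasing) auto
          also have "\<dots> = (2 ^ j) powr 1" by simp
          also have "\<dots> \<le> (2 ^ j) powr p" using p by (intro powr_mono) auto
          finally have "1 \<le> (1 / 2) ^ k * (2 ^ j) powr p" by (simp add: power_divide)
          then have "1 * Q x \<le> (1 / 2) ^ k * (2 ^ j) powr p * Q x" by (intro mult_right_mono Q0)
          then show "Q x \<le> (1 / 2) ^ k * ((2 ^ j) powr p * Q x)" by (simp add: mult_ac)
        qed simp
        finally have "2 powr p * z powr p \<le> 2 powr p * ((D\<^sup>2) powr p * ((1 / 2) ^ k * ((2 ^ j) powr p * Q x)))"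
          by (intro mult_left_mono) auto
        then have "ennreal (2 powr p * z powr p) \<le> ennreal (?d * ((2 ^ j) powr p * Q x))"
          by (intro ennreal_leI) (simp add: mult_ac)
        also have "\<dots> = ennreal ?d * E x" unfolding EQ by (rule ennreal_mult') simp
        finally show ?thesis using True by simp
      qed
      finally show ?thesis by (simp add: add_right_mono)
    qed
    have "(\<integral>\<^sup>+x. ennreal (\<bar>v x - f x\<bar> powr p) \<partial>m) \<le> ennreal ?d * (\<integral>\<^sup>+x. E x * indicator S x \<partial>m)
       + ennreal (2 powr p) * (\<integral>\<^sup>+x. ennreal (?J x) \<partial>m)"
      using nn_integral_mono[OF pt, of m "\<lambda>x. x"] by (subst (asm) nn_integral_add) (auto simp: nn_integral_cmult)
    also have "(\<integral>\<^sup>+x. ennreal (?J x) \<partial>m) = ennreal (\<integral>x. ?J x \<partial>m)"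
      using Ji by (intro nn_integral_eq_integral) auto
    also have "ennreal ?d * (\<integral>\<^sup>+x. E x * indicator S x \<partial>m) \<le> ennreal ?d * ennreal M"
      by (intro mult_left_mono EM) auto
    also have "ennreal ?d * ennreal M + ennreal (2 powr p) * ennreal (\<integral>x. ?J x \<partial>m)
      = ennreal (2 powr p * ((D\<^sup>2) powr p * M * (1 / 2) ^ k + (\<integral>x. ?J x \<partial>m)))"
      using M0 by (simp add: ennreal_mult[symmetric] ennreal_plus[symmetric] distrib_left mult_ac del: ennreal_plus)
    finally show ?thesis by (simp add: g_def)
  qed
  ultimately show ?thesis unfolding M_def by blast
qed

lemma W1pI:
  assumes f: "f \<in> Lp p m" and p: "1 < p"
    and B: "jump_bound p f B1 B2"
  shows "f \<in> W1p p m"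
proof -
  obtain a :: 'a where True by blast
  have [measurable]: "f \<in> borel_measurable m" and fi: "integrable m (\<lambda>x. \<bar>f x\<bar> powr p)"
    using f by (auto simp: Lp_def)
  define M where "M = 2 powr p * B1 + 2"
  define C where "C = 2 powr p * ((16 * D ^ 6) powr p * M + (\<integral>x. \<bar>f x\<bar> powr p \<partial>m))"
  define J where "J k x = \<bar>cutoff a k x * clip k f x - f x\<bar> powr p" for k x
  define X where "X k = 2 powr p * ((D\<^sup>2) powr p * M * (1 / 2) ^ k + (\<integral>x. J k x \<partial>m))" for k
  \<comment> \<open>Index 0 is skipped: there division by zero makes the cut-off identically
    1.\<close>
  have "\<forall>k. \<exists>v. v \<in> LIP_bs \<inter> Lp p m \<and> (\<integral>\<^sup>+x. ennreal (slope v x powr p) \<partial>m) \<le> ennreal C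
    \<and> (\<integral>\<^sup>+x. ennreal (\<bar>v x - f x\<bar> powr p) \<partial>m) \<le> ennreal (X (Suc k))"
    using cutoff_approximation[OF f p _ B, of "Suc _" a] unfolding C_def X_def M_def J_def by blast
  then obtain v where v: "\<And>k. v k \<in> LIP_bs \<inter> Lp p m" "\<And>k. (\<integral>\<^sup>+x. ennreal (slope (v k) x powr p) \<partial>m) \<le> ennreal C"
    "\<And>k. (\<integral>\<^sup>+x. ennreal (\<bar>v k x - f x\<bar> powr p) \<partial>m) \<le> ennreal (X (Suc k))" by metis
  have Jlim: "(\<lambda>k. \<integral>x. J k x \<partial>m) \<longlonglongrightarrow> (\<integral>x. 0 \<partial>m)"
  proof (rule integral_dominated_convergence[OF _ _ fi])
    show "J k \<in> borel_measurable m" for k unfolding J_def[abs_def] by measurable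
    show "AE x in m. (\<lambda>k. J k x) \<longlonglongrightarrow> 0"
    proof (rule AE_I2)
      fix x
      obtain n :: nat where n: "max (dist a x) \<bar>f x\<bar> \<le> real n" using real_arch_simple by blast
      have "J k x = 0" if "Suc n \<le> k" for k
      proof -
        have "0 < k" "dist a x \<le> real k" "\<bar>f x\<bar> \<le> real k" using n that by auto
        then show ?thesis using cutoff_props(4)[of k a x] clip_props(5)[of "real k" f x] by (simp add: J_def)
      qed
      then show "(\<lambda>k. J k x) \<longlonglongrightarrow> 0"
        by (intro tendsto_eventually eventually_sequentiallyI[of "Suc n"])
    qed
    show "AE x in m. norm (J k x) \<le> \<bar>f x\<bar> powr p" for k
      using p by (intro AE_I2) (auto simp: J_def intro!: powr_mono2 cutoff_clip_diff)
  qed simp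
  have "X \<longlonglongrightarrow> 2 powr p * ((D\<^sup>2) powr p * M * 0 + (\<integral>x. 0 \<partial>m))"
    unfolding X_def by (intro tendsto_intros Jlim LIMSEQ_power_zero) auto
  then have Xlim: "(\<lambda>k. X (Suc k)) \<longlonglongrightarrow> 0" by (simp add: LIMSEQ_Suc)
  have X0: "0 \<le> X k" for k
    unfolding X_def J_def using B
    by (auto simp: M_def jump_bound_def intro!: mult_nonneg_nonneg add_nonneg_nonneg Bochner_Integration.integral_nonneg)
  have Ile: "(\<integral>x. \<bar>v k x - f x\<bar> powr p \<partial>m) \<le> X (Suc k)" for k
  proof -
    have "integrable m (\<lambda>x. \<bar>v k x - f x\<bar> powr p)" using v(1)[of k] f p by (intro Lp_diff_integrable) auto
    then have "(\<integral>\<^sup>+x. ennreal (\<bar>v k x - f x\<bar> powr p) \<partial>m) = ennreal (\<integral>x. \<bar>v k x - f x\<bar> powr p \<partial>m)"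
      by (intro nn_integral_eq_integral) auto
    then show ?thesis using v(3)[of k] X0 by simp
  qed
  have "(\<lambda>k. \<integral>x. \<bar>v k x - f x\<bar> powr p \<partial>m) \<longlonglongrightarrow> 0"
  proof (rule tendsto_sandwich[OF _ _ tendsto_const Xlim])
    show "\<forall>\<^sub>F k in sequentially. 0 \<le> (\<integral>x. \<bar>v k x - f x\<bar> powr p \<partial>m)"
      by (intro always_eventually allI Bochner_Integration.integral_nonneg) auto
  qed (use Ile in \<open>auto intro: always_eventually\<close>)
  then have "(\<lambda>k. (\<integral>x. \<bar>v k x - f x\<bar> powr p \<partial>m) powr (1 / p)) \<longlonglongrightarrow> 0"
    using p by (intro tendsto_zero_powrI[OF _ tendsto_const])
      (auto intro!: always_eventually Bochner_Integration.integral_nonneg)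
  then have "(\<lambda>k. Lp_norm p m (\<lambda>x. v k x - f x)) \<longlonglongrightarrow> 0" by (simp add: Lp_norm_def)
  then have "Ch p m f \<le> liminf (\<lambda>k. \<integral>\<^sup>+x. ennreal (slope (v k) x powr p) \<partial>m)"
    unfolding Ch_def using v(1) by (intro Inf_lower) blast
  also have "\<dots> \<le> ennreal C"
    using v(2) by (intro order_trans[OF Liminf_le_Limsup Limsup_bounded]) auto
  also have "\<dots> < \<infinity>" by simp
  finally show ?thesis using f by (simp add: W1p_def)
qed


section \<open>The integrands of the theorem and the zero measure\<close>

lemma divide_ball_eq_kern:
  assumes "x \<noteq> y" "0 \<le> c"
  shows "ennreal c / (emeasure m (ball x (dist x y)) * ennreal (dist x y powr p)) = ennreal (c * kern p x y)"
  using assms ball_pos[of "dist x y" x]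
  by (simp add: emeasure_ball ennreal_mult[symmetric] divide_ennreal kern_def)

lemma small_jump_integrand:
  "(if x = y then 0 else ennreal (\<delta> * \<bar>f x - f y\<bar> powr (p + \<delta>)) /
      (emeasure m (ball x (dist x y)) * ennreal (dist x y powr p))) * indicator {y. \<bar>f x - f y\<bar> \<le> 1} y
   = small_jump p \<delta> f x y"
  if "0 < \<delta>"
  using that by (auto simp: small_jump_def divide_ball_eq_kern)

lemma large_jump_integrand:
  fixes f :: "'a \<Rightarrow> real"
  shows "1 / (emeasure m (ball x (dist x y)) * ennreal (dist x y powr p)) * indicator {y. \<bar>f x - f y\<bar> > 1} y
   = large_jump p f x y"
proof (cases "x = y")
  case False
  from divide_ball_eq_kern[OF this, of 1 p] show ?thesis by (simp add: large_jump_def)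
next
  \<comment> \<open>The quotient is infinite on the diagonal, but the indicator vanishes
    there.\<close>
  case True
  then show ?thesis by (auto simp: large_jump_def)
qed

end

text \<open>The doubling and Poincare conditions do not exclude the zero measure, for which ball averages
  divide by 0.\<close>

lemma W1p_null_measure:
  fixes m :: "'a::polish_space measure"
  assumes "emeasure m (space m) = 0" and f: "f \<in> Lp p m"
  shows "f \<in> W1p p m" and "\<And>h. (\<integral>\<^sup>+x. h x \<partial>m) = 0"
proof -
  have ae: "AE x in m. P x" for P
    by (rule AE_I[of _ _ "space m"]) (use assms in auto)
  show nn0: "(\<integral>\<^sup>+x. h x \<partial>m) = 0" for h
    using nn_integral_cong_AE[OF ae[of "\<lambda>x. h x = 0"]] by simp
  have [measurable]: "f \<in> borel_measurable m" using f by (simp add: Lp_def)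
  have "(\<integral>x. \<bar>0 - f x\<bar> powr p \<partial>m) = (\<integral>x. 0 \<partial>m)"
    by (rule integral_cong_AE[OF _ _ ae]) auto
  then have "(\<lambda>k::nat. Lp_norm p m (\<lambda>x. 0 - f x)) \<longlonglongrightarrow> 0" by (simp add: Lp_norm_def)
  moreover have "(\<lambda>x::'a. 0) \<in> LIP_bs \<inter> Lp p m"
    by (auto simp: LIP_bs_def Lp_def intro!: exI[of _ 0] lipschitz_onI)
  ultimately have "Ch p m f \<le> liminf (\<lambda>k::nat. \<integral>\<^sup>+x. ennreal (slope (\<lambda>_. 0) x powr p) \<partial>m)"
    unfolding Ch_def by (intro Inf_lower) (auto intro!: exI[of _ "\<lambda>_ _. 0"])
  then show "f \<in> W1p p m" using f by (simp add: W1p_def nn0 Liminf_const)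
qed

theorem theorem4:
  fixes m :: "'a::polish_space measure" and f :: "'a \<Rightarrow> real" and p :: real
  assumes "1 < p"
    and "PI_space p m"
    and "f \<in> Lp p m"
  shows "f \<in> W1p p m \<longleftrightarrow>
    (SUP \<delta>\<in>{0<..<1::real}.
       \<integral>\<^sup>+x. (\<integral>\<^sup>+y\<in>{y. \<bar>f x - f y\<bar> \<le> 1}.
         (if x = y then 0
          else ennreal (\<delta> * \<bar>f x - f y\<bar> powr (p + \<delta>)) /
               (emeasure m (ball x (dist x y)) * ennreal (dist x y powr p))) \<partial>m) \<partial>m) < \<infinity> \<and>
    (\<integral>\<^sup>+x. (\<integral>\<^sup>+y\<in>{y. \<bar>f x - f y\<bar> > 1}.
         1 / (emeasure m (ball x (dist x y)) * ennreal (dist x y powr p)) \<partial>m) \<partial>m) < \<infinity>"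
  (is "_ \<longleftrightarrow> (SUP \<delta>\<in>_. ?I \<delta>) < \<infinity> \<and> ?J < \<infinity>")
proof -
  have sets_m: "sets m = sets borel" and fin: "\<And>x r. emeasure m (ball x r) < \<infinity>"
    using assms(2) by (auto simp: PI_space_def metric_measure_space_def)
  obtain CD where CD: "0 < CD" "\<And>x r. 0 < r \<Longrightarrow> measure m (ball x (2 * r)) \<le> CD * measure m (ball x r)"
    using assms(2) by (auto simp: PI_space_def uniformly_doubling_def)
  obtain CP where CP: "0 < CP" "\<And>g x r. g \<in> LIP_bs \<Longrightarrow> 0 < r \<Longrightarrow>
      ball_avg m x r (\<lambda>y. \<bar>g y - ball_avg m x r g\<bar>) \<le> CP * r * ball_avg m x r (\<lambda>y. slope g y powr p) powr (1 / p)"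
    using assms(2) by (auto simp: PI_space_def poincare_inequality_def)
  show ?thesis
  proof (cases "\<exists>x r. 0 < r \<and> measure m (ball x r) \<le> 0")
    case True
    then obtain x r where r: "0 < r" "measure m (ball x r) \<le> 0" by blast
    \<comment> \<open>Doubling spreads one null ball over the whole space.\<close>
    have zero: "measure m (ball x (2 ^ n * r)) = 0" for n
    proof (induction n)
      case (Suc n)
      have "measure m (ball x (2 * (2 ^ n * r))) \<le> CD * measure m (ball x (2 ^ n * r))"
        using r by (intro CD) simp
      with Suc show ?case by (simp add: mult.assoc measure_le_0_iff)
    qed (use r in \<open>simp add: measure_le_0_iff\<close>)
    have "emeasure m (ball x (2 ^ n * r)) = 0" for n
      using zero[of n] fin[of x "2 ^ n * r"] emeasure_eq_ennreal_measure[of m "ball x (2 ^ n * r)"] by auto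
    then have "ball x (2 ^ n * r) \<in> null_sets m" for n by (auto simp: sets_m)
    then have "(\<Union>n. ball x (2 ^ n * r)) \<in> null_sets m" by blast
    moreover have "(\<Union>n. ball x (2 ^ n * r)) = space m"
    proof -
      have "\<exists>n. dist x y < 2 ^ n * r" for y
      proof -
        obtain n where "dist x y / r < 2 ^ n" using real_arch_pow[of 2] by auto
        then show ?thesis using r by (auto simp: field_simps)
      qed
      then show ?thesis using sets_eq_imp_space_eq[OF sets_m] by auto
    qed
    ultimately have "emeasure m (space m) = 0" by auto
    from W1p_null_measure[OF this assms(3)] show ?thesis by simp
  next
    case False
    then have pos: "0 < measure m (ball x r)" if "0 < r" for x r using that by (meson not_le)
    interpret poincare_space m CD p CP
      by unfold_locales (use sets_m fin CD CP pos assms(1) in auto)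
    have I: "?I \<delta> = dint (small_jump p \<delta> f)" if "0 < \<delta>" for \<delta>
      using that by (simp only: small_jump_integrand)
    have J: "?J = dint (large_jump p f)"
      by (simp only: large_jump_integrand)
    show ?thesis
    proof
      assume "f \<in> W1p p m"
      then obtain B where B: "0 \<le> B" "\<And>\<delta>. 0 < \<delta> \<Longrightarrow> \<delta> \<le> 1 \<Longrightarrow>
          (\<integral>\<^sup>+x. (\<integral>\<^sup>+y. ennreal (\<delta> * min \<bar>f x - f y\<bar> 1 powr (p + \<delta>) * kern p x y) \<partial>m) \<partial>m) \<le> ennreal B"
        using nonlocal_energy_bounded by blast
      have "?I \<delta> \<le> ennreal B" if "\<delta> \<in> {0<..<1}" for \<delta>
      proof -
        have "?I \<delta> \<le> (\<integral>\<^sup>+x. (\<integral>\<^sup>+y. ennreal (\<delta> * min \<bar>f x - f y\<bar> 1 powr (p + \<delta>) * kern p x y) \<partial>m) \<partial>m)"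
          using that by (subst I) (auto simp: small_jump_def intro!: nn_integral_mono)
        also have "\<dots> \<le> ennreal B" using that by (intro B) auto
        finally show ?thesis .
      qed
      then have "(SUP \<delta>\<in>{0<..<1}. ?I \<delta>) \<le> ennreal B" by (intro SUP_least)
      moreover have "?J \<le> ennreal B"
      proof -
        \<comment> \<open>Take \<delta> = 1: on large jumps the truncated difference is 1, so the
          integrand is the kernel itself.\<close>
        have "?J \<le> (\<integral>\<^sup>+x. (\<integral>\<^sup>+y. ennreal (1 * min \<bar>f x - f y\<bar> 1 powr (p + 1) * kern p x y) \<partial>m) \<partial>m)"
          unfolding J by (intro nn_integral_mono) (auto simp: large_jump_def)
        also have "\<dots> \<le> ennreal B" by (intro B) auto
        finally show ?thesis .
      qed
      ultimately show "(SUP \<delta>\<in>{0<..<1}. ?I \<delta>) < \<infinity> \<and> ?J < \<infinity>"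
        by (auto intro: le_less_trans)
    next
      assume fin: "(SUP \<delta>\<in>{0<..<1}. ?I \<delta>) < \<infinity> \<and> ?J < \<infinity>"
      obtain B1 where B1: "0 \<le> B1" "(SUP \<delta>\<in>{0<..<1}. ?I \<delta>) = ennreal B1"
        using fin by (cases "SUP \<delta>\<in>{0<..<1}. ?I \<delta>" rule: ennreal_cases) auto
      obtain B2 where B2: "0 \<le> B2" "?J = ennreal B2"
        using fin by (cases ?J rule: ennreal_cases) auto
      have "dint (small_jump p \<delta> f) \<le> ennreal B1" if "0 < \<delta>" "\<delta> < 1" for \<delta>
        unfolding B1(2)[symmetric] I[OF that(1), symmetric] using that by (intro SUP_upper) auto
      then have "jump_bound p f B1 B2" using B1(1) B2 J by (simp add: jump_bound_def)
      then show "f \<in> W1p p m" by (rule W1pI[OF assms(3,1)])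
    qed
  qed
qed

end
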